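(* Let $\Omega\subset\mathbb{R}^d$ be a bounded polytopal Lipschitz domain and let $H:\overline\Omega\times\mathbb{R}^d\to\mathbb{R}$ satisfy: (i) $H\in C(\overline\Omega\times\mathbb{R}^d)$; (ii) $p\mapsto H(x,p)$ is convex for all $x\in\overline\Omega$; (iii) $H(x,p)\to\infty$ as $\|p\|\to\infty$, uniformly in $x\in\overline\Omega$; (iv) $H(x,0)<0$ for all $x\in\Omega$. Let $\Sigma_h$, for a sequence $h\to0$, be a shape-regular family of simplicial triangulations of $\Omega$ with regularity constant $\theta\ge 1$. Let $\rho_*\ge 0$ be a constant such that $\rho(x,q)\ge\rho_*\|q\|$ for all $x\in\Omega$, $q\in\mathbb{R}^d$, and let $g:\partial\Omega\to\mathbb{R}$ satisfy \[ g(x)-g(y)\le\frac{\rho_*}{\theta}\|x-y\|\qquad\text{for all }x,y\in\partial\Omega . \] Then, as $h\to0$, the sequence of unique finite-element solutions $u_h\in V_h$ defined by \[ u_h=\Lambda_hu_h,\qquad u_h|_{\partial\Omega_h}=g|_{\partial\Omega_h}, \] converges uniformly to the unique viscosity solution $u$ of the Dirichlet problem \[ H(x,Du(x))=0,\quad x\in\Omega,\qquad u|_{\partial\Omega}=g . \]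
   Context: $\|\cdot\|$ is the Euclidean norm and $\langle\cdot,\cdot\rangle$ the Euclidean inner product on $\mathbb{R}^d$. Support function: $\rho(x,q)=\max_{H(x,p)=0}\langle p,q\rangle=\sup_{H(x,p)\le0}\langle p,q\rangle$ for $x\in\overline\Omega$, $q\in\mathbb{R}^d$. (By continuity, (iv) implies $H(x,0)\le 0$ on $\overline\Omega$, so $\rho$ is well defined.) Triangulations: for a simplex $\sigma\in\Sigma_h$ (closed), $h_1(\sigma)$ is its diameter and $h_0(\sigma)$ the minimal height of a vertex in $\sigma$; $h=\max_{\sigma\in\Sigma_h}h_1(\sigma)$; the family is shape-regular with regularity constant $\theta$ if $1\le h_1(\sigma)/h_0(\sigma)\le\theta$ for all $\sigma\in\Sigma_h$ and all $h$. $V_h$ is the space of continuous functions on $\overline\Omega$ that are affine on each $\sigma\in\Sigma_h$. $\overline\Omega_h,\Omega_h,\partial\Omega_h$ denote the sets of nodal points (vertices of $\Sigma_h$) belonging to $\overline\Omega,\Omega,\partial\Omega$, respectively. For $x_h\in\Omega_h$, $\omega_h(x_h)$ is the interior of the union of all simplices of $\Sigma_h$ that have $x_h$ as a vertex. Hopf–Lax update function: $\Lambda_h:V_h\to V_h$ is given by the nodal values \[ (\Lambda_hu_h)(x_h)=\min_{y\in\partial\omega_h(x_h)}\bigl(u_h(y)+\rho(x_h,x_h-y)\bigr)\ \ (x_h\in\Omega_h),\qquad(\Lambda_hu_h)(x_h)=u_h(x_h)\ \ (x_h\in\partial\Omega_h). \] Viscosity solutions: $u\in C^{0,1}(\overline\Omega)$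 is a viscosity subsolution (supersolution) of $H(x,Du(x))=0$, $x\in\Omega$, if for all $v\in C_0^\infty(\Omega)$ such that $u-v$ attains a local maximum (minimum) at some $x_0\in\Omega$ one has $H(x_0,Dv(x_0))\le0$ ($\ge0$). A viscosity solution is a function that is both a viscosity sub- and supersolution; for the Dirichlet problem it must also satisfy $u=g$ on $\partial\Omega$. *)

theory Defs
  imports "HOL-Analysis.Analysis"
begin

(* Functions on the closure of Omega are represented as total functions. Where uniqueness
   matters they are taken from extensional (closure Omega), so that equality of representatives
   is equality on the closure of Omega. *)

text \<open>Near each boundary point the set is, in suitable orthogonal coordinates, the region strictly
  above a Lipschitz graph. The unit vector \<open>e\<close> is the vertical direction of these coordinates,
  and \<open>\<gamma>\<close> is a function on the orthogonal complement of \<open>e\<close>.\<close>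

definition lipschitz_boundary :: "'a::euclidean_space set \<Rightarrow> bool" where
  "lipschitz_boundary \<Omega> \<longleftrightarrow>
     (\<forall>x0\<in>frontier \<Omega>. \<exists>r>0. \<exists>e. norm e = 1 \<and> (\<exists>L (\<gamma>::'a \<Rightarrow> real).
        L-lipschitz_on {z. z \<bullet> e = 0} \<gamma> \<and>
        \<Omega> \<inter> ball x0 r = {x \<in> ball x0 r. \<gamma> (x - (x \<bullet> e) *\<^sub>R e) < x \<bullet> e}))"

definition polytopal_lipschitz_domain :: "'a::euclidean_space set \<Rightarrow> bool" where
  "polytopal_lipschitz_domain \<Omega> \<longleftrightarrow>
     open \<Omega> \<and> connected \<Omega> \<and> \<Omega> \<noteq> {} \<and> lipschitz_boundary \<Omega> \<and>
     (\<exists>\<P>. finite \<P> \<and> (\<forall>P\<in>\<P>. polytope P) \<and> closure \<Omega> = \<Union>\<P>)"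

definition support_fun :: "('a::euclidean_space \<Rightarrow> 'a \<Rightarrow> real) \<Rightarrow> 'a \<Rightarrow> 'a \<Rightarrow> real" where
  "support_fun H x q = (SUP p\<in>{p. H x p \<le> 0}. p \<bullet> q)"

text \<open>The supremum over the sublevel set is a maximum, and it is attained on the level set.\<close>

lemma support_fun_max:
  fixes H :: "'a::euclidean_space \<Rightarrow> 'a \<Rightarrow> real"
  assumes cont: "continuous_on UNIV (H x)"
    and coercive: "filterlim (H x) at_top at_infinity"
    and zero: "H x 0 \<le> 0"
  shows "\<exists>p. H x p = 0 \<and> support_fun H x q = p \<bullet> q \<and> (\<forall>p'. H x p' \<le> 0 \<longrightarrow> p' \<bullet> q \<le> p \<bullet> q)"
proof -
  let ?S = "{p. H x p \<le> 0}"
  have ev: "\<forall>\<^sub>F p in at_infinity. H x p > 0"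
    using coercive by (simp add: filterlim_at_top_dense)
  then obtain R where R: "\<And>p. R \<le> norm p \<Longrightarrow> H x p > 0"
    by (auto simp: eventually_at_infinity)
  have "?S \<subseteq> cball 0 R"
    using R by (auto simp: subset_iff) (meson linorder_linear not_le)
  then have "bounded ?S"
    using bounded_cball bounded_subset by blast
  moreover have "closed ?S"
    using closed_Collect_le[OF cont continuous_on_const] by simp
  ultimately have "compact ?S"
    by (simp add: compact_eq_bounded_closed)
  moreover have "?S \<noteq> {}"
    using zero by blast
  moreover have "continuous_on ?S (\<lambda>p. p \<bullet> q)"
    by (intro continuous_intros)
  ultimately obtain m where m: "H x m \<le> 0" "\<And>p. H x p \<le> 0 \<Longrightarrow> p \<bullet> q \<le> m \<bullet> q"
    using continuous_attains_sup[of ?S "\<lambda>p. p \<bullet> q"] by auto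
  obtain d where d: "norm d > 0" "d \<bullet> q \<ge> 0"
  proof (cases "q = 0")
    case True
    then show ?thesis using that[of "SOME i. i \<in> Basis"] by (simp add: SOME_Basis)
  next
    case False
    then show ?thesis using that[of q] by simp
  qed
  define T where "T = (\<bar>R\<bar> + norm m) / norm d"
  have T0: "0 \<le> T"
    using d by (simp add: T_def)
  have "norm (T *\<^sub>R d) = \<bar>R\<bar> + norm m"
    using d T0 by (simp add: T_def)
  then have "R \<le> norm (m + T *\<^sub>R d)"
    using norm_triangle_ineq4[of "m + T *\<^sub>R d" m] by simp
  then have T1: "H x (m + T *\<^sub>R d) \<ge> 0"
    using R less_imp_le by blast
  have "continuous_on {0..T} (\<lambda>t. H x (m + t *\<^sub>R d))"
    by (intro continuous_on_compose2[OF cont] continuous_intros) auto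
  then obtain t where t: "0 \<le> t" "H x (m + t *\<^sub>R d) = 0"
    using IVT'[of "\<lambda>t. H x (m + t *\<^sub>R d)" 0 0 T] m T0 T1 by auto
  have ge: "m \<bullet> q \<le> (m + t *\<^sub>R d) \<bullet> q"
    using t d by (simp add: inner_add_left)
  have max: "\<And>p. H x p \<le> 0 \<Longrightarrow> p \<bullet> q \<le> (m + t *\<^sub>R d) \<bullet> q"
    using m ge order_trans by blast
  have "support_fun H x q = (m + t *\<^sub>R d) \<bullet> q"
    unfolding support_fun_def
    by (rule cSup_eq_maximum) (use t max in auto)
  then show ?thesis
    using t max by blast
qed

definition triangulation_of :: "'a::euclidean_space set \<Rightarrow> 'a set set \<Rightarrow> bool" where
  "triangulation_of \<Omega> \<Sigma> \<longleftrightarrow>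
     triangulation \<Sigma> \<and> (\<forall>\<sigma>\<in>\<Sigma>. int DIM('a) simplex \<sigma>) \<and> \<Union>\<Sigma> = closure \<Omega>"

definition vertices :: "'a::euclidean_space set \<Rightarrow> 'a set" where
  "vertices \<sigma> = {v. v extreme_point_of \<sigma>}"

definition nodes :: "'a::euclidean_space set set \<Rightarrow> 'a set" where
  "nodes \<Sigma> = (\<Union>\<sigma>\<in>\<Sigma>. vertices \<sigma>)"

text \<open>The height of a vertex is its distance to the hyperplane spanned by the opposite facet.\<close>

definition min_height :: "'a::euclidean_space set \<Rightarrow> real" where
  "min_height \<sigma> = Min ((\<lambda>v. infdist v (affine hull (vertices \<sigma> - {v}))) ` vertices \<sigma>)"

definition mesh_size :: "'a::euclidean_space set set \<Rightarrow> real" where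
  "mesh_size \<Sigma> = Max (diameter ` \<Sigma>)"

definition shape_regular :: "real \<Rightarrow> 'a::euclidean_space set set \<Rightarrow> bool" where
  "shape_regular \<theta> \<Sigma> \<longleftrightarrow>
     (\<forall>\<sigma>\<in>\<Sigma>. 1 \<le> diameter \<sigma> / min_height \<sigma> \<and> diameter \<sigma> / min_height \<sigma> \<le> \<theta>)"

definition fe_space :: "'a::euclidean_space set \<Rightarrow> 'a set set \<Rightarrow> ('a \<Rightarrow> real) set" where
  "fe_space \<Omega> \<Sigma> = {u \<in> extensional (closure \<Omega>). continuous_on (closure \<Omega>) u \<and>
     (\<forall>\<sigma>\<in>\<Sigma>. \<exists>a c. \<forall>x\<in>\<sigma>. u x = a \<bullet> x + c)}"

definition patch :: "'a::euclidean_space set set \<Rightarrow> 'a \<Rightarrow> 'a set" where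
  "patch \<Sigma> x = interior (\<Union>{\<sigma>\<in>\<Sigma>. x \<in> vertices \<sigma>})"

text \<open>Hopf--Lax update: the finite element function with the prescribed nodal values. At a node in
  \<open>\<Omega>\<close> the infimum is a minimum, because the boundary of the patch is compact and nonempty, and
  \<open>u\<close> and \<open>support_fun H x\<close> are continuous there.\<close>

definition hopf_lax ::
  "'a::euclidean_space set \<Rightarrow> ('a \<Rightarrow> 'a \<Rightarrow> real) \<Rightarrow> 'a set set \<Rightarrow> ('a \<Rightarrow> real) \<Rightarrow> ('a \<Rightarrow> real)" where
  "hopf_lax \<Omega> H \<Sigma> u = (THE w. w \<in> fe_space \<Omega> \<Sigma> \<and>
     (\<forall>x\<in>nodes \<Sigma> \<inter> \<Omega>. w x = (INF y\<in>frontier (patch \<Sigma> x). u y + support_fun H x (x - y))) \<and>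
     (\<forall>x\<in>nodes \<Sigma> \<inter> frontier \<Omega>. w x = u x))"

definition fe_solution ::
  "'a::euclidean_space set \<Rightarrow> ('a \<Rightarrow> 'a \<Rightarrow> real) \<Rightarrow> ('a \<Rightarrow> real) \<Rightarrow> 'a set set \<Rightarrow> ('a \<Rightarrow> real) \<Rightarrow> bool"
  where
  "fe_solution \<Omega> H g \<Sigma> u \<longleftrightarrow>
     u \<in> fe_space \<Omega> \<Sigma> \<and> u = hopf_lax \<Omega> H \<Sigma> u \<and> (\<forall>x\<in>nodes \<Sigma> \<inter> frontier \<Omega>. u x = g x)"

text \<open>\<open>C_k k v\<close>: \<open>v\<close> is \<open>k\<close> times continuously differentiable on the whole space.\<close>

primrec C_k :: "nat \<Rightarrow> ('a::euclidean_space \<Rightarrow> real) \<Rightarrow> bool" where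
  "C_k 0 v \<longleftrightarrow> continuous_on UNIV v"
| "C_k (Suc k) v \<longleftrightarrow>
     (\<forall>x. v differentiable (at x)) \<and> (\<forall>b\<in>Basis. C_k k (\<lambda>x. frechet_derivative v (at x) b))"

definition test_functions :: "'a::euclidean_space set \<Rightarrow> ('a \<Rightarrow> real) set" where
  "test_functions \<Omega> = {v. (\<forall>k. C_k k v) \<and>
     compact (closure (support_on UNIV v)) \<and> closure (support_on UNIV v) \<subseteq> \<Omega>}"

definition local_max_at :: "'a::topological_space set \<Rightarrow> ('a \<Rightarrow> real) \<Rightarrow> 'a \<Rightarrow> bool" where
  "local_max_at \<Omega> f x0 \<longleftrightarrow> x0 \<in> \<Omega> \<and> (\<forall>\<^sub>F x in at x0 within \<Omega>. f x \<le> f x0)"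

definition local_min_at :: "'a::topological_space set \<Rightarrow> ('a \<Rightarrow> real) \<Rightarrow> 'a \<Rightarrow> bool" where
  "local_min_at \<Omega> f x0 \<longleftrightarrow> x0 \<in> \<Omega> \<and> (\<forall>\<^sub>F x in at x0 within \<Omega>. f x0 \<le> f x)"

definition viscosity_subsolution ::
  "'a::euclidean_space set \<Rightarrow> ('a \<Rightarrow> 'a \<Rightarrow> real) \<Rightarrow> ('a \<Rightarrow> real) \<Rightarrow> bool" where
  "viscosity_subsolution \<Omega> H u \<longleftrightarrow>
     (\<exists>L. L-lipschitz_on (closure \<Omega>) u) \<and>
     (\<forall>v\<in>test_functions \<Omega>. \<forall>x0 p.
        local_max_at \<Omega> (\<lambda>x. u x - v x) x0 \<longrightarrow> GDERIV v x0 :> p \<longrightarrow> H x0 p \<le> 0)"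

definition viscosity_supersolution ::
  "'a::euclidean_space set \<Rightarrow> ('a \<Rightarrow> 'a \<Rightarrow> real) \<Rightarrow> ('a \<Rightarrow> real) \<Rightarrow> bool" where
  "viscosity_supersolution \<Omega> H u \<longleftrightarrow>
     (\<exists>L. L-lipschitz_on (closure \<Omega>) u) \<and>
     (\<forall>v\<in>test_functions \<Omega>. \<forall>x0 p.
        local_min_at \<Omega> (\<lambda>x. u x - v x) x0 \<longrightarrow> GDERIV v x0 :> p \<longrightarrow> H x0 p \<ge> 0)"

definition dirichlet_viscosity_solution ::
  "'a::euclidean_space set \<Rightarrow> ('a \<Rightarrow> 'a \<Rightarrow> real) \<Rightarrow> ('a \<Rightarrow> real) \<Rightarrow> ('a \<Rightarrow> real) \<Rightarrow> bool" where
  "dirichlet_viscosity_solution \<Omega> H g u \<longleftrightarrow>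
     u \<in> extensional (closure \<Omega>) \<and>
     viscosity_subsolution \<Omega> H u \<and> viscosity_supersolution \<Omega> H u \<and>
     (\<forall>x\<in>frontier \<Omega>. u x = g x)"

end

theory Submission
  imports Defs "HOL-Complex_Analysis.Great_Picard"
begin

text \<open>Discrete sub- and supersolutions obey a comparison principle: among the nodes maximizing
  \<open>u - v\<close>, one with the smallest value of \<open>v\<close> cannot lie in \<open>\<Omega>\<close>, since the minimizing \<open>y\<close> in the
  update of \<open>v\<close> would have a smaller value of \<open>v\<close>, and hence so would a vertex that contributes to it.
  Perron's method then gives the discrete solutions. Comparison with the interpolants of the cones
  \<open>g z - \<rho>\<^sub>s / \<theta> * norm (x - z)\<close>, which are discrete subsolutions by shape regularity, controls the
  solutions near the boundary and yields a Lipschitz bound on segments, uniformly in the mesh; on a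
  Lipschitz domain this is a global Lipschitz bound. By the Arzela-Ascoli theorem a subsequence
  converges uniformly. The limit is a viscosity solution because the Hopf--Lax update is consistent:
  the distance from a node to the boundary of its patch is comparable to the diameters of the simplices
  of that patch that are met there, so quadratic interpolation errors are of higher order. Uniqueness
  follows by doubling of variables after scaling the subsolution by a factor \<open>s < 1\<close>, which makes it
  strict because \<open>H x\<close> is convex and \<open>H x 0 < 0\<close>.\<close>

section \<open>Test functions and second-order jets\<close>

text \<open>The update minimizes over the whole boundary of a patch, so its minimizer
  \<open>y\<close> is in general not a node. The fact that carries the proof is that
  \<open>y\<close> lies on a facet opposite \<open>x\<close>, which makes
  \<open>norm (x - y)\<close> at least the height of that simplex over this facet. Hence an
  interpolated cone of slope \<open>\<rho>\<^sub>s / \<theta>\<close>, which drops by at most this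
  slope times a diameter, drops by at most \<open>\<rho>\<^sub>s * norm (x - y)\<close>, a lower
  bound for the cost of the step. This explains the Lipschitz constant
  \<open>\<rho>\<^sub>s / \<theta>\<close> of the boundary data. Viscosity solutions are tested with
  compactly supported smooth functions, while doubling of variables and interpolation produce
  one-sided quadratic bounds; so both notions are first rewritten with quadratics. Existence for the
  Dirichlet problem gets no argument of its own: a limit of discrete solutions is the solution.
  \<open>H x 0\<close> may vanish on the boundary, so the comparison argument must keep its limit
  point inside \<Omega>; the scaling factor is taken close enough to 1 for that.\<close>

definition flat_exp :: "nat \<Rightarrow> real \<Rightarrow> real" where
  "flat_exp n t = (if t > 0 then exp (- (1 / t)) / t ^ n else 0)"

text \<open>The derivative stays in the span of the family, which is why the index \<open>n\<close>
  is carried along. At 0 the exponential beats every power, so all one-sided difference quotients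
  vanish there.\<close>

lemma has_real_derivative_flat_exp:
  "(flat_exp n has_real_derivative flat_exp (n + 2) t - real n * flat_exp (n + 1) t) (at t)"
proof -
  consider "t > 0" | "t < 0" | "t = 0" by linarith
  then show ?thesis
  proof cases
    case 1
    have "((\<lambda>t. exp (- (1 / t)) / t ^ n) has_real_derivative
            flat_exp (n + 2) t - real n * flat_exp (n + 1) t) (at t)"
    proof (cases n)
      case 0
      then show ?thesis
        using 1 by (auto intro!: derivative_eq_intros simp: flat_exp_def field_simps power2_eq_square)
    next
      case (Suc m)
      moreover have "m = 0 \<or> t ^ m = t * t ^ (m - Suc 0)" by (cases m) auto
      ultimately show ?thesis
        using 1 by (auto intro!: derivative_eq_intros simp: flat_exp_def field_simps power2_eq_square)
    qed
    then show ?thesis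
      by (rule DERIV_cong_ev[OF refl _ refl, THEN iffD1, rotated])
        (use 1 in \<open>auto simp: flat_exp_def eventually_nhds intro!: exI[of _ "{0<..}"]\<close>)
  next
    case 2
    have "((\<lambda>t. 0) has_real_derivative 0) (at t)" by simp
    then have "(flat_exp n has_real_derivative 0) (at t)"
      by (rule DERIV_cong_ev[OF refl _ refl, THEN iffD1, rotated])
        (use 2 in \<open>auto simp: flat_exp_def eventually_nhds intro!: exI[of _ "{..<0}"]\<close>)
    then show ?thesis using 2 by (simp add: flat_exp_def)
  next
    case 3
    \<comment> \<open>This is the difference quotient at 0 from the right, in the variable
      \<open>inverse h\<close>, which tends to infinity.\<close>
    have "((\<lambda>h::real. inverse h ^ (n + 1) / exp (inverse h)) \<longlongrightarrow> 0) (at_right 0)"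
      by (rule filterlim_compose[OF tendsto_power_div_exp_0 filterlim_inverse_at_top_right])
    then have R: "((\<lambda>h. flat_exp n h / h) \<longlongrightarrow> 0) (at_right 0)"
      by (rule Lim_transform_eventually)
        (auto simp: eventually_at_right_field flat_exp_def field_simps exp_minus intro!: exI[of _ 1])
    have L: "((\<lambda>h. flat_exp n h / h) \<longlongrightarrow> 0) (at_left 0)"
      by (rule Lim_transform_eventually[OF tendsto_const])
        (auto simp: eventually_at_left_field flat_exp_def intro!: exI[of _ "-1"])
    have "((\<lambda>h. flat_exp n h / h) \<longlongrightarrow> 0) (at 0)"
      using L R by (simp add: filterlim_split_at)
    then have "(flat_exp n has_real_derivative 0) (at 0)"
      by (simp add: DERIV_def flat_exp_def)
    then show ?thesis using 3 by (simp add: flat_exp_def)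
  qed
qed

text \<open>Smoothness by an invariant class: closure under partial derivatives replaces the
  computation of derivatives of order \<open>k\<close>.\<close>

lemma C_kI:
  assumes "v \<in> S"
    and "\<And>v. v \<in> S \<Longrightarrow> \<exists>D. (\<forall>x. (v has_derivative D x) (at x)) \<and> (\<forall>b\<in>Basis. (\<lambda>x. D x b) \<in> S)"
  shows "C_k k v"
  using assms(1)
proof (induction k arbitrary: v)
  case 0
  then obtain D where "\<forall>x. (v has_derivative D x) (at x)" using assms(2) by blast
  then show ?case
    using has_derivative_continuous_on[of UNIV v D] by simp
next
  case (Suc k)
  then obtain D where D: "\<forall>x. (v has_derivative D x) (at x)" "\<forall>b\<in>Basis. (\<lambda>x. D x b) \<in> S"
    using assms(2) by blast
  then have "frechet_derivative v (at x) = D x" for x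
    using frechet_derivative_at by metis
  then show ?case
    using D Suc.IH by (auto simp: differentiable_def)
qed

lemma real_polynomial_function_has_derivative:
  assumes "real_polynomial_function f"
  obtains D where "\<And>x. (f has_derivative D x) (at x)" "\<And>b. real_polynomial_function (\<lambda>x. D x b)"
  using assms
proof (induction f arbitrary: thesis rule: real_polynomial_function.induct)
  case (linear f)
  show ?case
    by (rule linear(2)[of "\<lambda>_. f"])
      (use linear in \<open>auto intro: bounded_linear_imp_has_derivative\<close>)
next
  case (const c)
  show ?case by (rule const[of "\<lambda>_ _. 0"]) auto
next
  case (add f g)
  obtain D where D: "\<And>x. (f has_derivative D x) (at x)" "\<And>b. real_polynomial_function (\<lambda>x. D x b)"
    using add.IH(1) by blast
  obtain E where E: "\<And>x. (g has_derivative E x) (at x)" "\<And>b. real_polynomial_function (\<lambda>x. E x b)"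
    using add.IH(2) by blast
  show ?case
    by (rule add.prems[of "\<lambda>x b. D x b + E x b"]) (use D E in \<open>auto intro: has_derivative_add\<close>)
next
  case (mult f g)
  obtain D where D: "\<And>x. (f has_derivative D x) (at x)" "\<And>b. real_polynomial_function (\<lambda>x. D x b)"
    using mult.IH(1) by blast
  obtain E where E: "\<And>x. (g has_derivative E x) (at x)" "\<And>b. real_polynomial_function (\<lambda>x. E x b)"
    using mult.IH(2) by blast
  show ?case
    by (rule mult.prems[of "\<lambda>x b. f x * E x b + D x b * g x"])
      (use D E mult.hyps in \<open>auto intro!: has_derivative_mult real_polynomial_function.intros(3,4)\<close>)
qed

text \<open>A class of functions that is closed under partial derivatives and contains the bumps.\<close>

inductive flat_class :: "('a::euclidean_space \<Rightarrow> real) \<Rightarrow> ('a \<Rightarrow> real) \<Rightarrow> bool"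
  for q :: "'a \<Rightarrow> real" where
  base: "real_polynomial_function m \<Longrightarrow> flat_class q (\<lambda>x. flat_exp n (q x) * m x)"
| add: "flat_class q f \<Longrightarrow> flat_class q g \<Longrightarrow> flat_class q (\<lambda>x. f x + g x)"

lemma C_k_flat_class:
  assumes q: "real_polynomial_function q" and "flat_class q v"
  shows "C_k k v"
proof (rule C_kI[where S = "{v. flat_class q v}"])
  obtain Q where Q: "\<And>x. (q has_derivative Q x) (at x)" "\<And>b. real_polynomial_function (\<lambda>x. Q x b)"
    using real_polynomial_function_has_derivative[OF q] by blast
  fix f assume "f \<in> {v. flat_class q v}"
  then have "flat_class q f" by simp
  then show "\<exists>D. (\<forall>x. (f has_derivative D x) (at x)) \<and> (\<forall>b\<in>Basis. (\<lambda>x. D x b) \<in> {v. flat_class q v})"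
  proof induction
    case (base m n)
    then obtain M where M: "\<And>x. (m has_derivative M x) (at x)" "\<And>b. real_polynomial_function (\<lambda>x. M x b)"
      using real_polynomial_function_has_derivative by blast
    define D where "D x b = flat_exp n (q x) * M x b + (flat_exp (n + 2) (q x) * (Q x b * m x)
       + flat_exp (n + 1) (q x) * (- real n * (Q x b * m x)))" for x b
    have "((\<lambda>x. flat_exp n (q x) * m x) has_derivative D x) (at x)" for x
    proof -
      have "((\<lambda>x. flat_exp n (q x)) has_derivative
          (\<lambda>b. Q x b * (flat_exp (n + 2) (q x) - real n * flat_exp (n + 1) (q x)))) (at x)"
        by (rule DERIV_compose_FDERIV[OF has_real_derivative_flat_exp Q(1)])
      from has_derivative_mult[OF this M(1)] show ?thesis
        by (rule has_derivative_eq_rhs) (auto simp: D_def algebra_simps)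
    qed
    moreover have "flat_class q (\<lambda>x. D x b)" for b
      unfolding D_def
      by (intro flat_class.intros real_polynomial_function.intros(2,4) M(2) Q(2) base)
    ultimately show ?case by blast
  next
    case (add f g)
    then obtain D E where "\<forall>x. (f has_derivative D x) (at x)" "\<forall>b\<in>Basis. flat_class q (\<lambda>x. D x b)"
      "\<forall>x. (g has_derivative E x) (at x)" "\<forall>b\<in>Basis. flat_class q (\<lambda>x. E x b)"
      by auto
    then show ?case
      by (intro exI[of _ "\<lambda>x b. D x b + E x b"]) (auto intro: has_derivative_add flat_class.add)
  qed
qed (use assms in simp)

lemma real_polynomial_function_inner_diff [intro]:
  "real_polynomial_function (\<lambda>x::'a::euclidean_space. (x - a) \<bullet> (x - b))"
  "real_polynomial_function (\<lambda>x::'a::euclidean_space. p \<bullet> (x - b))"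
proof -
  have 1: "real_polynomial_function (\<lambda>x::'a. (x - a) \<bullet> i)" for a i
    using real_polynomial_function_diff[OF real_polynomial_function.intros(1)[OF bounded_linear_inner_left[of i]]
      real_polynomial_function.intros(2)[of "a \<bullet> i"]] by (simp add: inner_diff_left)
  then show "real_polynomial_function (\<lambda>x::'a. p \<bullet> (x - b))"
    using 1[of b p] by (simp add: inner_commute)
  show "real_polynomial_function (\<lambda>x::'a. (x - a) \<bullet> (x - b))"
    by (subst euclidean_inner) (auto intro!: real_polynomial_function_sum real_polynomial_function.intros(4) 1)
qed

text \<open>A quadratic has no compact support, so it is multiplied by a bump that equals 1 at
  \<open>x0\<close>. The bump falls by at most a multiple of the squared distance, and a larger
  quadratic coefficient makes up for the loss.\<close>

lemma test_function_above_quadratic: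
  fixes \<Omega> :: "'a::euclidean_space set"
  assumes "open \<Omega>" "x0 \<in> \<Omega>"
  obtains v where "v \<in> test_functions \<Omega>" "GDERIV v x0 :> p"
    "\<forall>\<^sub>F x in nhds x0. v x0 + p \<bullet> (x - x0) + K * (norm (x - x0))\<^sup>2 \<le> v x"
proof -
  obtain r where r: "r > 0" "cball x0 r \<subseteq> \<Omega>"
    using assms open_contains_cball by blast
  \<comment> \<open>With \<open>s\<close> the squared distance to \<open>x0\<close>, the exponent
    falls by \<open>s / (r\<^sup>2 * (r\<^sup>2 - s))\<close>, which is at most
    \<open>2 * s / r^4\<close> as soon as \<open>s \<le> r\<^sup>2 / 2\<close>.\<close>
  define c where "c = 2 / r^4"
  define q where "q x = r\<^sup>2 - (x - x0) \<bullet> (x - x0)" for x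
  \<comment> \<open>The constant 1 keeps \<open>m\<close> between 0 and 2 near \<open>x0\<close>.
    The loss is then at most \<open>c * s * 2\<close>, which the extra coefficient
    \<open>2 * c\<close> absorbs.\<close>
  define m where "m x = 1 + (p \<bullet> (x - x0) + (K + 2 * c) * ((x - x0) \<bullet> (x - x0)))" for x
  define v where "v x = flat_exp 0 (q x) * (exp (1 / r\<^sup>2) * m x)" for x
  have c: "c > 0" using r by (simp add: c_def)
  have pq: "real_polynomial_function q"
    unfolding q_def
    by (intro real_polynomial_function_diff real_polynomial_function.intros(2) real_polynomial_function_inner_diff)
  have pm: "real_polynomial_function m"
    unfolding m_def
    by (intro real_polynomial_function.intros(2-4) real_polynomial_function_inner_diff)
  have "flat_class q v"
    unfolding v_def using pm by (intro flat_class.intros real_polynomial_function.intros(2,4))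
  then have Ck: "C_k k v" for k
    using C_k_flat_class[OF pq] by blast
  have "support_on UNIV v \<subseteq> cball x0 r"
  proof
    fix x assume "x \<in> support_on UNIV v"
    then have "q x > 0" by (auto simp: support_on_def v_def flat_exp_def split: if_splits)
    then have "(norm (x - x0))\<^sup>2 < r\<^sup>2" by (simp add: q_def power2_norm_eq_inner)
    then show "x \<in> cball x0 r"
      using r by (simp add: dist_norm norm_minus_commute power2_less_imp_less less_imp_le)
  qed
  then have "closure (support_on UNIV v) \<subseteq> cball x0 r"
    by (simp add: closure_minimal)
  then have "v \<in> test_functions \<Omega>"
    using Ck r(2) by (auto simp: test_functions_def compact_eq_bounded_closed
      intro: bounded_subset[OF bounded_cball])
  moreover have "GDERIV v x0 :> p"
  proof -
    have dq: "(q has_derivative (\<lambda>h. 0)) (at x0)"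
      unfolding q_def by (auto intro!: derivative_eq_intros)
    have dm: "(m has_derivative (\<lambda>h. p \<bullet> h)) (at x0)"
      unfolding m_def by (auto intro!: derivative_eq_intros)
    have 1: "((\<lambda>x. flat_exp 0 (q x)) has_derivative (\<lambda>h. 0)) (at x0)"
      by (rule has_derivative_eq_rhs[OF DERIV_compose_FDERIV[OF has_real_derivative_flat_exp dq]]) simp
    have 2: "((\<lambda>x. exp (1 / r\<^sup>2) * m x) has_derivative (\<lambda>h. exp (1 / r\<^sup>2) * (p \<bullet> h))) (at x0)"
      by (intro has_derivative_mult_right dm)
    have "flat_exp 0 (q x0) * exp (1 / r\<^sup>2) = 1"
      using r by (simp add: flat_exp_def q_def exp_minus)
    then have "(v has_derivative (\<lambda>h. p \<bullet> h)) (at x0)"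
      unfolding v_def
      by (intro has_derivative_eq_rhs[OF has_derivative_mult[OF 1 2]]) (simp flip: mult.assoc)
    then show ?thesis by (simp add: gderiv_def inner_commute)
  qed
  moreover have "\<forall>\<^sub>F x in nhds x0. v x0 + p \<bullet> (x - x0) + K * (norm (x - x0))\<^sup>2 \<le> v x"
  proof -
    have cm: "isCont m x0" 
      unfolding m_def by (intro continuous_intros)
    have m1: "m x0 = 1" by (simp add: m_def)
    have "\<forall>\<^sub>F x in nhds x0. 0 < m x \<and> m x < 2"
      using order_tendstoD(1)[OF isContD[OF cm], of 0] order_tendstoD(2)[OF isContD[OF cm], of 2] m1
      by (simp add: eventually_nhds_conv_at eventually_conj_iff)
    moreover have "\<forall>\<^sub>F x in nhds x0. dist x x0 < r / 2"
      using r by (auto simp: eventually_nhds_metric intro!: exI[of _ "r / 2"])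
    ultimately show ?thesis
    proof eventually_elim
      case (elim x)
      define s where "s = (norm (x - x0))\<^sup>2"
      have "s \<le> (r/2)\<^sup>2"
        unfolding s_def using elim by (intro power_mono) (auto simp: dist_norm)
      moreover have "0 \<le> s" by (simp add: s_def)
      ultimately have s: "0 \<le> s" "s \<le> r\<^sup>2 / 2" by (simp_all add: power_divide)
      have qx: "q x = r\<^sup>2 - s" by (simp add: q_def s_def power2_norm_eq_inner)
      have r2: "r\<^sup>2 > 0" using r by simp
      have "1 / R - 1 / (R - s) = - (s / (R * (R - s)))" if "R > 0" "R - s > 0" for R
        using that by (simp add: field_simps)
      moreover have sr: "r\<^sup>2 - s > 0" using s r2 by linarith
      ultimately have "1 / r\<^sup>2 - 1 / (r\<^sup>2 - s) = - (s / (r\<^sup>2 * (r\<^sup>2 - s)))"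
        using r2 by blast
      also have "\<dots> \<ge> - (c * s)"
      proof -
        have "s / (r\<^sup>2 * (r\<^sup>2 - s)) \<le> s / (r\<^sup>2 * (r\<^sup>2 / 2))"
          using s r2 sr by (intro divide_left_mono mult_left_mono mult_pos_pos) auto
        also have "\<dots> = c * s"
          by (simp add: c_def power4_eq_xxxx power2_eq_square mult_ac)
        finally show ?thesis by simp
      qed
      finally have "1 - c * s \<le> exp (1 / r\<^sup>2 - 1 / (r\<^sup>2 - s))"
        using exp_ge_add_one_self[of "1 / r\<^sup>2 - 1 / (r\<^sup>2 - s)"] by linarith
      also have "\<dots> = flat_exp 0 (q x) * exp (1 / r\<^sup>2)"
        using sr by (simp add: flat_exp_def qx exp_diff exp_minus divide_inverse)
      finally have "(1 - c * s) * m x \<le> v x"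
        using elim by (simp add: v_def mult_right_mono flip: mult.assoc)
      moreover have "c * s * m x \<le> c * s * 2"
        using elim s c by (intro mult_left_mono) auto
      moreover have "v x0 = 1"
        using r by (simp add: v_def m_def flat_exp_def q_def exp_minus)
      moreover have "m x = 1 + p \<bullet> (x - x0) + K * s + 2 * c * s"
        by (simp add: m_def s_def power2_norm_eq_inner algebra_simps)
      ultimately show ?case by (simp add: algebra_simps s_def[symmetric])
    qed
  qed
  ultimately show ?thesis using that by blast
qed

lemma test_functions_uminus:
  assumes "v \<in> test_functions \<Omega>"
  shows "(\<lambda>x. - v x) \<in> test_functions \<Omega>"
proof -
  have "C_k k v \<Longrightarrow> C_k k (\<lambda>x. - v x)" for k and v :: "'a \<Rightarrow> real"
  proof (induction k arbitrary: v)
    case 0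
    then show ?case by (auto intro: continuous_on_minus)
  next
    case (Suc k)
    then have d: "v differentiable (at x)" for x by simp
    then have "frechet_derivative (\<lambda>x. - v x) (at x) b = - frechet_derivative v (at x) b" for x b
      using frechet_derivative_at[OF has_derivative_minus[OF frechet_derivative_works[THEN iffD1, OF d]]]
      by metis
    then show ?case using Suc by simp
  qed
  then show ?thesis using assms by (auto simp: test_functions_def support_on_def)
qed

text \<open>Taylor's bound without a Hessian: differentiability of the partial derivatives at
  \<open>x0\<close> bounds the change of the gradient linearly in the distance, and the mean value
  inequality on the segment from \<open>x0\<close> gives one more factor of the distance.\<close>

lemma C_2_quadratic_bound:
  fixes v :: "'a::euclidean_space \<Rightarrow> real"
  assumes "C_k 2 v" "GDERIV v x0 :> p"
  obtains K where "K \<ge> 0" "\<forall>\<^sub>F x in nhds x0. \<bar>v x - v x0 - p \<bullet> (x - x0)\<bar> \<le> K * (norm (x - x0))\<^sup>2"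
proof -
  define D where "D x = frechet_derivative v (at x)" for x
  have vd: "(v has_derivative D x) (at x)" for x
    using assms(1) by (simp add: D_def numeral_2_eq_2 frechet_derivative_works)
  have Dp: "D x0 = (\<lambda>h. p \<bullet> h)"
    using has_derivative_unique[OF vd assms(2)[unfolded gderiv_def]] by (auto simp: inner_commute)
  have "\<exists>L. \<forall>\<^sub>F x in nhds x0. \<bar>D x b - D x0 b\<bar> \<le> L * norm (x - x0)" if b: "b \<in> Basis" for b
  proof -
    have "(\<lambda>x. D x b) differentiable (at x0)"
      using assms(1) b by (simp add: D_def numeral_2_eq_2)
    then obtain E where E: "((\<lambda>x. D x b) has_derivative E) (at x0)"
      by (auto simp: differentiable_def)
    then obtain d where d: "d > 0" "\<And>x. norm (x - x0) < d \<Longrightarrow>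
        norm (D x b - D x0 b - E (x - x0)) \<le> 1 * norm (x - x0)"
      unfolding has_derivative_at_alt using zero_less_one by meson
    obtain B where B: "\<And>h. norm (E h) \<le> norm h * B"
      using bounded_linear.bounded[OF has_derivative_bounded_linear[OF E]] by blast
    have "\<bar>D x b - D x0 b\<bar> \<le> (1 + B) * norm (x - x0)" if "norm (x - x0) < d" for x
      using d(2)[OF that] B[of "x - x0"] by (simp add: algebra_simps)
    then show ?thesis
      using d(1) by (intro exI[of _ "1 + B"]) (auto simp: eventually_nhds_metric dist_norm)
  qed
  then obtain L where L: "\<And>b. b \<in> Basis \<Longrightarrow> \<forall>\<^sub>F x in nhds x0. \<bar>D x b - D x0 b\<bar> \<le> L b * norm (x - x0)"
    by metis
  then have "\<forall>\<^sub>F x in nhds x0. \<forall>b\<in>Basis. \<bar>D x b - D x0 b\<bar> \<le> L b * norm (x - x0)"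
    by (simp add: eventually_ball_finite_distrib)
  then obtain d where d: "d > 0" "\<And>x b. \<lbrakk>dist x x0 < d; b \<in> Basis\<rbrakk> \<Longrightarrow> \<bar>D x b - D x0 b\<bar> \<le> L b * norm (x - x0)"
    by (auto simp: eventually_nhds_metric)
  define K where "K = (\<Sum>b\<in>(Basis::'a set). \<bar>L b\<bar>)"
  have est: "\<bar>D y h - D x0 h\<bar> \<le> K * norm (y - x0) * norm h" if "dist y x0 < d" for y h
  proof -
    have lin: "linear (D z)" for z
      using vd has_derivative_linear by blast
    have "D z h = (\<Sum>b\<in>Basis. (h \<bullet> b) * D z b)" for z
      by (subst euclidean_representation[of h, symmetric], subst linear_sum[OF lin])
        (simp add: linear_scale[OF lin])
    then have "\<bar>D y h - D x0 h\<bar> = \<bar>\<Sum>b\<in>Basis. (h \<bullet> b) * (D y b - D x0 b)\<bar>"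
      by (simp add: sum_subtractf algebra_simps)
    also have "\<dots> \<le> (\<Sum>b\<in>Basis. norm h * (\<bar>L b\<bar> * norm (y - x0)))"
    proof (rule order_trans[OF sum_abs sum_mono])
      fix b :: 'a assume b: "b \<in> Basis"
      have "\<bar>D y b - D x0 b\<bar> \<le> \<bar>L b\<bar> * norm (y - x0)"
        using d(2)[OF that b] by (meson abs_ge_self mult_right_mono norm_ge_zero order_trans)
      then show "\<bar>(h \<bullet> b) * (D y b - D x0 b)\<bar> \<le> norm h * (\<bar>L b\<bar> * norm (y - x0))"
        unfolding abs_mult by (intro mult_mono Basis_le_norm b) auto
    qed
    also have "\<dots> = K * norm (y - x0) * norm h"
      by (simp add: K_def sum_distrib_left sum_distrib_right mult_ac)
    finally show ?thesis .
  qed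
  have "\<bar>v x - v x0 - p \<bullet> (x - x0)\<bar> \<le> K * (norm (x - x0))\<^sup>2" if x: "dist x x0 < d" for x
  proof -
    have seg: "((\<lambda>z. v z - D x0 z) has_derivative (\<lambda>h. D y h - D x0 h)) (at y within closed_segment x0 x)" for y
      by (intro has_derivative_diff has_derivative_at_withinI[OF vd]
          has_derivative_at_withinI[OF bounded_linear_imp_has_derivative[OF has_derivative_bounded_linear[OF vd]]])
    have "norm ((v x - D x0 x) - (v x0 - D x0 x0)) \<le> (K * norm (x - x0)) * norm (x - x0)"
    proof (rule differentiable_bound[OF convex_closed_segment seg])
      fix y assume "y \<in> closed_segment x0 x"
      then have n: "norm (y - x0) \<le> norm (x - x0)"
        using segment_bound1[of y x0 x] by simp
      then have "dist y x0 < d" using x by (simp add: dist_norm)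
      from est[OF this]
      have "\<bar>D y h - D x0 h\<bar> \<le> K * norm (x - x0) * norm h" for h
        by (rule order_trans) (intro mult_right_mono mult_left_mono n; simp add: K_def sum_nonneg)
      then show "onorm (\<lambda>h. D y h - D x0 h) \<le> K * norm (x - x0)"
        by (intro onorm_le) simp
    qed auto
    then show ?thesis
      by (simp add: Dp inner_diff_right power2_eq_square algebra_simps)
  qed
  then have "\<forall>\<^sub>F x in nhds x0. \<bar>v x - v x0 - p \<bullet> (x - x0)\<bar> \<le> K * (norm (x - x0))\<^sup>2"
    using d(1) by (auto simp: eventually_nhds_metric)
  moreover have "K \<ge> 0" by (simp add: K_def sum_nonneg)
  ultimately show ?thesis using that by blast
qed

lemma eventually_nhds_open_iff_within:
  assumes "open \<Omega>" "x0 \<in> \<Omega>" "P x0"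
  shows "(\<forall>\<^sub>F x in at x0 within \<Omega>. P x) \<longleftrightarrow> (\<forall>\<^sub>F x in nhds x0. P x)"
  by (simp only: at_within_open[OF assms(2,1)] eventually_nhds_conv_at assms(3) simp_thms)

text \<open>A quadratic bound from above yields a touching test function with the same gradient by
  \<open>test_function_above_quadratic\<close>; conversely, Taylor's bound turns a touching test
  function into a quadratic.\<close>

lemma viscosity_subsolution_iff_jet:
  fixes \<Omega> :: "'a::euclidean_space set"
  assumes "open \<Omega>"
  shows "viscosity_subsolution \<Omega> H u \<longleftrightarrow> (\<exists>L. L-lipschitz_on (closure \<Omega>) u) \<and>
    (\<forall>x0\<in>\<Omega>. \<forall>p K. (\<forall>\<^sub>F x in nhds x0. u x \<le> u x0 + p \<bullet> (x - x0) + K * (norm (x - x0))\<^sup>2) \<longrightarrow> H x0 p \<le> 0)"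
    (is "_ \<longleftrightarrow> ?L \<and> ?J")
proof -
  have "?J" if u: "viscosity_subsolution \<Omega> H u"
  proof (intro ballI allI impI)
    fix x0 p K
    assume x0: "x0 \<in> \<Omega>" and ev: "\<forall>\<^sub>F x in nhds x0. u x \<le> u x0 + p \<bullet> (x - x0) + K * (norm (x - x0))\<^sup>2"
    obtain v where v: "v \<in> test_functions \<Omega>" "GDERIV v x0 :> p"
      "\<forall>\<^sub>F x in nhds x0. v x0 + p \<bullet> (x - x0) + K * (norm (x - x0))\<^sup>2 \<le> v x"
      using test_function_above_quadratic[OF assms x0] by blast
    have "local_max_at \<Omega> (\<lambda>x. u x - v x) x0"
      unfolding local_max_at_def using x0
      by (subst eventually_nhds_open_iff_within[OF assms x0])
        (simp, use ev v(3) in \<open>simp, eventually_elim, simp\<close>)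
    then show "H x0 p \<le> 0"
      using u v by (auto simp: viscosity_subsolution_def)
  qed
  moreover have "H x0 p \<le> 0" if J: "?J" and v: "v \<in> test_functions \<Omega>"
    and m: "local_max_at \<Omega> (\<lambda>x. u x - v x) x0" and g: "GDERIV v x0 :> p" for v x0 p
  proof -
    have x0: "x0 \<in> \<Omega>" using m by (simp add: local_max_at_def)
    have "\<forall>\<^sub>F x in nhds x0. u x - v x \<le> u x0 - v x0"
      using m by (simp add: local_max_at_def eventually_nhds_open_iff_within[OF assms x0])
    moreover have "C_k 2 v" using v by (simp add: test_functions_def)
    then obtain K where
      "\<forall>\<^sub>F x in nhds x0. \<bar>v x - v x0 - p \<bullet> (x - x0)\<bar> \<le> K * (norm (x - x0))\<^sup>2"
      using C_2_quadratic_bound[OF _ g] by blast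
    ultimately have "\<forall>\<^sub>F x in nhds x0. u x \<le> u x0 + p \<bullet> (x - x0) + K * (norm (x - x0))\<^sup>2"
      by eventually_elim linarith
    then show ?thesis using J x0 by blast
  qed
  ultimately show ?thesis unfolding viscosity_subsolution_def by blast
qed

text \<open>Reduction to subsolutions: \<open>u\<close> is a supersolution for \<open>H x p\<close>
  exactly when \<open>- u\<close> is a subsolution for \<open>- H x (- p)\<close>. Test functions
  and gradients are reindexed by their negatives.\<close>

lemma viscosity_supersolution_iff_jet:
  fixes \<Omega> :: "'a::euclidean_space set"
  assumes "open \<Omega>"
  shows "viscosity_supersolution \<Omega> H u \<longleftrightarrow> (\<exists>L. L-lipschitz_on (closure \<Omega>) u) \<and>
    (\<forall>x0\<in>\<Omega>. \<forall>p K. (\<forall>\<^sub>F x in nhds x0. u x0 + p \<bullet> (x - x0) - K * (norm (x - x0))\<^sup>2 \<le> u x) \<longrightarrow> H x0 p \<ge> 0)"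
proof -
  have 4: "(\<forall>p. P p) \<longleftrightarrow> (\<forall>p. P (- p))" for P :: "'a \<Rightarrow> bool"
    by (metis minus_minus)
  have *: "viscosity_supersolution \<Omega> H u \<longleftrightarrow> viscosity_subsolution \<Omega> (\<lambda>x p. - H x (- p)) (\<lambda>x. - u x)"
  proof -
    have 1: "local_min_at \<Omega> (\<lambda>x. u x - v x) x0 = local_max_at \<Omega> (\<lambda>x. - u x - - v x) x0" for v x0
      by (simp add: local_min_at_def local_max_at_def algebra_simps)
    have 2: "(\<forall>v\<in>test_functions \<Omega>. P v) \<longleftrightarrow> (\<forall>v\<in>test_functions \<Omega>. P (\<lambda>x. - v x))" for P
      using test_functions_uminus[of "\<lambda>x. - _ x" \<Omega>] test_functions_uminus[of _ \<Omega>]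
      by (metis (no_types, lifting) ext minus_minus)
    have 3: "GDERIV (\<lambda>x. - v x) x0 :> p \<longleftrightarrow> GDERIV v x0 :> - p" for v x0 and p :: 'a
      using GDERIV_minus[of v x0 "- p"] GDERIV_minus[of "\<lambda>x. - v x" x0 p] by auto
    show ?thesis
      unfolding viscosity_supersolution_def viscosity_subsolution_def
      by (subst (2) 2, subst (2) 4) (simp add: 1 3)
  qed
  have 5: "- u x \<le> - u x0 + - p \<bullet> (x - x0) + K * (norm (x - x0))\<^sup>2 \<longleftrightarrow>
      u x0 + p \<bullet> (x - x0) - K * (norm (x - x0))\<^sup>2 \<le> u x" for x x0 p K
    by auto
  show ?thesis
    unfolding * viscosity_subsolution_iff_jet[OF assms]
    by (subst (1) 4) (simp only: 5 lipschitz_on_minus_iff minus_minus neg_le_0_iff_le)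
qed

section \<open>Comparison of viscosity solutions\<close>

text \<open>The penalty coefficient \<open>k\<close> blows up, but the penalty gradients
  \<open>2 * k\<close> times \<open>X k - Y k\<close> stay bounded by twice the Lipschitz constant.
  This gives a limiting gradient \<open>p\<close> along a subsequence and forces a common limit of
  \<open>X\<close> and \<open>Y\<close>.\<close>

lemma doubling_maximizers:
  fixes u v :: "'a::euclidean_space \<Rightarrow> real"
  assumes "compact S" "S \<noteq> {}" "L-lipschitz_on S u" "L-lipschitz_on S v" "s \<ge> 0"
  obtains r :: "nat \<Rightarrow> nat" and X Y l p where
    "strict_mono r"
    "\<forall>k. X k \<in> S \<and> Y k \<in> S" "l \<in> S"
    "\<forall>k. \<forall>x\<in>S. \<forall>y\<in>S. s * u x - v y - real k * (norm (x - y))\<^sup>2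
       \<le> s * u (X k) - v (Y k) - real k * (norm (X k - Y k))\<^sup>2"
    "(X \<circ> r) \<longlonglongrightarrow> l" "(Y \<circ> r) \<longlonglongrightarrow> l"
    "((\<lambda>k. (2 * real k) *\<^sub>R (X k - Y k)) \<circ> r) \<longlonglongrightarrow> p"
proof -
  have cu: "continuous_on S u" and cv: "continuous_on S v"
    using assms lipschitz_on_continuous_on by blast+
  have "\<exists>z\<in>S \<times> S. \<forall>w\<in>S \<times> S. s * u (fst w) - v (snd w) - real k * (norm (fst w - snd w))\<^sup>2
      \<le> s * u (fst z) - v (snd z) - real k * (norm (fst z - snd z))\<^sup>2" for k
    by (rule continuous_attains_sup)
      (use assms in \<open>auto intro!: compact_Times continuous_intros continuous_on_compose2[OF cu] continuous_on_compose2[OF cv]\<close>)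
  then obtain Z where Z: "\<And>k. Z k \<in> S \<times> S" "\<And>k w. w \<in> S \<times> S \<Longrightarrow>
      s * u (fst w) - v (snd w) - real k * (norm (fst w - snd w))\<^sup>2
      \<le> s * u (fst (Z k)) - v (snd (Z k)) - real k * (norm (fst (Z k) - snd (Z k)))\<^sup>2"
    by metis
  define X Y where "X k = fst (Z k)" and "Y k = snd (Z k)" for k
  have XY: "X k \<in> S" "Y k \<in> S" for k
    using Z(1)[of k] by (auto simp: X_def Y_def mem_Times_iff)
  have max: "s * u x - v y - real k * (norm (x - y))\<^sup>2 \<le> s * u (X k) - v (Y k) - real k * (norm (X k - Y k))\<^sup>2"
    if "x \<in> S" "y \<in> S" for k x y
    using Z(2)[of "(x, y)" k] that by (auto simp: X_def Y_def)
  have L: "L \<ge> 0" using assms(3) lipschitz_on_nonneg by blast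
  have pb: "real k * norm (X k - Y k) \<le> L" for k
  proof (cases "X k = Y k")
    case False
    \<comment> \<open>The maximal pair is compared with the diagonal pair \<open>(X k, X k)\<close>,
      so that only the Lipschitz bound of \<open>v\<close> enters.\<close>
    have "real k * (norm (X k - Y k))\<^sup>2 \<le> v (X k) - v (Y k)"
      using max[of "X k" "X k" k] XY by simp
    also have "\<dots> \<le> L * norm (X k - Y k)"
      using lipschitz_onD[OF assms(4) XY(1) XY(2), of k k] by (simp add: dist_norm)
    finally show ?thesis using False by (simp add: power2_eq_square)
  qed (use L in simp)
  define P where "P k = (2 * real k) *\<^sub>R (X k - Y k)" for k
  have "norm (P k) \<le> 2 * L" for k
    using pb[of k] by (simp add: P_def)
  then have "(X k, P k) \<in> S \<times> cball 0 (2 * L)" for k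
    using XY by simp
  moreover have "compact (S \<times> cball (0::'a) (2 * L))"
    using assms(1) by (intro compact_Times compact_cball)
  ultimately obtain z r where z: "z \<in> S \<times> cball (0::'a) (2 * L)" "strict_mono r" "((\<lambda>k. (X k, P k)) \<circ> r) \<longlonglongrightarrow> z"
    unfolding compact_eq_seq_compact_metric using seq_compactE[of _ "\<lambda>k. (X k, P k)"] by metis
  have X: "(X \<circ> r) \<longlonglongrightarrow> fst z" and P: "(P \<circ> r) \<longlonglongrightarrow> snd z"
    using tendsto_fst[OF z(3)] tendsto_snd[OF z(3)] by (simp_all add: o_def)
  have "(\<lambda>k. X k - Y k) \<longlonglongrightarrow> 0"
  proof (rule Lim_null_comparison)
    show "\<forall>\<^sub>F k in sequentially. norm (X k - Y k) \<le> L / real k"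
      using eventually_gt_at_top[of 0]
      by eventually_elim (use pb in \<open>simp add: field_simps\<close>)
    show "(\<lambda>k. L / real k) \<longlonglongrightarrow> 0" by (rule lim_const_over_n)
  qed
  from LIMSEQ_subseq_LIMSEQ[OF this z(2)]
  have "(Y \<circ> r) \<longlonglongrightarrow> fst z"
    using tendsto_diff[OF X] by (fastforce simp: o_def)
  then show ?thesis
    using that[of r X Y "fst z" "snd z"] z(1,2) XY max X P by (auto simp: P_def[abs_def] mem_Times_iff)
qed

text \<open>The limiting gradient \<open>p\<close> of the doubled functional satisfies
  \<open>H l p \<ge> 0\<close> through \<open>v\<close>, and
  \<open>H l (p /\<^sub>R s) \<le> 0\<close> through \<open>s * u\<close>. Convexity between
  \<open>p /\<^sub>R s\<close> and 0 turns the latter into \<open>H l p < 0\<close>.\<close>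

lemma viscosity_comparison_jets:
  fixes \<Omega> :: "'a::euclidean_space set"
  assumes "open \<Omega>" "bounded \<Omega>"
    and H: "continuous_on (closure \<Omega> \<times> UNIV) (\<lambda>(x, p). H x p)"
    and convex: "\<And>x. x \<in> \<Omega> \<Longrightarrow> convex_on UNIV (H x)"
    and H0: "\<And>x. x \<in> \<Omega> \<Longrightarrow> H x 0 < 0"
    and u: "Lu-lipschitz_on (closure \<Omega>) u" and v: "Lv-lipschitz_on (closure \<Omega>) v"
    and sub: "\<And>x0 p K. x0 \<in> \<Omega> \<Longrightarrow>
      (\<forall>\<^sub>F x in nhds x0. u x \<le> u x0 + p \<bullet> (x - x0) + K * (norm (x - x0))\<^sup>2) \<Longrightarrow> H x0 p \<le> 0"
    and super: "\<And>x0 p K. x0 \<in> \<Omega> \<Longrightarrow>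
      (\<forall>\<^sub>F x in nhds x0. v x0 + p \<bullet> (x - x0) - K * (norm (x - x0))\<^sup>2 \<le> v x) \<Longrightarrow> H x0 p \<ge> 0"
    and bd: "\<And>x. x \<in> frontier \<Omega> \<Longrightarrow> u x \<le> v x"
    and z: "z \<in> closure \<Omega>"
  shows "u z \<le> v z"
proof (rule ccontr)
  assume "\<not> u z \<le> v z"
  define M where "M = u z - v z"
  have M: "M > 0" using \<open>\<not> u z \<le> v z\<close> by (simp add: M_def)
  have comp: "compact (closure \<Omega>)" using assms(2) by (simp add: compact_closure)
  define L where "L = max Lu Lv"
  have u': "L-lipschitz_on (closure \<Omega>) u" and v': "L-lipschitz_on (closure \<Omega>) v"
    using u v by (auto simp: L_def intro: lipschitz_on_mono)
  have cu: "continuous_on (closure \<Omega>) u" and cv: "continuous_on (closure \<Omega>) v"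
    using u v lipschitz_on_continuous_on by blast+
  have "bounded (u ` closure \<Omega>)"
    using compact_continuous_image[OF cu comp] compact_imp_bounded by blast
  then obtain B where B: "B > 0" "\<And>x. x \<in> closure \<Omega> \<Longrightarrow> \<bar>u x\<bar> \<le> B"
    by (auto simp: bounded_pos)
  \<comment> \<open>Scaling by \<open>s\<close> changes \<open>u\<close> by at most
    \<open>M / 4\<close> at any point, and it is felt at the two points \<open>z\<close> and
    \<open>l\<close>, so \<open>u l - v l\<close> is still at least \<open>M / 2\<close>. The
    minimum with \<open>1/2\<close> keeps \<open>s\<close> positive.\<close>
  define s where "s = 1 - min (1/2) (M / (4 * B))"
  have s: "0 < s" "s < 1" "(1 - s) * B \<le> M / 4"
    using M B(1) by (auto simp: s_def min_def field_simps)
  have ubound: "(1 - s) * \<bar>u x\<bar> \<le> M / 4" if "x \<in> closure \<Omega>" for x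
    using mult_left_mono[OF B(2)[OF that], of "1 - s"] s by linarith
  have ne: "closure \<Omega> \<noteq> {}" and s0: "0 \<le> s" using z s(1) by auto
  obtain r X Y l p where
    r: "strict_mono r" and XY0: "\<forall>k. X k \<in> closure \<Omega> \<and> Y k \<in> closure \<Omega>" and l: "l \<in> closure \<Omega>"
    and max0: "\<forall>k. \<forall>x\<in>closure \<Omega>. \<forall>y\<in>closure \<Omega>. s * u x - v y - real k * (norm (x - y))\<^sup>2
       \<le> s * u (X k) - v (Y k) - real k * (norm (X k - Y k))\<^sup>2"
    and X: "(X \<circ> r) \<longlonglongrightarrow> l" and Y: "(Y \<circ> r) \<longlonglongrightarrow> l"
    and P: "((\<lambda>k. (2 * real k) *\<^sub>R (X k - Y k)) \<circ> r) \<longlonglongrightarrow> p"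
    by (rule doubling_maximizers[OF comp ne u' v' s0])
  note XY = conjunct1[OF spec[OF XY0]] conjunct2[OF spec[OF XY0]] and max = max0[rule_format]
  define P' where "P' k = (2 * real k) *\<^sub>R (X k - Y k)" for k
  have "s * u z - v z \<le> s * u (X (r k)) - v (Y (r k))" for k
  proof -
    have "0 \<le> real (r k) * (norm (X (r k) - Y (r k)))\<^sup>2" by simp
    then show ?thesis
      using max[OF z z, of "r k", unfolded diff_self norm_zero power_zero_numeral mult_zero_right]
      by linarith
  qed
  moreover have "(\<lambda>k. s * u (X (r k)) - v (Y (r k))) \<longlonglongrightarrow> s * u l - v l"
    using X Y XY l
    by (intro tendsto_intros continuous_on_tendsto_compose[OF cu] continuous_on_tendsto_compose[OF cv])
      (auto simp: o_def)
  ultimately have "s * u z - v z \<le> s * u l - v l"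
    by (intro LIMSEQ_le_const) auto
  then have "M - (1 - s) * u z \<le> u l - v l - (1 - s) * u l"
    by (simp add: M_def algebra_simps)
  moreover have "(1 - s) * u z \<le> M / 4" "- ((1 - s) * u l) \<le> M / 4"
    using ubound[OF z] ubound[OF l] s
    by (smt (verit, ccfv_SIG) mult_left_mono mult_minus_right)+
  ultimately have "u l - v l > 0" using M by linarith
  then have "l \<notin> frontier \<Omega>" using bd by force
  then have l\<Omega>: "l \<in> \<Omega>" using l assms(1) by (simp add: frontier_def interior_open)
  have ev: "\<forall>\<^sub>F k in sequentially. X (r k) \<in> \<Omega> \<and> Y (r k) \<in> \<Omega>"
    using topological_tendstoD[OF X assms(1) l\<Omega>] topological_tendstoD[OF Y assms(1) l\<Omega>]
    by (simp add: o_def eventually_conj)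
  have nh: "\<forall>\<^sub>F x in nhds y. x \<in> closure \<Omega>" if "y \<in> \<Omega>" for y
    using eventually_nhds_in_open[OF assms(1) that] by eventually_elim (use closure_subset in blast)
  have square: "(norm (x - b))\<^sup>2 - (norm (a - b))\<^sup>2 = 2 * ((a - b) \<bullet> (x - a)) + (norm (x - a))\<^sup>2" for x a b :: 'a
    by (simp add: power2_norm_eq_inner inner_diff_left inner_diff_right inner_commute algebra_simps)
  \<comment> \<open>Fixing \<open>y = Y k\<close> in the maximality shows that \<open>u\<close> is
    touched from above by the expanded penalty divided by \<open>s\<close>. Its second-order
    coefficient grows with \<open>k\<close>, which is harmless because the jet condition allows any
    \<open>K\<close>.\<close>
  have 1: "H (X k) (P' k /\<^sub>R s) \<le> 0" if "X k \<in> \<Omega>" for k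
  proof (rule sub[OF that])
    show "\<forall>\<^sub>F x in nhds (X k). u x \<le> u (X k) + (P' k /\<^sub>R s) \<bullet> (x - X k) + (real k / s) * (norm (x - X k))\<^sup>2"
      using nh[OF that]
    proof eventually_elim
      case (elim x)
      have "s * u x \<le> s * u (X k) + real k * ((norm (x - Y k))\<^sup>2 - (norm (X k - Y k))\<^sup>2)"
        using max[OF elim XY(2)[of k], of k] by (simp add: algebra_simps)
      also have "\<dots> = s * (u (X k) + (P' k /\<^sub>R s) \<bullet> (x - X k) + (real k / s) * (norm (x - X k))\<^sup>2)"
      proof -
        have "(P' k /\<^sub>R s) \<bullet> (x - X k) = 2 * real k / s * ((X k - Y k) \<bullet> (x - X k))"
          by (simp add: P'_def divide_inverse)
        moreover have "s * a + real k * (2 * q + n) = s * (a + 2 * real k / s * q + real k / s * n)" for a q n :: real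
          using s by (simp add: field_simps)
        ultimately show ?thesis unfolding square by presburger
      qed
      finally show ?case using s by simp
    qed
  qed
  have 2: "H (Y k) (P' k) \<ge> 0" if "Y k \<in> \<Omega>" for k
  proof (rule super[OF that])
    show "\<forall>\<^sub>F y in nhds (Y k). v (Y k) + P' k \<bullet> (y - Y k) - real k * (norm (y - Y k))\<^sup>2 \<le> v y"
      using nh[OF that]
    proof eventually_elim
      case (elim y)
      have "v (Y k) \<le> v y + real k * ((norm (y - X k))\<^sup>2 - (norm (Y k - X k))\<^sup>2)"
        using max[OF XY(1)[of k] elim, of k] by (simp add: algebra_simps norm_minus_commute)
      moreover have "real k * ((norm (y - X k))\<^sup>2 - (norm (Y k - X k))\<^sup>2) =
          - (P' k \<bullet> (y - Y k)) + real k * (norm (y - Y k))\<^sup>2"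
        unfolding square by (simp add: P'_def inner_diff_left algebra_simps)
      ultimately show ?case by simp
    qed
  qed
  have lim: "(\<lambda>k. H (A k) (Q k)) \<longlonglongrightarrow> H l q"
    if "A \<longlonglongrightarrow> l" "Q \<longlonglongrightarrow> q" "\<And>k. A k \<in> closure \<Omega>" for A Q q
    using continuous_on_tendsto_compose[OF H tendsto_Pair[OF that(1,2)]] l that(3) by simp
  have P2: "(\<lambda>k. P' (r k)) \<longlonglongrightarrow> p" using P by (simp add: P'_def o_def)
  have "H l (p /\<^sub>R s) \<le> 0"
    by (rule tendsto_upperbound[OF lim[of "\<lambda>k. X (r k)" "\<lambda>k. P' (r k) /\<^sub>R s"]])
      (use X P2 XY in \<open>auto simp: o_def intro!: tendsto_intros eventually_mono[OF ev] 1\<close>)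
  moreover have "H l p \<ge> 0"
    by (rule tendsto_lowerbound[OF lim[of "\<lambda>k. Y (r k)" "\<lambda>k. P' (r k)"]])
      (use Y P2 XY in \<open>auto simp: o_def intro!: eventually_mono[OF ev] 2\<close>)
  \<comment> \<open>The point \<open>p\<close> is the convex combination of
    \<open>p /\<^sub>R s\<close> and 0 with weights \<open>s\<close> and
    \<open>1 - s\<close>.\<close>
  moreover have "H l p \<le> s * H l (p /\<^sub>R s) + (1 - s) * H l 0"
    using convex_onD[OF convex[OF l\<Omega>], of "1 - s" "p /\<^sub>R s" 0] s by (simp add: algebra_simps)
  moreover have "(1 - s) * H l 0 < 0" using H0[OF l\<Omega>] s by (simp add: mult_pos_neg)
  moreover have "s * H l (p /\<^sub>R s) \<le> 0" using calculation(1) s by (simp add: mult_nonneg_nonpos)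
  ultimately show False by linarith
qed

section \<open>Lipschitz domains\<close>

lemma lipschitz_boundaryE:
  fixes \<Omega> :: "'a::euclidean_space set"
  assumes "lipschitz_boundary \<Omega>" "x0 \<in> frontier \<Omega>"
  obtains r e L and \<gamma> :: "'a \<Rightarrow> real" where "r > 0" "norm e = 1" "L-lipschitz_on {z. z \<bullet> e = 0} \<gamma>"
    "\<Omega> \<inter> ball x0 r = {x \<in> ball x0 r. \<gamma> (x - (x \<bullet> e) *\<^sub>R e) < x \<bullet> e}"
proof -
  have "\<exists>r>0. \<exists>e. norm e = 1 \<and> (\<exists>L (\<gamma>::'a \<Rightarrow> real). L-lipschitz_on {z. z \<bullet> e = 0} \<gamma> \<and>
        \<Omega> \<inter> ball x0 r = {x \<in> ball x0 r. \<gamma> (x - (x \<bullet> e) *\<^sub>R e) < x \<bullet> e})"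
    using assms unfolding lipschitz_boundary_def by (rule bspec)
  then show ?thesis by (elim exE conjE) (rule that; assumption)
qed

text \<open>A Lipschitz domain has no slits: the points strictly below the graph form an open set
  that misses \<Omega> near the boundary point, so they are not in the closure either.\<close>

lemma interior_closure_lipschitz_domain:
  fixes \<Omega> :: "'a::euclidean_space set"
  assumes "open \<Omega>" "lipschitz_boundary \<Omega>"
  shows "interior (closure \<Omega>) = \<Omega>"
proof
  show "\<Omega> \<subseteq> interior (closure \<Omega>)"
    using assms(1) closure_subset interior_maximal by blast
  show "interior (closure \<Omega>) \<subseteq> \<Omega>"
  proof (rule ccontr)
    assume "\<not> interior (closure \<Omega>) \<subseteq> \<Omega>"
    then obtain z where z: "z \<in> interior (closure \<Omega>)" "z \<notin> \<Omega>" by blast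
    then have zf: "z \<in> frontier \<Omega>"
      using assms(1) interior_subset by (auto simp: frontier_def interior_open)
    then obtain r e L \<gamma> where r: "r > 0" and e: "norm e = 1"
      and lip: "L-lipschitz_on {z. z \<bullet> e = 0} (\<gamma> :: 'a \<Rightarrow> real)"
      and graph: "\<Omega> \<inter> ball z r = {x \<in> ball z r. \<gamma> (x - (x \<bullet> e) *\<^sub>R e) < x \<bullet> e}"
      by (rule lipschitz_boundaryE[OF assms(2)])
    have ee: "e \<bullet> e = 1" using e by (simp add: norm_eq_1)
    \<comment> \<open>Height above the graph. A boundary point has \<open>h z \<le> 0\<close>, and a
      step along \<open>- e\<close> makes it strictly negative.\<close>
    define h where "h x = x \<bullet> e - \<gamma> (x - (x \<bullet> e) *\<^sub>R e)" for x
    have "continuous_on UNIV h"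
      unfolding h_def
      by (intro continuous_intros continuous_on_compose2[OF lipschitz_on_continuous_on[OF lip]])
        (auto simp: inner_diff_left ee)
    then have op: "open {x. h x < 0}"
      by (simp add: open_Collect_less continuous_on_const)
    obtain d where d: "d > 0" "ball z d \<subseteq> closure \<Omega>"
      using z(1) by (auto simp: mem_interior)
    define t where "t = min d r / 2"
    have t: "t > 0" "t < d" "t < r" using d r by (auto simp: t_def)
    define y where "y = z - t *\<^sub>R e"
    have "dist z y = t" using e t by (simp add: y_def dist_norm)
    then have y: "y \<in> ball z r" "y \<in> closure \<Omega>" using t d by auto
    have "h z \<le> 0"
      using z(2) graph r by (force simp: h_def)
    then have "h y < 0"
      using t by (simp add: h_def y_def inner_diff_left ee algebra_simps)
    then have "y \<in> {x. h x < 0} \<inter> ball z r" using y by simp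
    then obtain x where "x \<in> \<Omega>" "x \<in> {x. h x < 0} \<inter> ball z r"
      using y(2) op open_Int_closure_eq_empty[of "{x. h x < 0} \<inter> ball z r" \<Omega>] by blast
    then have "\<gamma> (x - (x \<bullet> e) *\<^sub>R e) < x \<bullet> e" "x \<bullet> e < \<gamma> (x - (x \<bullet> e) *\<^sub>R e)"
      using graph by (blast, simp add: h_def)
    then show False by simp
  qed
qed

text \<open>The points are joined by three segments: up along \<open>e\<close>, across, and down
  again. With \<open>N\<close> the distance of the points and \<open>t\<close> the height, the total
  length is \<open>2 * t + N\<close>, that is \<open>(2 * L + 3) * N\<close>.\<close>

lemma lipschitz_graph_path:
  fixes \<Omega> :: "'a::euclidean_space set"
  assumes e: "norm e = 1" and lip: "L-lipschitz_on {z. z \<bullet> e = 0} (\<gamma> :: 'a \<Rightarrow> real)"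
    and graph: "\<Omega> \<inter> ball x0 r = {x \<in> ball x0 r. \<gamma> (x - (x \<bullet> e) *\<^sub>R e) < x \<bullet> e}"
    and x: "x \<in> \<Omega>" "dist x x0 < r / (2 * L + 4)" and y: "y \<in> \<Omega>" "dist y x0 < r / (2 * L + 4)"
    and f: "\<And>x y. closed_segment x y \<subseteq> closure \<Omega> \<Longrightarrow> \<bar>f x - f y\<bar> \<le> M * norm (x - y)"
  shows "\<bar>f x - f y\<bar> \<le> (2 * L + 3) * M * norm (x - y)"
proof -
  have ee: "e \<bullet> e = 1" using e by (simp add: norm_eq_1)
  have L: "L \<ge> 0" using lip lipschitz_on_nonneg by blast
  \<comment> \<open>Along the crossing the graph rises by at most \<open>L * N\<close> and the
    segment sinks by at most \<open>N\<close>, hence the height \<open>(L + 1) * N\<close>. The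
    radius \<open>\<delta>\<close> makes \<open>\<delta> + t < (2 * L + 3) * \<delta> < r\<close>,
    so the path stays in the chart.\<close>
  define N t \<delta> where "N = norm (x - y)" and "t = (L + 1) * N" and "\<delta> = r / (2 * L + 4)"
  have N: "N < 2 * \<delta>"
    using x(2) y(2) dist_triangle2[of x y x0] by (simp add: N_def \<delta>_def dist_norm)
  have t0: "t \<ge> 0" using L by (simp add: t_def N_def)
  have "t \<le> (L + 1) * (2 * \<delta>)" using N L unfolding t_def by (intro mult_left_mono) auto
  moreover have "(2 * L + 4) * \<delta> = r" using L by (simp add: \<delta>_def)
  moreover have "\<delta> > 0" using x(2) zero_le_dist[of x x0] unfolding \<delta>_def by linarith
  ultimately have tr: "\<delta> + t < r" by (simp add: algebra_simps)
  have inb: "z \<in> closure \<Omega>" if "z \<in> \<Omega>" for z using that closure_subset by blast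
  have mem: "w + s *\<^sub>R e \<in> \<Omega>"
    if "dist w x0 < \<delta>" "0 \<le> s" "s \<le> t" "\<gamma> (w - (w \<bullet> e) *\<^sub>R e) < w \<bullet> e + s" for w s
  proof -
    have "dist (w + s *\<^sub>R e) x0 \<le> dist w x0 + s"
      using that(2) e norm_triangle_ineq[of "w - x0" "s *\<^sub>R e"] by (simp add: dist_norm algebra_simps)
    then have "w + s *\<^sub>R e \<in> ball x0 r" using that tr by (simp add: dist_commute)
    moreover have "(w + s *\<^sub>R e) - ((w + s *\<^sub>R e) \<bullet> e) *\<^sub>R e = w - (w \<bullet> e) *\<^sub>R e"
      by (simp add: inner_add_left ee algebra_simps)
    moreover have "(w + s *\<^sub>R e) \<bullet> e = w \<bullet> e + s" by (simp add: inner_add_left ee)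
    ultimately have "w + s *\<^sub>R e \<in> {x \<in> ball x0 r. \<gamma> (x - (x \<bullet> e) *\<^sub>R e) < x \<bullet> e}"
      using that(4) by (metis (mono_tags, lifting) mem_Collect_eq)
    then show ?thesis using graph by blast
  qed
  have gr: "\<gamma> (w - (w \<bullet> e) *\<^sub>R e) < w \<bullet> e" if "w \<in> \<Omega>" "dist w x0 < \<delta>" for w
  proof -
    have "\<delta> \<le> r" using tr t0 by linarith
    then have "w \<in> \<Omega> \<inter> ball x0 r" using that by (simp add: dist_commute)
    then show ?thesis using graph by blast
  qed
  have x': "dist x x0 < \<delta>" and y': "dist y x0 < \<delta>" using x y by (auto simp: \<delta>_def)
  have up: "closed_segment w (w + t *\<^sub>R e) \<subseteq> closure \<Omega>" if "w \<in> \<Omega>" "dist w x0 < \<delta>" for w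
  proof
    fix z assume "z \<in> closed_segment w (w + t *\<^sub>R e)"
    then obtain s where s: "0 \<le> s" "s \<le> 1" "z = w + (s * t) *\<^sub>R e"
      by (auto simp: in_segment algebra_simps)
    have "s * t \<le> t" using s t0 by (simp add: mult_left_le_one_le)
    moreover have "0 \<le> s * t" using s t0 by simp
    moreover have "\<gamma> (w - (w \<bullet> e) *\<^sub>R e) < w \<bullet> e + s * t" using gr[OF that] calculation by linarith
    ultimately show "z \<in> closure \<Omega>"
      unfolding s(3) using that by (intro inb mem)
  qed
  have across: "closed_segment (x + t *\<^sub>R e) (y + t *\<^sub>R e) \<subseteq> closure \<Omega>"
  proof
    fix z assume "z \<in> closed_segment (x + t *\<^sub>R e) (y + t *\<^sub>R e)"
    then obtain s where s: "0 \<le> s" "s \<le> 1" "z = ((1 - s) *\<^sub>R x + s *\<^sub>R y) + t *\<^sub>R e"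
      by (auto simp: in_segment algebra_simps)
    define w where "w = (1 - s) *\<^sub>R x + s *\<^sub>R y"
    have wx: "w - x = s *\<^sub>R (y - x)" by (simp add: w_def algebra_simps)
    then have nwx: "norm (w - x) \<le> N"
      using s by (simp add: N_def norm_minus_commute mult_left_le_one_le)
    have "w \<in> ball x0 \<delta>"
      unfolding w_def using s x' y' by (intro convexD) (auto simp: dist_commute)
    then have wd: "dist w x0 < \<delta>" by (simp add: dist_commute)
    define P where "P v = v - (v \<bullet> e) *\<^sub>R e" for v
    have P: "P v \<bullet> e = 0" for v by (simp add: P_def inner_diff_left ee)
    have "norm (P w - P x) \<le> norm (w - x)"
    proof -
      have "(norm (d - (d \<bullet> e) *\<^sub>R e))\<^sup>2 = (norm d)\<^sup>2 - (d \<bullet> e)\<^sup>2" for d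
      proof -
        have "(d - c *\<^sub>R e) \<bullet> (d - c *\<^sub>R e) = d \<bullet> d - 2 * (c * (d \<bullet> e)) + c * c" for c
          by (simp add: inner_diff_left inner_diff_right inner_commute[of e d] ee right_diff_distrib)
        from this[of "d \<bullet> e"] show ?thesis by (simp add: power2_norm_eq_inner power2_eq_square[of "d \<bullet> e"])
      qed
      moreover have "P w - P x = (w - x) - ((w - x) \<bullet> e) *\<^sub>R e"
        by (simp add: P_def inner_diff_left scaleR_left_diff_distrib)
      ultimately have "(norm (P w - P x))\<^sup>2 \<le> (norm (w - x))\<^sup>2" by simp
      then show ?thesis by (rule power2_le_imp_le) simp
    qed
    then have "\<bar>\<gamma> (P w) - \<gamma> (P x)\<bar> \<le> L * N"
      using lipschitz_onD[OF lip, of "P w" "P x"] P nwx mult_left_mono[OF _ L, of "norm (P w - P x)" N]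
      by (simp add: dist_norm)
    moreover have "\<bar>(w - x) \<bullet> e\<bar> \<le> N"
      using Cauchy_Schwarz_ineq2[of "w - x" e] e nwx by simp
    moreover have "\<gamma> (P x) < x \<bullet> e" using gr[OF x(1) x'] by (simp add: P_def)
    ultimately have "\<gamma> (P w) < w \<bullet> e + t"
      by (simp add: t_def inner_diff_left algebra_simps)
    then show "z \<in> closure \<Omega>"
      using mem[OF wd t0 order_refl] s(3) by (simp add: inb P_def w_def)
  qed
  have "\<bar>f x - f (x + t *\<^sub>R e)\<bar> \<le> M * t" "\<bar>f y - f (y + t *\<^sub>R e)\<bar> \<le> M * t"
    using f[OF up[OF x(1) x']] f[OF up[OF y(1) y']] e t0 by auto
  moreover have "\<bar>f (x + t *\<^sub>R e) - f (y + t *\<^sub>R e)\<bar> \<le> M * N"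
    using f[OF across] by (simp add: N_def)
  ultimately have "\<bar>f x - f y\<bar> \<le> M * t + M * N + M * t" by linarith
  then show ?thesis by (simp add: t_def N_def algebra_simps)
qed

text \<open>This is what a simplexwise bound gives on a nonconvex set. Continuity is included to
  pass from points of \<Omega>, where the graph description applies, to boundary points.\<close>

definition segment_lipschitz :: "real \<Rightarrow> 'a::euclidean_space set \<Rightarrow> ('a \<Rightarrow> real) \<Rightarrow> bool" where
  "segment_lipschitz M S f \<longleftrightarrow> M \<ge> 0 \<and> continuous_on S f \<and>
     (\<forall>x y. closed_segment x y \<subseteq> S \<longrightarrow> \<bar>f x - f y\<bar> \<le> M * norm (x - y))"

text \<open>Inside \<Omega> a ball is convex and segments suffice. At the boundary the three-segment
  path is used for points of \<Omega>, and their limits reach the closure. Both \<open>r\<close> and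
  \<open>C\<close> are chosen before \<open>f\<close> and \<open>M\<close>, so they serve all
  meshes.\<close>

lemma lipschitz_domain_local_lipschitz:
  fixes \<Omega> :: "'a::euclidean_space set"
  assumes op: "open \<Omega>" and "lipschitz_boundary \<Omega>" and x0: "x0 \<in> closure \<Omega>"
  shows "\<exists>r>0. \<exists>C\<ge>0. \<forall>f M. segment_lipschitz M (closure \<Omega>) f \<longrightarrow> (C * M)-lipschitz_on (closure \<Omega> \<inter> ball x0 r) f"
proof (cases "x0 \<in> \<Omega>")
  case True
  then obtain r where r: "r > 0" "ball x0 r \<subseteq> \<Omega>" using op open_contains_ball by blast
  show ?thesis
  proof (rule exI[of _ r], rule conjI[OF r(1)], rule exI[of _ 1], intro conjI allI impI lipschitz_onI)
    fix f M x y
    assume f: "segment_lipschitz M (closure \<Omega>) f"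
      and xy: "x \<in> closure \<Omega> \<inter> ball x0 r" "y \<in> closure \<Omega> \<inter> ball x0 r"
    have "closed_segment x y \<subseteq> ball x0 r" using xy by (intro closed_segment_subset) auto
    then have "closed_segment x y \<subseteq> closure \<Omega>" using r closure_subset by blast
    then show "dist (f x) (f y) \<le> 1 * M * dist x y" using f by (simp add: segment_lipschitz_def dist_norm)
  qed (use r in \<open>auto simp: segment_lipschitz_def\<close>)
next
  case False
  then have "x0 \<in> frontier \<Omega>" using x0 op by (simp add: frontier_def interior_open)
  then obtain r e L \<gamma> where r: "r > 0" and e: "norm e = 1"
      and lip: "L-lipschitz_on {z. z \<bullet> e = 0} (\<gamma> :: 'a \<Rightarrow> real)"
      and graph: "\<Omega> \<inter> ball x0 r = {x \<in> ball x0 r. \<gamma> (x - (x \<bullet> e) *\<^sub>R e) < x \<bullet> e}"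
    by (rule lipschitz_boundaryE[OF assms(2)])
  have L: "L \<ge> 0" using lip lipschitz_on_nonneg by blast
  define \<delta> where "\<delta> = r / (2 * L + 4)"
  show ?thesis
  proof (rule exI[of _ \<delta>], rule conjI[rotated], rule exI[of _ "2 * L + 3"], intro conjI allI impI lipschitz_onI)
    show "\<delta> > 0" "2 * L + 3 \<ge> 0" using r L by (auto simp: \<delta>_def)
    fix f M assume sl: "segment_lipschitz M (closure \<Omega>) f"
    then show "0 \<le> (2 * L + 3) * M" using L by (simp add: segment_lipschitz_def)
    have cont: "continuous_on (closure \<Omega>) f"
      and f: "\<And>x y. closed_segment x y \<subseteq> closure \<Omega> \<Longrightarrow> \<bar>f x - f y\<bar> \<le> M * norm (x - y)"
      using sl by (auto simp: segment_lipschitz_def)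
    fix x y assume xy: "x \<in> closure \<Omega> \<inter> ball x0 \<delta>" "y \<in> closure \<Omega> \<inter> ball x0 \<delta>"
    have "\<exists>X. X \<longlonglongrightarrow> z \<and> (\<forall>n. X n \<in> \<Omega> \<inter> ball x0 \<delta>)" if "z \<in> closure \<Omega> \<inter> ball x0 \<delta>" for z
    proof -
      have "z \<in> closure (\<Omega> \<inter> ball x0 \<delta>)"
        using open_Int_closure_subset[of "ball x0 \<delta>" \<Omega>] that by (auto simp: Int_commute)
      then show ?thesis by (auto simp: closure_sequential)
    qed
    then obtain X Y where X: "X \<longlonglongrightarrow> x" "\<And>n. X n \<in> \<Omega> \<inter> ball x0 \<delta>"
      and Y: "Y \<longlonglongrightarrow> y" "\<And>n. Y n \<in> \<Omega> \<inter> ball x0 \<delta>"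
      using xy by metis
    have cl: "\<And>n. X n \<in> closure \<Omega>" "\<And>n. Y n \<in> closure \<Omega>"
      using X(2) Y(2) closure_subset by blast+
    have "(\<lambda>n. \<bar>f (X n) - f (Y n)\<bar>) \<longlonglongrightarrow> \<bar>f x - f y\<bar>"
      using cl xy by (intro tendsto_intros continuous_on_tendsto_compose[OF cont] X Y) auto
    moreover have "(\<lambda>n. (2 * L + 3) * M * norm (X n - Y n)) \<longlonglongrightarrow> (2 * L + 3) * M * norm (x - y)"
      by (intro tendsto_intros X Y)
    moreover have "\<bar>f (X n) - f (Y n)\<bar> \<le> (2 * L + 3) * M * norm (X n - Y n)" for n
      using X(2)[of n] Y(2)[of n]
      by (intro lipschitz_graph_path[OF e lip graph _ _ _ _ f]) (auto simp: \<delta>_def dist_commute)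
    ultimately have "\<bar>f x - f y\<bar> \<le> (2 * L + 3) * M * norm (x - y)"
      by (intro LIMSEQ_le) auto
    then show "dist (f x) (f y) \<le> (2 * L + 3) * M * dist x y" by (simp add: dist_norm)
  qed
qed

text \<open>Points closer than a Lebesgue number of a finite cover share a local neighbourhood; for
  more distant points the sup bound \<open>B\<close> suffices.\<close>

lemma lipschitz_domain_uniform_lipschitz:
  fixes \<Omega> :: "'a::euclidean_space set"
  assumes "open \<Omega>" "bounded \<Omega>" "lipschitz_boundary \<Omega>" and M: "M \<ge> 0"
  obtains L where "\<And>f. \<lbrakk>segment_lipschitz M (closure \<Omega>) f; \<And>x. x \<in> closure \<Omega> \<Longrightarrow> \<bar>f x\<bar> \<le> B\<rbrakk>
    \<Longrightarrow> L-lipschitz_on (closure \<Omega>) f"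
proof -
  have comp: "compact (closure \<Omega>)" using assms(2) by (simp add: compact_closure)
  define Q where "Q x0 r C \<longleftrightarrow> (\<forall>f M. segment_lipschitz M (closure \<Omega>) f \<longrightarrow>
    (C * M)-lipschitz_on (closure \<Omega> \<inter> ball x0 r) f)" for x0 r C
  have "\<forall>x0\<in>closure \<Omega>. \<exists>r>0. \<exists>C\<ge>0. Q x0 r C"
    using lipschitz_domain_local_lipschitz[OF assms(1,3)] unfolding Q_def by blast
  then obtain r C where rC: "\<And>x0. x0 \<in> closure \<Omega> \<Longrightarrow> r x0 > 0 \<and> C x0 \<ge> 0 \<and> Q x0 (r x0) (C x0)"
    by metis
  have cover: "closure \<Omega> \<subseteq> (\<Union>x0\<in>closure \<Omega>. ball x0 (r x0))"
    using rC by force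
  obtain D where D: "D \<subseteq> closure \<Omega>" "finite D" "closure \<Omega> \<subseteq> (\<Union>x0\<in>D. ball x0 (r x0))"
    using compactE_image[OF comp _ cover] by auto
  obtain \<epsilon> where eps: "\<epsilon> > 0" "\<And>x. x \<in> closure \<Omega> \<Longrightarrow> \<exists>x0\<in>D. ball x \<epsilon> \<subseteq> ball x0 (r x0)"
    using Heine_Borel_lemma[OF comp, of "(\<lambda>x0. ball x0 (r x0)) ` D"] D(3) by (auto simp: image_iff)
  define c where "c = (\<Sum>x0\<in>D. C x0)"
  have c: "C x0 \<le> c" if "x0 \<in> D" for x0
    unfolding c_def using that D rC by (intro member_le_sum) auto
  have c0: "c \<ge> 0" unfolding c_def using D rC by (intro sum_nonneg) auto
  \<comment> \<open>The first summand handles distances below \<open>\<epsilon>\<close>, the second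
    the remaining ones, where \<open>2 * \<bar>B\<bar>\<close> is at most
    \<open>2 * \<bar>B\<bar> / \<epsilon>\<close> times the distance.\<close>
  define L where "L = c * M + 2 * \<bar>B\<bar> / \<epsilon>"
  show ?thesis
  proof (rule that[of L])
    fix f assume f: "segment_lipschitz M (closure \<Omega>) f" and B: "\<And>x. x \<in> closure \<Omega> \<Longrightarrow> \<bar>f x\<bar> \<le> B"
    show "L-lipschitz_on (closure \<Omega>) f"
    proof (rule lipschitz_onI)
      show L0: "0 \<le> L" using c0 M eps by (simp add: L_def)
      fix x y assume xy: "x \<in> closure \<Omega>" "y \<in> closure \<Omega>"
      show "dist (f x) (f y) \<le> L * dist x y"
      proof (cases "dist x y < \<epsilon>")
        case True
        obtain x0 where x0: "x0 \<in> D" "ball x \<epsilon> \<subseteq> ball x0 (r x0)" using eps xy by blast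
        have "x \<in> ball x \<epsilon>" "y \<in> ball x \<epsilon>" using eps True by auto
        have "\<bar>f x - f y\<bar> \<le> C x0 * M * norm (x - y)"
        proof -
          have "x0 \<in> closure \<Omega>" using x0 D(1) by blast
          then have "(C x0 * M)-lipschitz_on (closure \<Omega> \<inter> ball x0 (r x0)) f"
            using f rC[of x0] unfolding Q_def by blast
          moreover have "x \<in> closure \<Omega> \<inter> ball x0 (r x0)" "y \<in> closure \<Omega> \<inter> ball x0 (r x0)"
            using \<open>x \<in> ball x \<epsilon>\<close> \<open>y \<in> ball x \<epsilon>\<close> x0(2) xy by blast+
          ultimately show ?thesis using lipschitz_onD by (fastforce simp: dist_norm)
        qed
        also have "\<dots> \<le> L * norm (x - y)"
          using c[OF x0(1)] M eps(1) unfolding L_def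
          by (intro mult_right_mono) (auto intro!: add_increasing2 mult_right_mono)
        finally show ?thesis by (simp add: dist_norm)
      next
        case False
        have "\<bar>f x - f y\<bar> \<le> 2 * \<bar>B\<bar>" using B[OF xy(1)] B[OF xy(2)] by linarith
        also have "\<dots> \<le> 2 * \<bar>B\<bar> / \<epsilon> * dist x y"
          using False eps(1) mult_left_mono[of \<epsilon> "dist x y" "2 * \<bar>B\<bar>"] by (simp add: field_simps)
        also have "\<dots> \<le> L * dist x y"
          unfolding L_def using c0 M by (intro mult_right_mono) auto
        finally show ?thesis by (simp add: dist_norm)
      qed
    qed
  qed
qed

section \<open>Simplicial meshes\<close>

lemma affine_interpolation_exists:
  fixes f :: "'a::euclidean_space \<Rightarrow> real"
  assumes "\<not> affine_dependent C"
  shows "\<exists>a c. \<forall>v\<in>C. a \<bullet> v + c = f v"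
proof (cases "C = {}")
  case False
  then obtain v0 where v0: "v0 \<in> C" by blast
  have "independent ((\<lambda>x. - v0 + x) ` (C - {v0}))"
    using assms affine_dependent_iff_dependent2[OF v0] by simp
  from linear_independent_extend[OF this, of "\<lambda>x. f (v0 + x) - f v0"]
  obtain g where g: "linear g" "\<forall>x\<in>(\<lambda>x. - v0 + x) ` (C - {v0}). g x = f (v0 + x) - f v0"
    by blast
  define a where "a = (\<Sum>b\<in>Basis. g b *\<^sub>R b)"
  have ga: "g x = a \<bullet> x" for x
  proof -
    have "g x = (\<Sum>b\<in>Basis. (x \<bullet> b) * g b)"
      by (subst euclidean_representation[of x, symmetric], subst linear_sum[OF g(1)])
        (simp add: linear_scale[OF g(1)])
    also have "\<dots> = a \<bullet> x" 
      unfolding a_def inner_sum_left inner_scaleR_left by (simp add: inner_commute mult.commute)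
    finally show ?thesis .
  qed
  have "a \<bullet> v + (f v0 - a \<bullet> v0) = f v" if "v \<in> C" for v
  proof (cases "v = v0")
    case False
    then have "g (- v0 + v) = f v - f v0" using g(2) that by auto
    then show ?thesis unfolding ga by (simp add: inner_add_right inner_diff_right)
  qed simp
  then show ?thesis by blast
qed simp

text \<open>Barycentric coordinates, extended to affine functions on the whole space.\<close>

definition bary :: "'a::euclidean_space set \<Rightarrow> 'a \<Rightarrow> 'a \<Rightarrow> real" where
  "bary \<sigma> v = (SOME b. (\<exists>a c. \<forall>x. b x = a \<bullet> x + c) \<and> (\<forall>w\<in>vertices \<sigma>. b w = of_bool (w = v)))"

lemma simplex_vertices:
  fixes \<sigma> :: "'a::euclidean_space set"
  assumes "n simplex \<sigma>"
  shows "\<not> affine_dependent (vertices \<sigma>)" "finite (vertices \<sigma>)" "int (card (vertices \<sigma>)) = n + 1"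
    "\<sigma> = convex hull (vertices \<sigma>)"
proof -
  obtain C where C: "\<not> affine_dependent C" "int (card C) = n + 1" "\<sigma> = convex hull C"
    using assms by (auto simp: simplex_def)
  then have "vertices \<sigma> = C"
    by (auto simp: vertices_def extreme_point_of_convex_hull_affine_independent)
  then show "\<not> affine_dependent (vertices \<sigma>)" "finite (vertices \<sigma>)" "int (card (vertices \<sigma>)) = n + 1"
    "\<sigma> = convex hull (vertices \<sigma>)"
    using C aff_independent_finite by auto
qed

lemma bary_affine_vertex:
  assumes "n simplex \<sigma>"
  shows "\<exists>a c. \<forall>x. bary \<sigma> v x = a \<bullet> x + c" "w \<in> vertices \<sigma> \<Longrightarrow> bary \<sigma> v w = of_bool (w = v)"
proof -
  obtain a c where "\<forall>w\<in>vertices \<sigma>. a \<bullet> w + c = of_bool (w = v)"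
    using affine_interpolation_exists[OF simplex_vertices(1)[OF assms], of "\<lambda>w. of_bool (w = v)"] by blast
  then have "\<exists>b. (\<exists>a c. \<forall>x. b x = a \<bullet> x + c) \<and> (\<forall>w\<in>vertices \<sigma>. b w = of_bool (w = v))"
    by (intro exI[of _ "\<lambda>x. a \<bullet> x + c"]) blast
  from someI_ex[OF this]
  show "\<exists>a c. \<forall>x. bary \<sigma> v x = a \<bullet> x + c" "w \<in> vertices \<sigma> \<Longrightarrow> bary \<sigma> v w = of_bool (w = v)"
    unfolding bary_def by blast+
qed

lemma bary_sum:
  assumes "n simplex \<sigma>" "v \<in> vertices \<sigma>" "sum u (vertices \<sigma>) = 1"
  shows "bary \<sigma> v (\<Sum>w\<in>vertices \<sigma>. u w *\<^sub>R w) = u v"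
proof -
  obtain a c where ac: "\<And>x. bary \<sigma> v x = a \<bullet> x + c" using bary_affine_vertex(1)[OF assms(1)] by metis
  have "bary \<sigma> v (\<Sum>w\<in>vertices \<sigma>. u w *\<^sub>R w) = (\<Sum>w\<in>vertices \<sigma>. u w * (a \<bullet> w)) + c * sum u (vertices \<sigma>)"
    using assms(3) by (simp add: ac inner_sum_right)
  also have "\<dots> = (\<Sum>w\<in>vertices \<sigma>. u w * bary \<sigma> v w)"
    by (simp add: ac sum_distrib_left sum.distrib algebra_simps)
  also have "\<dots> = (\<Sum>w\<in>vertices \<sigma>. if w = v then u w else 0)"
    by (intro sum.cong) (auto simp: bary_affine_vertex(2)[OF assms(1)])
  also have "\<dots> = u v"
    using assms(2) simplex_vertices(2)[OF assms(1)] by simp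
  finally show ?thesis .
qed

lemma bary_coords:
  fixes \<sigma> :: "'a::euclidean_space set"
  assumes "int DIM('a) simplex \<sigma>"
  shows "(\<Sum>v\<in>vertices \<sigma>. bary \<sigma> v x) = 1" "(\<Sum>v\<in>vertices \<sigma>. bary \<sigma> v x *\<^sub>R v) = x"
proof -
  have "aff_dim (vertices \<sigma>) = int DIM('a)"
    using aff_dim_simplex[OF assms] simplex_vertices(4)[OF assms] aff_dim_convex_hull by metis
  then have "x \<in> affine hull (vertices \<sigma>)" by (simp add: aff_dim_eq_full)
  then obtain u where u: "sum u (vertices \<sigma>) = 1" "(\<Sum>v\<in>vertices \<sigma>. u v *\<^sub>R v) = x"
    using affine_hull_finite[OF simplex_vertices(2)[OF assms]] by auto
  have "bary \<sigma> v x = u v" if "v \<in> vertices \<sigma>" for v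
    using bary_sum[OF assms that u(1)] u(2) by simp
  then show "(\<Sum>v\<in>vertices \<sigma>. bary \<sigma> v x) = 1" "(\<Sum>v\<in>vertices \<sigma>. bary \<sigma> v x *\<^sub>R v) = x"
    using u by (simp_all cong: sum.cong)
qed

lemma mem_simplex_iff_bary:
  fixes \<sigma> :: "'a::euclidean_space set"
  assumes "int DIM('a) simplex \<sigma>"
  shows "x \<in> \<sigma> \<longleftrightarrow> (\<forall>v\<in>vertices \<sigma>. 0 \<le> bary \<sigma> v x)"
proof
  assume "x \<in> \<sigma>"
  then have "x \<in> convex hull (vertices \<sigma>)" using simplex_vertices(4)[OF assms] by simp
  then obtain u where u: "\<forall>v\<in>vertices \<sigma>. 0 \<le> u v" "sum u (vertices \<sigma>) = 1" "(\<Sum>v\<in>vertices \<sigma>. u v *\<^sub>R v) = x"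
    unfolding convex_hull_finite[OF simplex_vertices(2)[OF assms]] by auto
  then show "\<forall>v\<in>vertices \<sigma>. 0 \<le> bary \<sigma> v x"
    using bary_sum[OF assms _ u(2)] by auto
next
  assume "\<forall>v\<in>vertices \<sigma>. 0 \<le> bary \<sigma> v x"
  then have "x \<in> convex hull (vertices \<sigma>)"
    unfolding convex_hull_finite[OF simplex_vertices(2)[OF assms]] using bary_coords[OF assms, of x]
    by (intro CollectI exI[of _ "\<lambda>v. bary \<sigma> v x"]) simp
  then show "x \<in> \<sigma>" using simplex_vertices(4)[OF assms] by simp
qed

lemma bary_combine:
  assumes "n simplex \<sigma>" "s + t = 1"
  shows "bary \<sigma> v (s *\<^sub>R x + t *\<^sub>R y) = s * bary \<sigma> v x + t * bary \<sigma> v y"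
proof -
  obtain a c where ac: "\<And>x. bary \<sigma> v x = a \<bullet> x + c" using bary_affine_vertex(1)[OF assms(1)] by metis
  have "s * c + t * c = c" using assms(2) by (simp flip: distrib_right)
  then show ?thesis by (simp add: ac inner_add_right algebra_simps)
qed

lemma bary_le_1:
  fixes \<sigma> :: "'a::euclidean_space set"
  assumes "int DIM('a) simplex \<sigma>" "x \<in> \<sigma>" "v \<in> vertices \<sigma>"
  shows "bary \<sigma> v x \<le> 1"
proof -
  have "bary \<sigma> v x \<le> (\<Sum>v\<in>vertices \<sigma>. bary \<sigma> v x)"
    using assms simplex_vertices(2)[OF assms(1)] mem_simplex_iff_bary[OF assms(1), of x]
    by (intro member_le_sum) auto
  then show ?thesis using bary_coords(1)[OF assms(1)] by simp
qed

lemma vertices_subset: "vertices \<sigma> \<subseteq> \<sigma>"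
  by (auto simp: vertices_def extreme_point_of_def)

text \<open>The gradient \<open>a\<close> of a barycentric coordinate has norm 1 over the height of
  its vertex: descending from \<open>v\<close> along \<open>a\<close> by the length
  \<open>1 / norm a\<close> reaches the affine hull of the opposite facet.\<close>

lemma bary_lipschitz:
  fixes \<sigma> :: "'a::euclidean_space set"
  assumes "int DIM('a) simplex \<sigma>" "v \<in> vertices \<sigma>" and h: "min_height \<sigma> > 0"
  shows "\<bar>bary \<sigma> v x - bary \<sigma> v y\<bar> \<le> norm (x - y) / min_height \<sigma>"
proof -
  obtain a c where ac: "\<And>x. bary \<sigma> v x = a \<bullet> x + c" using bary_affine_vertex(1)[OF assms(1)] by metis
  have "norm a \<le> 1 / min_height \<sigma>"
  proof (cases "a = 0")
    case False
    define y0 where "y0 = v - (1 / (norm a)\<^sup>2) *\<^sub>R a"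
    have "bary \<sigma> v v = 1" using bary_affine_vertex(2)[OF assms(1,2)] by simp
    moreover have "a \<bullet> a / (norm a)\<^sup>2 = 1" using False by (simp add: power2_norm_eq_inner)
    ultimately have b0: "bary \<sigma> v y0 = 0" by (simp add: ac y0_def inner_diff_right)
    have fin: "finite (vertices \<sigma>)" using simplex_vertices(2)[OF assms(1)] .
    have "(\<Sum>w\<in>vertices \<sigma> - {v}. bary \<sigma> w y0) = 1" "(\<Sum>w\<in>vertices \<sigma> - {v}. bary \<sigma> w y0 *\<^sub>R w) = y0"
      using bary_coords[OF assms(1), of y0] b0 assms(2) fin by (simp_all add: sum.remove[of _ v])
    then have "y0 \<in> affine hull (vertices \<sigma> - {v})"
      using fin by (simp add: affine_hull_finite) blast
    then have "infdist v (affine hull (vertices \<sigma> - {v})) \<le> dist v y0" by (rule infdist_le)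
    also have "\<dots> = 1 / norm a" using False by (simp add: y0_def dist_norm power2_eq_square)
    finally have "min_height \<sigma> \<le> 1 / norm a"
      unfolding min_height_def using fin assms(2) by (subst Min_le_iff) auto
    then show ?thesis using h False by (simp add: field_simps)
  qed (use h in simp)
  then have "norm a * norm (x - y) \<le> 1 / min_height \<sigma> * norm (x - y)"
    by (intro mult_right_mono) auto
  moreover have "\<bar>bary \<sigma> v x - bary \<sigma> v y\<bar> \<le> norm a * norm (x - y)"
    using Cauchy_Schwarz_ineq2[of a "x - y"] by (simp add: ac inner_diff_right)
  ultimately show ?thesis by simp
qed

section \<open>Triangulations of the domain: patches, their boundaries and nodal
  interpolation\<close>

locale mesh =
  fixes \<Omega> :: "'a::euclidean_space set" and \<Sigma> :: "'a set set"
  assumes open_domain: "open \<Omega>" and bounded_domain: "bounded \<Omega>" and domain_ne: "\<Omega> \<noteq> {}"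
    and interior_closure: "interior (closure \<Omega>) = \<Omega>"
    and triangulation: "triangulation_of \<Omega> \<Sigma>"
begin

lemma finite_mesh: "finite \<Sigma>" and mesh_Un: "\<Union>\<Sigma> = closure \<Omega>"
  and full_simplex: "\<sigma> \<in> \<Sigma> \<Longrightarrow> int DIM('a) simplex \<sigma>"
  using triangulation by (auto simp: triangulation_of_def triangulation_def)

lemma Int_face_of: "\<sigma> \<in> \<Sigma> \<Longrightarrow> \<tau> \<in> \<Sigma> \<Longrightarrow> \<sigma> \<inter> \<tau> face_of \<sigma>"
  using triangulation by (auto simp: triangulation_of_def triangulation_def)

lemma closed_simplex_mesh: "\<sigma> \<in> \<Sigma> \<Longrightarrow> closed \<sigma>" and convex_simplex_mesh: "\<sigma> \<in> \<Sigma> \<Longrightarrow> convex \<sigma>"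
  and compact_simplex_mesh: "\<sigma> \<in> \<Sigma> \<Longrightarrow> compact \<sigma>"
  using full_simplex closed_simplex convex_simplex compact_simplex by blast+

lemma simplex_subset: "\<sigma> \<in> \<Sigma> \<Longrightarrow> \<sigma> \<subseteq> closure \<Omega>"
  using mesh_Un by blast

lemma obtain_simplex: 
  assumes "x \<in> closure \<Omega>" obtains \<sigma> where "\<sigma> \<in> \<Sigma>" "x \<in> \<sigma>"
  using assms mesh_Un by blast

lemma finite_vertices_mesh: "\<sigma> \<in> \<Sigma> \<Longrightarrow> finite (vertices \<sigma>)"
  using full_simplex simplex_vertices(2) by blast

lemma finite_nodes: "finite (nodes \<Sigma>)"
  using finite_mesh finite_vertices_mesh by (simp add: nodes_def)

lemma nodes_subset: "nodes \<Sigma> \<subseteq> closure \<Omega>"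
  using vertices_subset simplex_subset by (fastforce simp: nodes_def)

lemma node_cases:
  assumes "x \<in> nodes \<Sigma>" obtains "x \<in> nodes \<Sigma> \<inter> \<Omega>" | "x \<in> nodes \<Sigma> \<inter> frontier \<Omega>"
  using assms nodes_subset interior_open[OF open_domain] by (auto simp: frontier_def)

lemma vertex_nodes: "\<sigma> \<in> \<Sigma> \<Longrightarrow> v \<in> vertices \<sigma> \<Longrightarrow> v \<in> nodes \<Sigma>"
  by (auto simp: nodes_def)

text \<open>Conformity excludes hanging nodes: an extreme point of the common face of two simplices
  is an extreme point of both.\<close>

lemma vertex_of_containing:
  assumes "v \<in> nodes \<Sigma>" "\<tau> \<in> \<Sigma>" "v \<in> \<tau>"
  shows "v \<in> vertices \<tau>"
proof -
  obtain \<sigma> where s: "\<sigma> \<in> \<Sigma>" "v extreme_point_of \<sigma>"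
    using assms(1) by (auto simp: nodes_def vertices_def)
  have "v \<in> \<sigma>" using s(2) by (simp add: extreme_point_of_def)
  then have "v extreme_point_of (\<sigma> \<inter> \<tau>)"
    using extreme_point_of_face[OF Int_face_of[OF s(1) assms(2)]] s(2) assms(3) by simp
  then have "v extreme_point_of (\<tau> \<inter> \<sigma>)" by (simp add: Int_commute)
  then show ?thesis
    using extreme_point_of_face[OF Int_face_of[OF assms(2) s(1)]] by (simp add: vertices_def)
qed

text \<open>The finitely many simplices that miss \<open>y\<close> have a closed union, so they also
  miss a neighbourhood of \<open>y\<close>.\<close>

lemma eventually_covered:
  assumes "y \<in> \<Omega>"
  shows "\<forall>\<^sub>F z in nhds y. \<exists>\<tau>\<in>\<Sigma>. y \<in> \<tau> \<and> z \<in> \<tau>"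
proof -
  define U where "U = \<Union>{\<sigma>\<in>\<Sigma>. y \<notin> \<sigma>}"
  have "closed U" unfolding U_def using finite_mesh closed_simplex_mesh by (intro closed_Union) auto
  then have "open (\<Omega> - U)" using open_domain by blast
  moreover have "y \<in> \<Omega> - U" using assms by (auto simp: U_def)
  ultimately have "\<forall>\<^sub>F z in nhds y. z \<in> \<Omega> - U" by (rule eventually_nhds_in_open)
  then show ?thesis
  proof eventually_elim
    case (elim z)
    then obtain \<tau> where "\<tau> \<in> \<Sigma>" "z \<in> \<tau>" using obtain_simplex[of z] closure_subset by blast
    then show ?case using elim by (auto simp: U_def)
  qed
qed

lemma mem_patch_iff: "y \<in> patch \<Sigma> x \<longleftrightarrow> (\<forall>\<^sub>F z in nhds y. \<exists>\<tau>\<in>\<Sigma>. x \<in> vertices \<tau> \<and> z \<in> \<tau>)"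
proof -
  have "(\<exists>\<tau>\<in>\<Sigma>. x \<in> vertices \<tau> \<and> z \<in> \<tau>) \<longleftrightarrow> z \<in> \<Union>{\<sigma>\<in>\<Sigma>. x \<in> vertices \<sigma>}" for z by blast
  then show ?thesis
    by (simp only: patch_def mem_interior eventually_nhds_metric subset_iff mem_ball dist_commute)
qed

lemma node_in_patch:
  assumes "x \<in> nodes \<Sigma> \<inter> \<Omega>"
  shows "x \<in> patch \<Sigma> x"
  unfolding mem_patch_iff using eventually_covered[of x] assms
  by (auto elim!: eventually_mono intro: vertex_of_containing)

text \<open>Near a point with the same positive barycentric coordinates as \<open>y\<close>, the mesh looks like the mesh
  near \<open>y\<close>. Such points exist arbitrarily close to \<open>v\<close>, on the segment from \<open>v\<close> to \<open>y\<close>.\<close>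

lemma bary_pos_in_patch:
  assumes v: "v \<in> \<Omega>" and s: "\<sigma> \<in> \<Sigma>" "v \<in> vertices \<sigma>" "y \<in> \<sigma>" and pos: "bary \<sigma> v y > 0"
  shows "y \<in> patch \<Sigma> v"
proof (cases "y = v")
  case True
  then show ?thesis using node_in_patch v s vertex_nodes by blast
next
  case False
  have vs: "v \<in> \<sigma>" using s(2) vertices_subset by blast
  have vn: "v \<in> nodes \<Sigma>" using s vertex_nodes by blast
  have "(\<lambda>\<epsilon>. v + \<epsilon> *\<^sub>R (y - v)) \<midarrow>0\<rightarrow> v + 0 *\<^sub>R (y - v)" by (intro tendsto_intros)
  then have "\<forall>\<^sub>F \<epsilon> in at 0. v + \<epsilon> *\<^sub>R (y - v) \<in> \<Omega>"
    using topological_tendstoD[OF _ open_domain] v by auto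
  then have "\<forall>\<^sub>F \<epsilon> in at_right 0. v + \<epsilon> *\<^sub>R (y - v) \<in> \<Omega>"
    by (rule filter_leD[OF at_le, rotated]) simp
  then obtain b where b: "b > 0" "\<And>\<epsilon>. 0 < \<epsilon> \<Longrightarrow> \<epsilon> < b \<Longrightarrow> v + \<epsilon> *\<^sub>R (y - v) \<in> \<Omega>"
    by (auto simp: eventually_at_right_field)
  \<comment> \<open>Small enough for \<open>y'\<close> to stay in \<Omega> next to \<open>v\<close>.
    Membership of \<open>y\<close> in \<Omega> is not known yet, so
    \<open>eventually_covered\<close> is applied at \<open>y'\<close>.\<close>
  define \<epsilon> where "\<epsilon> = min b 1 / 2"
  have eps: "0 < \<epsilon>" "\<epsilon> < 1" "\<epsilon> < b" using b(1) by (auto simp: \<epsilon>_def)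
  define y' where "y' = v + \<epsilon> *\<^sub>R (y - v)"
  have y'\<Omega>: "y' \<in> \<Omega>" using b(2) eps by (simp add: y'_def)
  have y'_comb: "y' = (1 - \<epsilon>) *\<^sub>R v + \<epsilon> *\<^sub>R y" by (simp add: y'_def algebra_simps)
  define \<eta> where "\<eta> = bary \<sigma> v y"
  \<comment> \<open>The segment from \<open>v\<close> is prolonged beyond \<open>y\<close>. The
    coordinate at \<open>v\<close> becomes \<open>\<eta>\<^sup>2\<close> and the others are only
    enlarged, so \<open>y''\<close> stays in \<open>\<sigma>\<close>. Finding \<open>y''\<close> in
    a simplex \<open>\<tau>\<close> later shows that \<open>y\<close> has a positive coordinate at
    \<open>v\<close> there as well.\<close>
  define y'' where "y'' = (- \<eta>) *\<^sub>R v + (1 + \<eta>) *\<^sub>R y"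
  have \<eta>: "0 < \<eta>" "\<eta> \<le> 1" using pos bary_le_1[OF full_simplex] s by (auto simp: \<eta>_def)
  have "bary \<sigma> w y'' \<ge> 0" if w: "w \<in> vertices \<sigma>" for w
  proof -
    have "bary \<sigma> w y'' = - \<eta> * bary \<sigma> w v + (1 + \<eta>) * bary \<sigma> w y"
      unfolding y''_def by (intro bary_combine[OF full_simplex[OF s(1)]]) simp
    moreover have "bary \<sigma> w v = of_bool (v = w)"
      using bary_affine_vertex(2)[OF full_simplex[OF s(1)] s(2)] by simp
    moreover have "0 \<le> bary \<sigma> w y" using mem_simplex_iff_bary[OF full_simplex[OF s(1)]] s(3) w by blast
    ultimately show ?thesis using \<eta> by (cases "v = w") (auto simp: \<eta>_def algebra_simps)
  qed
  then have y''s: "y'' \<in> \<sigma>" using mem_simplex_iff_bary[OF full_simplex[OF s(1)]] by blast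
  have y_comb: "y = (\<eta> / (1 + \<eta>)) *\<^sub>R v + (1 / (1 + \<eta>)) *\<^sub>R y''"
  proof -
    have "1 / (1 + \<eta>) * (1 + \<eta>) = 1" "1 / (1 + \<eta>) * (- \<eta>) = - (\<eta> / (1 + \<eta>))" using \<eta> by auto
    then show ?thesis unfolding y''_def scaleR_add_right scaleR_scaleR by simp
  qed
  have seg: "y' \<in> open_segment v y''"
  proof -
    define t where "t = \<epsilon> / (1 + \<eta>)"
    have t: "0 < t" "t < 1" using eps \<eta> by (auto simp: t_def)
    have "y' = (1 - t) *\<^sub>R v + t *\<^sub>R y''"
    proof -
      have te: "t * (1 + \<eta>) = \<epsilon>" using \<eta> by (simp add: t_def)
      have "(1 - t) *\<^sub>R v + t *\<^sub>R y'' = (1 - t - t * \<eta>) *\<^sub>R v + (t * (1 + \<eta>)) *\<^sub>R y"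
        by (simp add: y''_def algebra_simps)
      moreover have "1 - t - t * \<eta> = 1 - \<epsilon>" using te by (simp add: algebra_simps)
      ultimately show ?thesis by (simp add: te y'_comb)
    qed
    moreover have "v \<noteq> y''"
    proof
      assume "v = y''"
      then have "(1 + \<eta>) *\<^sub>R (y - v) = 0" by (simp add: y''_def algebra_simps)
      then show False using False \<eta> by simp
    qed
    ultimately show ?thesis using t by (auto simp: in_segment)
  qed
  have seg2: "y' \<in> open_segment v y"
    using eps False by (auto simp: in_segment y'_comb)
  \<comment> \<open>The face property puts \<open>v\<close>, \<open>y\<close> and \<open>y''\<close>
    into every simplex through \<open>y'\<close>. Coordinates that are positive at \<open>y\<close>
    remain so nearby; those that vanish at \<open>y\<close> vanish at \<open>y'\<close> too, so they
    take equal values after the same displacement \<open>w\<close>.\<close>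
  have near: "v \<in> vertices \<tau> \<and> (\<forall>\<^sub>F w in nhds 0. y' + w \<in> \<tau> \<longrightarrow> y + w \<in> \<tau>)"
    if t: "\<tau> \<in> \<Sigma>" "y' \<in> \<tau>" for \<tau>
  proof -
    have y's: "y' \<in> \<sigma> \<inter> \<tau>"
      using t(2) convex_simplex_mesh[OF s(1)] vs s(3) eps unfolding y'_comb by (auto intro: convexD)
    have vt: "v \<in> \<tau>" and yt: "y \<in> \<tau>" and y''t: "y'' \<in> \<tau>"
      using face_ofD[OF Int_face_of[OF s(1) t(1)] seg2 vs s(3) y's]
        face_ofD[OF Int_face_of[OF s(1) t(1)] seg vs y''s y's] by auto
    have v\<tau>: "v \<in> vertices \<tau>" using vertex_of_containing[OF vn t(1) vt] .
    note ft = full_simplex[OF t(1)]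
    have nonneg: "0 \<le> bary \<tau> w z" if "w \<in> vertices \<tau>" "z \<in> \<tau>" for w z
      using mem_simplex_iff_bary[OF ft] that by blast
    have "bary \<tau> v y = \<eta> / (1 + \<eta>) * bary \<tau> v v + 1 / (1 + \<eta>) * bary \<tau> v y''"
      using y_comb bary_combine[OF ft, of "\<eta> / (1 + \<eta>)" "1 / (1 + \<eta>)" v v y''] \<eta>
      by (simp add: field_simps)
    moreover have "bary \<tau> v v = 1" using bary_affine_vertex(2)[OF ft v\<tau>] by simp
    moreover have "1 / (1 + \<eta>) * bary \<tau> v y'' \<ge> 0" "\<eta> / (1 + \<eta>) > 0"
      using nonneg[OF v\<tau> y''t] \<eta> by simp_all
    ultimately have posv: "bary \<tau> v y > 0" by (metis add_pos_nonneg mult.right_neutral)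
    have coord: "\<forall>\<^sub>F w in nhds 0. y' + w \<in> \<tau> \<longrightarrow> 0 \<le> bary \<tau> i (y + w)" if i: "i \<in> vertices \<tau>" for i
    proof -
      obtain a c where ac: "\<And>x. bary \<tau> i x = a \<bullet> x + c" using bary_affine_vertex(1)[OF ft] by metis
      show ?thesis
      proof (cases "bary \<tau> i y > 0")
        case True
        have "(\<lambda>w. bary \<tau> i (y + w)) \<midarrow>0\<rightarrow> bary \<tau> i (y + 0)"
          unfolding ac by (intro tendsto_intros)
        then have "\<forall>\<^sub>F w in nhds 0. 0 < bary \<tau> i (y + w)"
          using order_tendstoD(1)[of _ _ "at 0" 0] True by (simp add: eventually_nhds_conv_at)
        then show ?thesis by eventually_elim simp
      next
        case False
        then have y0: "bary \<tau> i y = 0" using nonneg[OF i yt] by simp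
        then have "i \<noteq> v" using posv by auto
        then have "bary \<tau> i v = 0" using bary_affine_vertex(2)[OF ft v\<tau>] by simp
        then have "bary \<tau> i y' = 0"
          unfolding y'_comb using bary_combine[OF ft, of "1 - \<epsilon>" \<epsilon>] y0 by simp
        then have "bary \<tau> i (y + w) = bary \<tau> i (y' + w)" for w
          using y0 by (simp add: ac inner_add_right)
        then show ?thesis using nonneg[OF i] by (intro always_eventually) auto
      qed
    qed
    have "\<forall>\<^sub>F w in nhds 0. \<forall>i\<in>vertices \<tau>. y' + w \<in> \<tau> \<longrightarrow> 0 \<le> bary \<tau> i (y + w)"
      by (rule eventually_ball_finite[OF finite_vertices_mesh[OF t(1)]], rule ballI, rule coord)
    then have "\<forall>\<^sub>F w in nhds 0. y' + w \<in> \<tau> \<longrightarrow> y + w \<in> \<tau>"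
      by eventually_elim (auto simp: mem_simplex_iff_bary[OF ft])
    then show ?thesis using v\<tau> by blast
  qed
  have tr: "(\<forall>\<^sub>F z in nhds x. P z) \<longleftrightarrow> (\<forall>\<^sub>F w in nhds 0. P (x + w))" for x :: 'a and P
  proof -
    have "nhds x = filtermap (\<lambda>w. x + w) (nhds 0)"
      using filtermap_nhds_shift[of "- x" 0] by (simp add: add.commute)
    then show ?thesis by (simp add: eventually_filtermap)
  qed
  have "\<forall>\<^sub>F w in nhds 0. \<forall>\<tau>\<in>{\<tau>\<in>\<Sigma>. y' \<in> \<tau>}. y' + w \<in> \<tau> \<longrightarrow> y + w \<in> \<tau>"
    using near finite_mesh by (subst eventually_ball_finite_distrib) auto
  moreover have "\<forall>\<^sub>F w in nhds 0. \<exists>\<tau>\<in>\<Sigma>. y' \<in> \<tau> \<and> y' + w \<in> \<tau>"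
    using eventually_covered[OF y'\<Omega>] unfolding tr[of _ y'] .
  ultimately have "\<forall>\<^sub>F w in nhds 0. \<exists>\<tau>\<in>\<Sigma>. v \<in> vertices \<tau> \<and> y + w \<in> \<tau>"
    by eventually_elim (use near in blast)
  then show ?thesis unfolding mem_patch_iff tr[of _ y] .
qed

lemma open_patch: "open (patch \<Sigma> x)"
  by (simp add: patch_def)

text \<open>The union of simplices lies only in the closure; \<open>interior_closure\<close> brings
  its interior back into \<Omega>.\<close>

lemma patch_subset: "patch \<Sigma> x \<subseteq> \<Omega>"
proof -
  have "\<Union>{\<sigma>\<in>\<Sigma>. x \<in> vertices \<sigma>} \<subseteq> closure \<Omega>" using simplex_subset by blast
  then show ?thesis unfolding patch_def using interior_mono interior_closure by blast
qed

lemma bounded_patch: "bounded (patch \<Sigma> x)"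
  using bounded_subset[OF bounded_domain patch_subset] .

lemma compact_frontier_patch: "compact (frontier (patch \<Sigma> x))"
  using bounded_patch compact_frontier_bounded by blast

text \<open>By \<open>bary_pos_in_patch\<close>, a point with positive coordinate at
  \<open>x\<close> is interior to the patch. So a competitor of the update lies on the facet
  opposite \<open>x\<close>, at least a height away from \<open>x\<close>.\<close>

lemma frontier_patchE:
  assumes "x \<in> \<Omega>" "y \<in> frontier (patch \<Sigma> x)"
  obtains \<sigma> where "\<sigma> \<in> \<Sigma>" "x \<in> vertices \<sigma>" "y \<in> \<sigma>" "bary \<sigma> x y = 0"
proof -
  have "closed (\<Union>{\<sigma>\<in>\<Sigma>. x \<in> vertices \<sigma>})"
    using finite_mesh closed_simplex_mesh by (intro closed_Union) auto
  then have "closure (patch \<Sigma> x) \<subseteq> \<Union>{\<sigma>\<in>\<Sigma>. x \<in> vertices \<sigma>}"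
    unfolding patch_def by (intro closure_minimal interior_subset)
  then obtain \<sigma> where s: "\<sigma> \<in> \<Sigma>" "x \<in> vertices \<sigma>" "y \<in> \<sigma>"
    using assms(2) by (auto simp: frontier_def)
  have "y \<notin> patch \<Sigma> x" using assms(2) open_patch by (simp add: frontier_def interior_open)
  then have "\<not> bary \<sigma> x y > 0" using bary_pos_in_patch[OF assms(1) s] by blast
  moreover have "0 \<le> bary \<sigma> x y" using mem_simplex_iff_bary[OF full_simplex[OF s(1)]] s by blast
  ultimately show ?thesis using that[OF s] by simp
qed

lemma frontier_patch_subset: "x \<in> \<Omega> \<Longrightarrow> frontier (patch \<Sigma> x) \<subseteq> closure \<Omega>"
  using frontier_patchE simplex_subset by (metis subsetD subsetI)

lemma frontier_patch_ne:
  assumes "x \<in> nodes \<Sigma> \<inter> \<Omega>"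
  shows "frontier (patch \<Sigma> x) \<noteq> {}"
  using node_in_patch[OF assms] bounded_patch[of x] not_bounded_UNIV frontier_eq_empty by (metis empty_iff)

lemma not_in_frontier_patch: "x \<in> nodes \<Sigma> \<inter> \<Omega> \<Longrightarrow> x \<notin> frontier (patch \<Sigma> x)"
  using node_in_patch open_patch by (simp add: frontier_def interior_open)

text \<open>Makes adjacent nodes admissible competitors in the update, from which the bound along
  edges follows.\<close>

lemma neighbour_in_frontier_patch:
  assumes s: "\<sigma> \<in> \<Sigma>" "x \<in> vertices \<sigma>" "w \<in> vertices \<sigma>" and "w \<noteq> x" "x \<in> \<Omega>"
  shows "w \<in> frontier (patch \<Sigma> x)"
proof -
  have xw: "x \<in> \<sigma>" "w \<in> \<sigma>" using s vertices_subset by blast+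
  have "w \<notin> patch \<Sigma> x"
  proof
    assume "w \<in> patch \<Sigma> x"
    then have ev: "\<forall>\<^sub>F z in nhds w. \<exists>\<tau>\<in>\<Sigma>. x \<in> vertices \<tau> \<and> z \<in> \<tau>" by (simp add: mem_patch_iff)
    \<comment> \<open>A point slightly beyond \<open>w\<close> on the ray from \<open>x\<close>
      would lie in a simplex with vertex \<open>x\<close>; then \<open>w\<close> would be inside a
      segment of that simplex, although it is one of its vertices.\<close>
    have "((\<lambda>t. w + t *\<^sub>R (w - x)) \<longlongrightarrow> w + 0 *\<^sub>R (w - x)) (at_right 0)" by (intro tendsto_intros)
    then have "\<forall>\<^sub>F t in at_right 0. \<exists>\<tau>\<in>\<Sigma>. x \<in> vertices \<tau> \<and> w + t *\<^sub>R (w - x) \<in> \<tau>"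
      using ev by (auto simp: filterlim_iff)
    then have "\<forall>\<^sub>F t in at_right 0. t > 0 \<and> (\<exists>\<tau>\<in>\<Sigma>. x \<in> vertices \<tau> \<and> w + t *\<^sub>R (w - x) \<in> \<tau>)"
      using eventually_at_right_less by (rule eventually_conj[rotated])
    then obtain t \<tau> where t: "t > 0" "\<tau> \<in> \<Sigma>" "x \<in> vertices \<tau>" "w + t *\<^sub>R (w - x) \<in> \<tau>"
      using eventually_happens'[OF trivial_limit_at_right_real] by blast
    have xt: "x \<in> \<tau>" using t(3) vertices_subset by blast
    have eq: "w = (1 - 1 / (1 + t)) *\<^sub>R x + (1 / (1 + t)) *\<^sub>R (w + t *\<^sub>R (w - x))"
    proof -
      define b where "b = 1 / (1 + t)"
      have "b + b * t = 1" using t(1) by (simp add: b_def field_simps)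
      moreover have "(1 - b) *\<^sub>R x + b *\<^sub>R (w + t *\<^sub>R (w - x)) = (1 - (b + b * t)) *\<^sub>R x + (b + b * t) *\<^sub>R w"
        by (simp add: algebra_simps)
      ultimately show ?thesis by (simp add: b_def)
    qed
    have ne: "x \<noteq> w + t *\<^sub>R (w - x)"
    proof
      assume "x = w + t *\<^sub>R (w - x)"
      then have "(1 + t) *\<^sub>R (w - x) = 0" by (simp add: algebra_simps)
      then show False using t(1) assms(4) by simp
    qed
    have seg: "w \<in> open_segment x (w + t *\<^sub>R (w - x))"
      unfolding in_segment using t(1) ne by (intro conjI exI[of _ "1 / (1 + t)"] eq) auto
    then have "w \<in> \<tau>"
      using convex_simplex_mesh[OF t(2)] xt t(4) by (meson convex_contains_open_segment subsetD)
    then have "w \<in> vertices \<tau>" using vertex_of_containing vertex_nodes s t(2) by blast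
    then show False using seg xt t(4) by (auto simp: vertices_def extreme_point_of_def)
  qed
  moreover have "w \<in> closure (patch \<Sigma> x)"
  proof -
    define z where "z n = (inverse (real (Suc n))) *\<^sub>R x + (1 - inverse (real (Suc n))) *\<^sub>R w" for n
    have "z n \<in> patch \<Sigma> x" for n
    proof -
      have i: "0 < inverse (real (Suc n))" "inverse (real (Suc n)) \<le> 1" by (auto simp: field_simps)
      have "z n \<in> \<sigma>" unfolding z_def
        using convex_simplex_mesh[OF s(1)] xw i by (intro convexD) auto
      moreover have "bary \<sigma> x (z n) = inverse (real (Suc n))"
        unfolding z_def using bary_combine[OF full_simplex[OF s(1)], of "inverse (real (Suc n))" "1 - inverse (real (Suc n))" x x w]
          bary_affine_vertex(2)[OF full_simplex[OF s(1)]] s(2,3) assms(4) by simp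
      ultimately show ?thesis using bary_pos_in_patch[OF assms(5) s(1,2)] i by simp
    qed
    moreover have "z \<longlonglongrightarrow> 0 *\<^sub>R x + (1 - 0) *\<^sub>R w"
      unfolding z_def by (intro tendsto_intros LIMSEQ_inverse_real_of_nat)
    ultimately show ?thesis unfolding closure_sequential by auto
  qed
  ultimately show ?thesis using open_patch by (simp add: frontier_def interior_open)
qed

text \<open>A vertex in \<Omega> with positive weight at \<open>z\<close> would put \<open>z\<close>
  into its patch, hence into \<Omega>.\<close>

lemma boundary_vertex:
  assumes "z \<in> frontier \<Omega>" "\<sigma> \<in> \<Sigma>" "z \<in> \<sigma>" "v \<in> vertices \<sigma>" "bary \<sigma> v z > 0"
  shows "v \<in> frontier \<Omega>"
proof (rule ccontr)
  assume "v \<notin> frontier \<Omega>"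
  then have "v \<in> \<Omega>"
    using assms nodes_subset vertex_nodes interior_open[OF open_domain] by (auto simp: frontier_def)
  then have "z \<in> \<Omega>" using bary_pos_in_patch assms patch_subset by blast
  then show False using assms(1) open_domain by (simp add: frontier_def interior_open)
qed

lemma fe_space_bary:
  assumes "u \<in> fe_space \<Omega> \<Sigma>" "\<sigma> \<in> \<Sigma>" "y \<in> \<sigma>"
  shows "u y = (\<Sum>v\<in>vertices \<sigma>. bary \<sigma> v y * u v)"
proof -
  obtain a c where ac: "\<And>x. x \<in> \<sigma> \<Longrightarrow> u x = a \<bullet> x + c"
    using assms(1,2) by (auto simp: fe_space_def)
  note f = full_simplex[OF assms(2)]
  have "(\<Sum>v\<in>vertices \<sigma>. bary \<sigma> v y * u v) = (\<Sum>v\<in>vertices \<sigma>. bary \<sigma> v y * (a \<bullet> v + c))"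
    by (intro sum.cong refl) (simp add: ac[OF subsetD[OF vertices_subset]])
  also have "\<dots> = a \<bullet> (\<Sum>v\<in>vertices \<sigma>. bary \<sigma> v y *\<^sub>R v) + (\<Sum>v\<in>vertices \<sigma>. bary \<sigma> v y) * c"
    by (simp add: inner_sum_right sum_distrib_right sum.distrib distrib_left)
  also have "\<dots> = u y" using bary_coords[OF f] ac[OF assms(3)] by simp
  finally show ?thesis by simp
qed

lemma fe_space_mono:
  assumes "u \<in> fe_space \<Omega> \<Sigma>" "w \<in> fe_space \<Omega> \<Sigma>" "\<And>x. x \<in> nodes \<Sigma> \<Longrightarrow> u x \<le> w x" "y \<in> closure \<Omega>"
  shows "u y \<le> w y"
proof -
  obtain \<sigma> where s: "\<sigma> \<in> \<Sigma>" "y \<in> \<sigma>" using obtain_simplex[OF assms(4)] .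
  show ?thesis
    unfolding fe_space_bary[OF assms(1) s] fe_space_bary[OF assms(2) s]
    using mem_simplex_iff_bary[OF full_simplex[OF s(1)]] s assms(3) vertex_nodes
    by (intro sum_mono mult_left_mono) auto
qed

lemma fe_space_eqI:
  assumes "u \<in> fe_space \<Omega> \<Sigma>" "w \<in> fe_space \<Omega> \<Sigma>" "\<And>x. x \<in> nodes \<Sigma> \<Longrightarrow> u x = w x"
  shows "u = w"
proof (rule extensionalityI)
  show "u \<in> extensional (closure \<Omega>)" "w \<in> extensional (closure \<Omega>)"
    using assms by (auto simp: fe_space_def)
  show "u x = w x" if "x \<in> closure \<Omega>" for x
    using fe_space_mono[of u w x] fe_space_mono[of w u x] assms that by force
qed

text \<open>The affine pieces fit together because the intersection of two simplices is a common
  face: the extreme points of the face are vertices of both, and the set where two affine functions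
  agree is convex.\<close>

lemma interpolant_exists: "\<exists>u\<in>fe_space \<Omega> \<Sigma>. \<forall>x\<in>nodes \<Sigma>. u x = U x"
proof -
  define A where "A \<sigma> x = (\<Sum>v\<in>vertices \<sigma>. bary \<sigma> v x * U v)" for \<sigma> x
  have affine: "\<exists>a c. \<forall>x. A \<sigma> x = a \<bullet> x + c" if s: "\<sigma> \<in> \<Sigma>" for \<sigma>
  proof -
    obtain a c where "\<And>v x. bary \<sigma> v x = a v \<bullet> x + c v"
      using bary_affine_vertex(1)[OF full_simplex[OF s]] by metis
    then have "A \<sigma> x = (\<Sum>v\<in>vertices \<sigma>. U v *\<^sub>R a v) \<bullet> x + (\<Sum>v\<in>vertices \<sigma>. c v * U v)" for x
      by (simp add: A_def inner_sum_left sum.distrib algebra_simps)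
    then show ?thesis by blast
  qed
  have vertex: "A \<sigma> w = U w" if "\<sigma> \<in> \<Sigma>" "w \<in> vertices \<sigma>" for \<sigma> w
  proof -
    have "A \<sigma> w = (\<Sum>v\<in>vertices \<sigma>. if v = w then U v else 0)"
      unfolding A_def by (intro sum.cong) (auto simp: bary_affine_vertex(2)[OF full_simplex[OF that(1)] that(2)])
    then show ?thesis using that finite_vertices_mesh by simp
  qed
  have glue: "A \<sigma> x = A \<tau> x" if st: "\<sigma> \<in> \<Sigma>" "\<tau> \<in> \<Sigma>" and x: "x \<in> \<sigma>" "x \<in> \<tau>" for \<sigma> \<tau> x
  proof -
    obtain a c a' c' where ac: "\<And>x. A \<sigma> x = a \<bullet> x + c" "\<And>x. A \<tau> x = a' \<bullet> x + c'"
      using affine st by metis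
    have "{x. A \<sigma> x = A \<tau> x} = {x. (a - a') \<bullet> x = c' - c}"
      by (auto simp: ac inner_diff_left)
    then have conv: "convex {x. A \<sigma> x = A \<tau> x}" by (simp add: convex_hyperplane)
    have sub: "{v. v extreme_point_of (\<sigma> \<inter> \<tau>)} \<subseteq> {x. A \<sigma> x = A \<tau> x}"
    proof
      fix v assume "v \<in> {v. v extreme_point_of (\<sigma> \<inter> \<tau>)}"
      then have v: "v extreme_point_of (\<sigma> \<inter> \<tau>)" by simp
      then have v': "v extreme_point_of (\<tau> \<inter> \<sigma>)" by (simp only: Int_commute)
      have "v \<in> vertices \<sigma>" "v \<in> vertices \<tau>"
        using v v' extreme_point_of_face[OF Int_face_of[OF st(1,2)], of v]
          extreme_point_of_face[OF Int_face_of[OF st(2,1)], of v]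
        unfolding vertices_def by blast+
      then show "v \<in> {x. A \<sigma> x = A \<tau> x}" using vertex st by simp
    qed
    have "\<sigma> \<inter> \<tau> = convex hull {v. v extreme_point_of (\<sigma> \<inter> \<tau>)}"
      using st compact_simplex_mesh convex_simplex_mesh
      by (intro Krein_Milman_Minkowski compact_Int convex_Int)
    also have "\<dots> \<subseteq> {x. A \<sigma> x = A \<tau> x}" by (rule hull_minimal, rule sub, rule conv)
    finally show ?thesis using x by blast
  qed
  define u where "u x = (if x \<in> closure \<Omega> then A (SOME \<sigma>. \<sigma> \<in> \<Sigma> \<and> x \<in> \<sigma>) x else undefined)" for x
  have uA: "u x = A \<sigma> x" if "\<sigma> \<in> \<Sigma>" "x \<in> \<sigma>" for \<sigma> x
  proof -
    have "(SOME \<sigma>. \<sigma> \<in> \<Sigma> \<and> x \<in> \<sigma>) \<in> \<Sigma> \<and> x \<in> (SOME \<sigma>. \<sigma> \<in> \<Sigma> \<and> x \<in> \<sigma>)"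
      by (rule someI) (use that in blast)
    then have "A (SOME \<sigma>. \<sigma> \<in> \<Sigma> \<and> x \<in> \<sigma>) x = A \<sigma> x" using glue that by blast
    moreover have "x \<in> closure \<Omega>" using that simplex_subset by blast
    ultimately show ?thesis by (simp add: u_def)
  qed
  have "continuous_on (\<Union>\<sigma>\<in>\<Sigma>. \<sigma>) u"
  proof (rule continuous_on_closed_Union[OF finite_mesh closed_simplex_mesh])
    fix \<sigma> assume s: "\<sigma> \<in> \<Sigma>"
    obtain a c where "\<And>x. A \<sigma> x = a \<bullet> x + c" using affine[OF s] by blast
    then have "continuous_on \<sigma> (A \<sigma>)" by (simp add: continuous_on_add continuous_on_inner continuous_on_const continuous_on_id cong: continuous_on_cong)
    then show "continuous_on \<sigma> u" using uA[OF s] by (simp cong: continuous_on_cong)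
  qed
  then have "continuous_on (closure \<Omega>) u" using mesh_Un by simp
  moreover have "u \<in> extensional (closure \<Omega>)" by (auto simp: extensional_def u_def)
  moreover have "\<exists>a c. \<forall>x\<in>\<sigma>. u x = a \<bullet> x + c" if "\<sigma> \<in> \<Sigma>" for \<sigma>
    using uA[OF that] affine[OF that] by metis
  ultimately have "u \<in> fe_space \<Omega> \<Sigma>" by (simp add: fe_space_def)
  moreover have "u x = U x" if "x \<in> nodes \<Sigma>" for x
    using that uA vertex vertices_subset by (fastforce simp: nodes_def)
  ultimately show ?thesis by blast
qed

end

section \<open>The discrete problem\<close>

text \<open>The cost \<open>r\<close> stands for the support function. The growth constant
  \<open>R\<close> also serves as the slope of the upper barriers.\<close>

locale discrete_hamilton_jacobi = mesh \<Omega> \<Sigma>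
  for \<Omega> :: "'a::euclidean_space set" and \<Sigma> +
  fixes r :: "'a \<Rightarrow> 'a \<Rightarrow> real" and R :: real
  assumes r_pos: "x \<in> \<Omega> \<Longrightarrow> q \<noteq> 0 \<Longrightarrow> 0 < r x q"
    and r_continuous: "x \<in> \<Omega> \<Longrightarrow> continuous_on UNIV (r x)"
    and r_le: "x \<in> \<Omega> \<Longrightarrow> r x q \<le> R * norm q"
begin

definition dsub :: "('a \<Rightarrow> real) \<Rightarrow> bool" where
  "dsub u \<longleftrightarrow> u \<in> fe_space \<Omega> \<Sigma> \<and>
     (\<forall>x\<in>nodes \<Sigma> \<inter> \<Omega>. \<forall>y\<in>frontier (patch \<Sigma> x). u x \<le> u y + r x (x - y))"

text \<open>With \<open>dsub\<close> this splits the equation at a node into two inequalities. The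
  existential form expresses that the minimum is attained.\<close>

definition dsup :: "('a \<Rightarrow> real) \<Rightarrow> bool" where
  "dsup u \<longleftrightarrow> u \<in> fe_space \<Omega> \<Sigma> \<and>
     (\<forall>x\<in>nodes \<Sigma> \<inter> \<Omega>. \<exists>y\<in>frontier (patch \<Sigma> x). u y + r x (x - y) \<le> u x)"

lemma R_pos: "R > 0"
proof -
  obtain x where x: "x \<in> \<Omega>" using domain_ne by blast
  obtain b :: 'a where b: "b \<in> Basis" using nonempty_Basis by blast
  have "0 < r x b" using r_pos[OF x] b nonzero_Basis by blast
  also have "\<dots> \<le> R" using r_le[OF x, of b] b by simp
  finally show ?thesis .
qed

lemma r_frontier_pos:
  assumes "x \<in> nodes \<Sigma> \<inter> \<Omega>" "y \<in> frontier (patch \<Sigma> x)"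
  shows "0 < r x (x - y)"
proof -
  have "x \<noteq> y" using not_in_frontier_patch[OF assms(1)] assms(2) by blast
  then show ?thesis using r_pos assms(1) by simp
qed

lemma discrete_comparison_nodes:
  assumes u: "dsub u" and v: "dsup v"
    and bd: "\<And>x. x \<in> nodes \<Sigma> \<inter> frontier \<Omega> \<Longrightarrow> u x \<le> v x" and x: "x \<in> nodes \<Sigma>"
  shows "u x \<le> v x"
proof (rule ccontr)
  assume neg: "\<not> u x \<le> v x"
  define M where "M = Max ((\<lambda>z. u z - v z) ` nodes \<Sigma>)"
  have fin: "finite ((\<lambda>z. u z - v z) ` nodes \<Sigma>)" using finite_nodes by blast
  have le_M: "u z - v z \<le> M" if "z \<in> nodes \<Sigma>" for z
    unfolding M_def using fin that by (intro Max_ge) auto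
  have M: "M > 0" using le_M[OF x] neg by linarith
  define A where "A = {z \<in> nodes \<Sigma>. u z - v z = M}"
  have "M \<in> (\<lambda>z. u z - v z) ` nodes \<Sigma>"
    unfolding M_def using fin x by (intro Max_in) auto
  then have "finite A" "A \<noteq> {}" using finite_nodes by (auto simp: A_def)
  then obtain p where p: "p \<in> A" "\<And>z. z \<in> A \<Longrightarrow> v p \<le> v z"
    using arg_min_if_finite(1)[of A v] arg_min_least[of A _ v] by blast
  have pn: "p \<in> nodes \<Sigma>" "u p - v p = M" using p(1) by (auto simp: A_def)
  have pO: "p \<in> nodes \<Sigma> \<inter> \<Omega>"
    using pn(1)
  proof (cases rule: node_cases)
    case 2
    then have "u p \<le> v p" by (rule bd)
    then show ?thesis using pn(2) M by linarith
  qed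
  obtain y where y: "y \<in> frontier (patch \<Sigma> p)" "v y + r p (p - y) \<le> v p"
    using v pO unfolding dsup_def by blast
  have "u p \<le> u y + r p (p - y)" using u pO y(1) unfolding dsub_def by blast
  then have yM: "u y - v y \<ge> M" using y(2) pn(2) by linarith
  obtain \<sigma> where s: "\<sigma> \<in> \<Sigma>" "y \<in> \<sigma>" using frontier_patchE y(1) pO by blast
  note f = full_simplex[OF s(1)]
  have nn: "0 \<le> bary \<sigma> w y" if "w \<in> vertices \<sigma>" for w using mem_simplex_iff_bary[OF f] s(2) that by blast
  have uy: "u y = (\<Sum>w\<in>vertices \<sigma>. bary \<sigma> w y * u w)" and vy: "v y = (\<Sum>w\<in>vertices \<sigma>. bary \<sigma> w y * v w)"
    using fe_space_bary s u v by (auto simp: dsub_def dsup_def)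
  have one: "c = (\<Sum>w\<in>vertices \<sigma>. bary \<sigma> w y * c)" for c
    using bary_coords(1)[OF f, of y] by (simp flip: sum_distrib_right)
  \<comment> \<open>A combination of nonnegative gaps that is at most 0: every vertex with positive
    weight at \<open>y\<close> attains the maximum \<open>M\<close>, so its value of
    \<open>v\<close> is at least \<open>v p\<close>. The average \<open>v y\<close> is then at least
    \<open>v p\<close> as well.\<close>
  have "(\<Sum>w\<in>vertices \<sigma>. bary \<sigma> w y * (M - (u w - v w))) = M - (u y - v y)"
    unfolding uy vy by (subst (2) one[of M]) (simp add: sum_subtractf right_diff_distrib)
  moreover define F where "F w = bary \<sigma> w y * (M - (u w - v w))" for w
  ultimately have "sum F (vertices \<sigma>) \<le> 0" using yM by simp
  moreover have t: "0 \<le> F w" if "w \<in> vertices \<sigma>" for w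
    using nn[OF that] le_M vertex_nodes[OF s(1) that] by (simp add: F_def)
  ultimately have "sum F (vertices \<sigma>) = 0" using sum_nonneg[of "vertices \<sigma>" F] by fastforce
  then have "\<forall>w\<in>vertices \<sigma>. F w = 0"
    using sum_nonneg_eq_0_iff[of "vertices \<sigma>" F] finite_vertices_mesh[OF s(1)] t by blast
  then have "bary \<sigma> w y * v p \<le> bary \<sigma> w y * v w" if "w \<in> vertices \<sigma>" for w
  proof (cases "bary \<sigma> w y = 0")
    case False
    moreover have "F w = 0" using \<open>\<forall>w\<in>vertices \<sigma>. F w = 0\<close> that by blast
    ultimately have "M - (u w - v w) = 0" unfolding F_def mult_eq_0_iff by blast
    then have "u w - v w = M" by linarith
    then have "v p \<le> v w" using p(2)[of w] vertex_nodes[OF s(1) that] by (simp add: A_def)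
    then show ?thesis using nn[OF that] by (rule mult_left_mono)
  qed simp
  then have "v p \<le> v y" unfolding vy by (subst one[of "v p"]) (rule sum_mono)
  then show False using y(2) r_frontier_pos[OF pO y(1)] by linarith
qed

lemma discrete_comparison:
  assumes "dsub u" "dsup v" "\<And>x. x \<in> nodes \<Sigma> \<inter> frontier \<Omega> \<Longrightarrow> u x \<le> v x" "x \<in> closure \<Omega>"
  shows "u x \<le> v x"
  using fe_space_mono[OF _ _ discrete_comparison_nodes[OF assms(1-3)] assms(4)] assms(1,2)
  by (auto simp: dsub_def dsup_def)

lemma update_attained:
  assumes "u \<in> fe_space \<Omega> \<Sigma>" "x \<in> nodes \<Sigma> \<inter> \<Omega>"
  obtains y where "y \<in> frontier (patch \<Sigma> x)"
    "\<And>z. z \<in> frontier (patch \<Sigma> x) \<Longrightarrow> u y + r x (x - y) \<le> u z + r x (x - z)"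
    "(INF z\<in>frontier (patch \<Sigma> x). u z + r x (x - z)) = u y + r x (x - y)"
proof -
  have "continuous_on (frontier (patch \<Sigma> x)) u"
    using assms frontier_patch_subset by (auto simp: fe_space_def intro: continuous_on_subset)
  then have "continuous_on (frontier (patch \<Sigma> x)) (\<lambda>z. u z + r x (x - z))"
    using assms(2) by (intro continuous_intros continuous_on_compose2[OF r_continuous]) auto
  then obtain y where y: "y \<in> frontier (patch \<Sigma> x)"
    "\<And>z. z \<in> frontier (patch \<Sigma> x) \<Longrightarrow> u y + r x (x - y) \<le> u z + r x (x - z)"
    using continuous_attains_inf[OF compact_frontier_patch frontier_patch_ne[OF assms(2)]] by blast
  moreover have "(INF z\<in>frontier (patch \<Sigma> x). u z + r x (x - z)) = u y + r x (x - y)"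
    using y by (intro cInf_eq_minimum) auto
  ultimately show ?thesis using that by blast
qed

lemma fixed_point_iff:
  assumes "u \<in> fe_space \<Omega> \<Sigma>"
  shows "(\<forall>x\<in>nodes \<Sigma> \<inter> \<Omega>. u x = (INF z\<in>frontier (patch \<Sigma> x). u z + r x (x - z))) \<longleftrightarrow> dsub u \<and> dsup u"
proof -
  have "u x = (INF z\<in>frontier (patch \<Sigma> x). u z + r x (x - z)) \<longleftrightarrow>
     (\<forall>y\<in>frontier (patch \<Sigma> x). u x \<le> u y + r x (x - y)) \<and>
     (\<exists>y\<in>frontier (patch \<Sigma> x). u y + r x (x - y) \<le> u x)" if x: "x \<in> nodes \<Sigma> \<inter> \<Omega>" for x
  proof -
    obtain y where y: "y \<in> frontier (patch \<Sigma> x)"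
      "\<And>z. z \<in> frontier (patch \<Sigma> x) \<Longrightarrow> u y + r x (x - y) \<le> u z + r x (x - z)"
      "(INF z\<in>frontier (patch \<Sigma> x). u z + r x (x - z)) = u y + r x (x - y)"
      using update_attained[OF assms x] by blast
    show ?thesis unfolding y(3) using y(1,2) by force
  qed
  then show ?thesis using assms unfolding dsub_def dsup_def by auto
qed

text \<open>The nodal supremum \<open>s\<close> of all subsolutions below \<open>g\<close> is
  improved by one update to \<open>w\<close>. The update is monotone, so \<open>w\<close> is again
  such a subsolution; maximality gives \<open>w = s\<close>, and \<open>s\<close> is a fixed
  point.\<close>

lemma perron_solution_exists:
  assumes u0: "dsub u0" "\<And>x. x \<in> nodes \<Sigma> \<inter> frontier \<Omega> \<Longrightarrow> u0 x \<le> g x"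
    and V: "dsup V" "\<And>x. x \<in> nodes \<Sigma> \<inter> frontier \<Omega> \<Longrightarrow> g x \<le> V x"
  shows "\<exists>w. dsub w \<and> dsup w \<and> (\<forall>x\<in>nodes \<Sigma> \<inter> frontier \<Omega>. w x = g x)"
proof -
  define S where "S = {u. dsub u \<and> (\<forall>x\<in>nodes \<Sigma> \<inter> frontier \<Omega>. u x \<le> g x)}"
  have S_ne: "S \<noteq> {}" using u0 by (auto simp: S_def)
  have SV: "u x \<le> V x" if "u \<in> S" "x \<in> nodes \<Sigma>" for u x
    by (rule discrete_comparison_nodes[OF _ V(1)]) (use that in \<open>auto simp: S_def intro: order_trans[OF _ V(2)]\<close>)
  have bdd: "bdd_above ((\<lambda>u. u x) ` S)" if "x \<in> nodes \<Sigma>" for x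
    using SV that by (intro bdd_aboveI2) blast
  obtain s where s: "s \<in> fe_space \<Omega> \<Sigma>" "\<And>x. x \<in> nodes \<Sigma> \<Longrightarrow> s x = (SUP u\<in>S. u x)"
    using interpolant_exists[of "\<lambda>x. SUP u\<in>S. u x"] by blast
  \<comment> \<open>Nodal order passes to the closure because interpolation weights are nonnegative;
    this is needed since competitors \<open>y\<close> are not nodes.\<close>
  have S_le: "u x \<le> s x" if "u \<in> S" "x \<in> closure \<Omega>" for u x
    by (rule fe_space_mono[of u s]) (use that s bdd in \<open>auto simp: S_def dsub_def intro: cSUP_upper\<close>)
  have s_sub: "s x \<le> s y + r x (x - y)" if "x \<in> nodes \<Sigma> \<inter> \<Omega>" "y \<in> frontier (patch \<Sigma> x)" for x y
  proof -
    have "u x \<le> s y + r x (x - y)" if u: "u \<in> S" for u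
    proof -
      have "u x \<le> u y + r x (x - y)"
        using u \<open>x \<in> nodes \<Sigma> \<inter> \<Omega>\<close> \<open>y \<in> frontier (patch \<Sigma> x)\<close> by (auto simp: S_def dsub_def)
      moreover have "u y \<le> s y"
        using S_le[OF u] frontier_patch_subset \<open>x \<in> nodes \<Sigma> \<inter> \<Omega>\<close> \<open>y \<in> frontier (patch \<Sigma> x)\<close> by blast
      ultimately show ?thesis by linarith
    qed
    then show ?thesis using that(1) S_ne by (subst s(2)) (auto intro: cSUP_least)
  qed
  \<comment> \<open>At boundary nodes the value is raised to \<open>g\<close> itself, so the
    boundary condition comes out of the same maximality.\<close>
  define U where "U x = (if x \<in> \<Omega> then (INF z\<in>frontier (patch \<Sigma> x). s z + r x (x - z)) else g x)" for x
  obtain w where w: "w \<in> fe_space \<Omega> \<Sigma>" "\<And>x. x \<in> nodes \<Sigma> \<Longrightarrow> w x = U x"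
    using interpolant_exists[of U] by blast
  have not_both: "x \<notin> \<Omega>" if "x \<in> frontier \<Omega>" for x
    using that open_domain by (simp add: frontier_def interior_open)
  have sw: "s x \<le> w x" if "x \<in> nodes \<Sigma>" for x
    using that
  proof (cases rule: node_cases)
    case 1
    obtain y where y: "y \<in> frontier (patch \<Sigma> x)"
      "(INF z\<in>frontier (patch \<Sigma> x). s z + r x (x - z)) = s y + r x (x - y)"
      using update_attained[OF s(1) 1] by blast
    then show ?thesis using s_sub[OF 1 y(1)] w(2) 1 by (simp add: U_def)
  next
    case 2
    have "s x \<le> g x" using 2 S_ne by (subst s(2)) (auto simp: S_def intro!: cSUP_least)
    then show ?thesis using 2 w(2) not_both by (simp add: U_def)
  qed
  then have sw_cl: "s x \<le> w x" if "x \<in> closure \<Omega>" for x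
    using fe_space_mono[OF s(1) w(1)] that by blast
  have "w x \<le> w y + r x (x - y)" if x: "x \<in> nodes \<Sigma> \<inter> \<Omega>" and y: "y \<in> frontier (patch \<Sigma> x)" for x y
  proof -
    obtain y' where y': "\<And>z. z \<in> frontier (patch \<Sigma> x) \<Longrightarrow> s y' + r x (x - y') \<le> s z + r x (x - z)"
      "(INF z\<in>frontier (patch \<Sigma> x). s z + r x (x - z)) = s y' + r x (x - y')"
      using update_attained[OF s(1) x] by blast
    have "w x = s y' + r x (x - y')" using w(2) x y'(2) by (simp add: U_def)
    also have "\<dots> \<le> s y + r x (x - y)" using y'(1)[OF y] .
    also have "\<dots> \<le> w y + r x (x - y)"
    proof -
      have "y \<in> closure \<Omega>" using frontier_patch_subset x y by blast
      then show ?thesis using sw_cl by simp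
    qed
    finally show ?thesis .
  qed
  then have w_sub: "dsub w" using w(1) by (simp add: dsub_def)
  moreover have w_bd: "w x = g x" if "x \<in> nodes \<Sigma> \<inter> frontier \<Omega>" for x
    using that w(2) not_both by (simp add: U_def)
  ultimately have "w \<in> S" by (simp add: S_def)
  then have "w x \<le> s x" if "x \<in> nodes \<Sigma>" for x
    using S_le nodes_subset that by blast
  then have ws: "w = s" using sw by (intro fe_space_eqI[OF w(1) s(1)]) (simp add: order_antisym)
  have "\<exists>y\<in>frontier (patch \<Sigma> x). w y + r x (x - y) \<le> w x" if x: "x \<in> nodes \<Sigma> \<inter> \<Omega>" for x
  proof -
    obtain y where y: "y \<in> frontier (patch \<Sigma> x)"
      "(INF z\<in>frontier (patch \<Sigma> x). s z + r x (x - z)) = s y + r x (x - y)"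
      using update_attained[OF s(1) x] by blast
    have "w x = s y + r x (x - y)" using w(2) x y(2) by (simp add: U_def)
    then show ?thesis using y(1) ws by auto
  qed
  then have "dsup w" using w(1) by (simp add: dsup_def)
  then show ?thesis using w_sub w_bd by blast
qed

text \<open>Moving from a node along \<open>- a\<close> up to the boundary of the patch lowers the
  barrier by \<open>R\<close> times the distance, which pays for the cost of the move.\<close>

lemma affine_barrier_dsup:
  assumes "norm a = 1"
  shows "dsup (restrict (\<lambda>x. R * (a \<bullet> x) + C) (closure \<Omega>))" (is "dsup ?V")
  unfolding dsup_def
proof
  show "?V \<in> fe_space \<Omega> \<Sigma>"
  proof -
    have "\<exists>b c. \<forall>x\<in>\<sigma>. ?V x = b \<bullet> x + c" if "\<sigma> \<in> \<Sigma>" for \<sigma>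
      using simplex_subset[OF that] by (intro exI[of _ "R *\<^sub>R a"] exI[of _ C]) auto
    moreover have "continuous_on (closure \<Omega>) ?V"
      by (rule continuous_on_eq[of _ "\<lambda>x. R * (a \<bullet> x) + C"]) (auto intro!: continuous_intros)
    ultimately show ?thesis by (simp add: fe_space_def)
  qed
  show "\<forall>x\<in>nodes \<Sigma> \<inter> \<Omega>. \<exists>y\<in>frontier (patch \<Sigma> x). ?V y + r x (x - y) \<le> ?V x"
  proof
    fix x assume x: "x \<in> nodes \<Sigma> \<inter> \<Omega>"
    have "x \<in> interior (patch \<Sigma> x)" using node_in_patch[OF x] open_patch by (simp add: interior_open)
    moreover have "- a \<noteq> 0" using assms by auto
    ultimately obtain d where d: "0 < d" "x + d *\<^sub>R (- a) \<in> frontier (patch \<Sigma> x)"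
      using ray_to_frontier[OF bounded_patch] by blast
    define y where "y = x + d *\<^sub>R (- a)"
    have "r x (x - y) \<le> R * d" using r_le[of x "x - y"] x d(1) assms by (simp add: y_def)
    moreover have "a \<bullet> y = a \<bullet> x - d"
      using assms by (simp add: y_def inner_add_right inner_diff_right norm_eq_1)
    moreover have "x \<in> closure \<Omega>" "y \<in> closure \<Omega>"
      using x d(2) nodes_subset frontier_patch_subset unfolding y_def by blast+
    moreover have "R * (a \<bullet> y) = R * (a \<bullet> x) - R * d"
      using calculation(2) by (simp add: right_diff_distrib)
    ultimately have "?V y + r x (x - y) \<le> ?V x" by simp
    then show "\<exists>y\<in>frontier (patch \<Sigma> x). ?V y + r x (x - y) \<le> ?V x" using d(2) y_def by blast
  qed
qed

lemma const_dsub: "dsub (restrict (\<lambda>x. c) (closure \<Omega>))"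
proof -
  have "\<exists>b d. \<forall>x\<in>\<sigma>. restrict (\<lambda>x. c) (closure \<Omega>) x = b \<bullet> x + d" if "\<sigma> \<in> \<Sigma>" for \<sigma>
    using simplex_subset[OF that] by (intro exI[of _ 0] exI[of _ c]) auto
  moreover have "continuous_on (closure \<Omega>) (restrict (\<lambda>x. c) (closure \<Omega>))"
    by (rule continuous_on_eq[of _ "\<lambda>x. c"]) auto
  moreover have "restrict (\<lambda>x. c) (closure \<Omega>) x \<le> restrict (\<lambda>x. c) (closure \<Omega>) y + r x (x - y)"
    if "x \<in> nodes \<Sigma> \<inter> \<Omega>" "y \<in> frontier (patch \<Sigma> x)" for x y
  proof -
    have "x \<in> closure \<Omega>" "y \<in> closure \<Omega>"
      using that nodes_subset frontier_patch_subset by blast+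
    then show ?thesis using r_frontier_pos[OF that] by simp
  qed
  ultimately show ?thesis by (simp add: dsub_def fe_space_def)
qed

lemma discrete_solution_exists:
  "\<exists>w. dsub w \<and> dsup w \<and> (\<forall>x\<in>nodes \<Sigma> \<inter> frontier \<Omega>. w x = g x)"
proof -
  obtain a :: 'a where a: "a \<in> Basis" using nonempty_Basis by blast
  \<comment> \<open>Large enough that \<open>- B\<close> lies below \<open>g\<close> and the barrier
    with constant \<open>B\<close> above \<open>g\<close> at all nodes.\<close>
  define B where "B = (\<Sum>x\<in>nodes \<Sigma>. \<bar>g x\<bar> + R * norm x)"
  have B: "\<bar>g x\<bar> + R * norm x \<le> B" if "x \<in> nodes \<Sigma>" for x
    unfolding B_def using that finite_nodes R_pos by (intro member_le_sum) auto
  show ?thesis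
  proof (rule perron_solution_exists[OF const_dsub _ affine_barrier_dsup])
    show "norm a = 1" using a by simp
    fix x assume x: "x \<in> nodes \<Sigma> \<inter> frontier \<Omega>"
    then have xc: "x \<in> closure \<Omega>" using nodes_subset by blast
    have 1: "\<bar>g x\<bar> + R * norm x \<le> B" using B x by blast
    have 2: "0 \<le> R * norm x" using R_pos by simp
    show "restrict (\<lambda>x. - B) (closure \<Omega>) x \<le> g x" using xc 1 2 by simp
    have "\<bar>a \<bullet> x\<bar> \<le> norm x" using Cauchy_Schwarz_ineq2[of a x] a by simp
    then have "R * (- norm x) \<le> R * (a \<bullet> x)" using R_pos by (intro mult_left_mono) auto
    then show "g x \<le> restrict (\<lambda>x. R * (a \<bullet> x) + B) (closure \<Omega>) x" using xc 1 by simp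
  qed
qed

lemma discrete_solution_unique:
  assumes "dsub u" "dsup u" "dsub w" "dsup w" "\<And>x. x \<in> nodes \<Sigma> \<inter> frontier \<Omega> \<Longrightarrow> u x = w x"
  shows "u = w"
proof (rule fe_space_eqI)
  show "u \<in> fe_space \<Omega> \<Sigma>" "w \<in> fe_space \<Omega> \<Sigma>" using assms by (auto simp: dsub_def)
  show "u x = w x" if "x \<in> nodes \<Sigma>" for x
    using discrete_comparison_nodes[OF assms(1,4) _ that] discrete_comparison_nodes[OF assms(3,2) _ that] assms(5)
    by (simp add: order_antisym)
qed

end

section \<open>A priori bounds from shape regularity\<close>

locale shape_regular_discretization = discrete_hamilton_jacobi \<Omega> \<Sigma> r R
  for \<Omega> :: "'a::euclidean_space set" and \<Sigma> r R +
  fixes \<theta> \<rho>\<^sub>s :: real and g :: "'a \<Rightarrow> real"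
  assumes theta: "\<theta> \<ge> 1" and regular: "shape_regular \<theta> \<Sigma>"
    and rho: "\<rho>\<^sub>s \<ge> 0" and r_ge: "x \<in> \<Omega> \<Longrightarrow> \<rho>\<^sub>s * norm q \<le> r x q"
    and g: "x \<in> frontier \<Omega> \<Longrightarrow> y \<in> frontier \<Omega> \<Longrightarrow> g x - g y \<le> \<rho>\<^sub>s / \<theta> * norm (x - y)"
begin

lemma min_height_pos: "\<sigma> \<in> \<Sigma> \<Longrightarrow> 0 < min_height \<sigma>"
  and diameter_le: "\<sigma> \<in> \<Sigma> \<Longrightarrow> diameter \<sigma> \<le> \<theta> * min_height \<sigma>"
proof -
  assume s: "\<sigma> \<in> \<Sigma>"
  have 1: "1 \<le> diameter \<sigma> / min_height \<sigma>" "diameter \<sigma> / min_height \<sigma> \<le> \<theta>"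
    using regular s by (auto simp: shape_regular_def)
  have "diameter \<sigma> \<ge> 0"
    using diameter_ge_0 compact_imp_bounded[OF compact_simplex_mesh[OF s]] by blast
  \<comment> \<open>A quotient of at least 1 with nonnegative numerator has a positive denominator;
    division by 0 yields 0.\<close>
  then show p: "0 < min_height \<sigma>"
    using 1(1) by (smt (verit, best) divide_nonneg_nonpos)
  show "diameter \<sigma> \<le> \<theta> * min_height \<sigma>" using 1(2) p by (simp add: pos_divide_le_eq)
qed

lemma dist_le_diameter: "\<sigma> \<in> \<Sigma> \<Longrightarrow> x \<in> \<sigma> \<Longrightarrow> y \<in> \<sigma> \<Longrightarrow> norm (x - y) \<le> diameter \<sigma>"
  using diameter_bounded_bound[OF compact_imp_bounded[OF compact_simplex_mesh]] by (simp add: dist_norm)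

lemma min_height_le_dist:
  assumes "\<sigma> \<in> \<Sigma>" "x \<in> vertices \<sigma>" "bary \<sigma> x y = 0"
  shows "min_height \<sigma> \<le> norm (x - y)"
  using bary_lipschitz[OF full_simplex[OF assms(1)] assms(2) min_height_pos[OF assms(1)], of x y]
    bary_affine_vertex(2)[OF full_simplex[OF assms(1)] assms(2), of x] assms(3) min_height_pos[OF assms(1)]
  by (simp add: field_simps)

text \<open>Here \<open>\<theta>\<close> cancels: from \<open>x\<close> to any point of the simplex
  the interpolant drops by at most \<open>\<rho>\<^sub>s / \<theta>\<close> times the diameter,
  hence by at most \<open>\<rho>\<^sub>s\<close> times the minimal height, and the opposite facet is
  at least that far away.\<close>

lemma cone_interpolant_dsub:
  assumes s: "s \<in> fe_space \<Omega> \<Sigma>" "\<And>x. x \<in> nodes \<Sigma> \<Longrightarrow> s x = G - \<rho>\<^sub>s / \<theta> * norm (x - z)"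
  shows "dsub s"
  unfolding dsub_def
proof (intro conjI ballI s(1))
  fix x y assume x: "x \<in> nodes \<Sigma> \<inter> \<Omega>" and y: "y \<in> frontier (patch \<Sigma> x)"
  obtain \<sigma> where \<sigma>: "\<sigma> \<in> \<Sigma>" "x \<in> vertices \<sigma>" "y \<in> \<sigma>" "bary \<sigma> x y = 0"
    using frontier_patchE x y by blast
  note f = full_simplex[OF \<sigma>(1)]
  have c: "\<rho>\<^sub>s / \<theta> \<ge> 0" using theta rho by simp
  have edge: "s x - \<rho>\<^sub>s / \<theta> * diameter \<sigma> \<le> s w" if w: "w \<in> vertices \<sigma>" for w
  proof -
    have "norm (w - z) \<le> norm (x - z) + norm (x - w)"
      using norm_triangle_ineq4[of "x - z" "x - w"] by simp
    also have "norm (x - w) \<le> diameter \<sigma>" using dist_le_diameter \<sigma> w vertices_subset by blast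
    finally have "\<rho>\<^sub>s / \<theta> * norm (w - z) \<le> \<rho>\<^sub>s / \<theta> * (norm (x - z) + diameter \<sigma>)"
      using c by (intro mult_left_mono) auto
    then show ?thesis using s(2) x vertex_nodes[OF \<sigma>(1) w] by (simp add: distrib_left)
  qed
  have "s x - \<rho>\<^sub>s / \<theta> * diameter \<sigma> = (\<Sum>w\<in>vertices \<sigma>. bary \<sigma> w y * (s x - \<rho>\<^sub>s / \<theta> * diameter \<sigma>))"
    using bary_coords(1)[OF f, of y] by (simp flip: sum_distrib_right)
  also have "\<dots> \<le> (\<Sum>w\<in>vertices \<sigma>. bary \<sigma> w y * s w)"
    using edge mem_simplex_iff_bary[OF f] \<sigma>(3) by (intro sum_mono mult_left_mono) auto
  also have "\<dots> = s y" using fe_space_bary[OF s(1) \<sigma>(1,3)] by simp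
  finally have 1: "s x - \<rho>\<^sub>s / \<theta> * diameter \<sigma> \<le> s y" .
  have "\<rho>\<^sub>s / \<theta> * diameter \<sigma> \<le> \<rho>\<^sub>s / \<theta> * (\<theta> * min_height \<sigma>)"
    using c diameter_le[OF \<sigma>(1)] by (intro mult_left_mono)
  also have "\<dots> = \<rho>\<^sub>s * min_height \<sigma>" using theta by simp
  also have "\<dots> \<le> \<rho>\<^sub>s * norm (x - y)"
    using rho min_height_le_dist[OF \<sigma>(1,2,4)] by (intro mult_left_mono)
  also have "\<dots> \<le> r x (x - y)" using r_ge x by blast
  finally show "s x \<le> s y + r x (x - y)" using 1 by linarith
qed

context
  fixes u
  assumes sub: "dsub u" and sup: "dsup u" and bd: "\<And>x. x \<in> nodes \<Sigma> \<inter> frontier \<Omega> \<Longrightarrow> u x = g x"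
begin

text \<open>The condition on \<open>g\<close> says exactly that the cone with apex at a boundary
  point stays below \<open>g\<close> on the boundary.\<close>

lemma solution_ge_cone:
  assumes z: "z \<in> frontier \<Omega>" and x: "x \<in> nodes \<Sigma>"
  shows "g z - \<rho>\<^sub>s / \<theta> * norm (x - z) \<le> u x"
proof -
  obtain s where s: "s \<in> fe_space \<Omega> \<Sigma>" "\<And>x. x \<in> nodes \<Sigma> \<Longrightarrow> s x = g z - \<rho>\<^sub>s / \<theta> * norm (x - z)"
    using interpolant_exists[of "\<lambda>x. g z - \<rho>\<^sub>s / \<theta> * norm (x - z)"] by blast
  have "s x \<le> u x"
  proof (rule discrete_comparison_nodes[OF cone_interpolant_dsub[OF s] sup _ x])
    fix b assume b: "b \<in> nodes \<Sigma> \<inter> frontier \<Omega>"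
    then show "s b \<le> u b" using g[OF z, of b] s(2) bd by (simp add: norm_minus_commute)
  qed
  then show ?thesis using s(2)[OF x] by simp
qed

text \<open>If \<open>v\<close> is in \<Omega>, then \<open>w\<close> is a competitor in its update,
  which gives the slope \<open>R\<close>. If \<open>v\<close> is on the boundary, the cone with apex
  \<open>v\<close> gives the slope \<open>\<rho>\<^sub>s / \<theta>\<close>. The sum
  \<open>R + \<rho>\<^sub>s\<close> covers both.\<close>

lemma solution_edge:
  assumes s: "\<sigma> \<in> \<Sigma>" "v \<in> vertices \<sigma>" "w \<in> vertices \<sigma>"
  shows "u v - u w \<le> (R + \<rho>\<^sub>s) * norm (v - w)"
proof (cases "v = w")
  case False
  have nv: "v \<in> nodes \<Sigma>" "w \<in> nodes \<Sigma>" using s vertex_nodes by blast+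
  have c: "\<rho>\<^sub>s / \<theta> * norm (v - w) \<le> (R + \<rho>\<^sub>s) * norm (v - w)"
    using theta rho R_pos mult_left_mono[of 1 \<theta> \<rho>\<^sub>s]
    by (intro mult_right_mono) (auto simp: pos_divide_le_eq distrib_right intro: add_increasing)
  from nv(1) show ?thesis
  proof (cases rule: node_cases)
    case 1
    have "w \<in> frontier (patch \<Sigma> v)" using neighbour_in_frontier_patch s False 1 by blast
    then have "u v \<le> u w + r v (v - w)" using sub 1 by (simp add: dsub_def)
    also have "r v (v - w) \<le> R * norm (v - w)" using r_le 1 by blast
    finally show ?thesis using mult_right_mono[of R "R + \<rho>\<^sub>s" "norm (v - w)"] rho by simp
  next
    case 2
    then have "g v - \<rho>\<^sub>s / \<theta> * norm (w - v) \<le> u w" using solution_ge_cone[of v w] nv by blast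
    then show ?thesis using c bd[OF 2] by (simp add: norm_minus_commute)
  qed
qed simp

lemma solution_le_affine:
  assumes "norm a = 1" "\<And>x. x \<in> frontier \<Omega> \<Longrightarrow> g x \<le> R * (a \<bullet> x) + C" "x \<in> closure \<Omega>"
  shows "u x \<le> R * (a \<bullet> x) + C"
proof -
  have "u x \<le> restrict (\<lambda>x. R * (a \<bullet> x) + C) (closure \<Omega>) x"
  proof (rule discrete_comparison[OF sub affine_barrier_dsup[OF assms(1)] _ assms(3)])
    fix b assume b: "b \<in> nodes \<Sigma> \<inter> frontier \<Omega>"
    then have "b \<in> closure \<Omega>" using nodes_subset by blast
    then show "u b \<le> restrict (\<lambda>x. R * (a \<bullet> x) + C) (closure \<Omega>) b" using assms(2) bd b by simp
  qed
  then show ?thesis using assms(3) by simp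
qed

lemma solution_ge_const:
  assumes "\<And>x. x \<in> frontier \<Omega> \<Longrightarrow> c \<le> g x" "x \<in> closure \<Omega>"
  shows "c \<le> u x"
proof -
  have "restrict (\<lambda>x. c) (closure \<Omega>) x \<le> u x"
    by (rule discrete_comparison[OF const_dsub sup _ assms(2)]) (use nodes_subset assms(1) bd in auto)
  then show ?thesis using assms(2) by simp
qed

context
  fixes slope :: real
  assumes slope_def: "slope = real (DIM('a) + 1) * (\<theta> * (R + \<rho>\<^sub>s))"
begin

lemma slope_nonneg: "slope \<ge> 0"
  using theta R_pos rho by (simp add: slope_def)

text \<open>Each of the \<open>DIM('a) + 1\<close> coordinates changes by at most
  \<open>norm (p - q)\<close> over the minimal height, while nodal differences are at most
  \<open>R + \<rho>\<^sub>s\<close> times a diameter. Shape regularity cancels the mesh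
  size.\<close>

lemma solution_lipschitz_simplex:
  assumes s: "\<sigma> \<in> \<Sigma>" and p: "p \<in> \<sigma>" and q: "q \<in> \<sigma>"
  shows "\<bar>u p - u q\<bar> \<le> slope * norm (p - q)"
proof -
  note f = full_simplex[OF s]
  let ?V = "vertices \<sigma>"
  have ufe: "u \<in> fe_space \<Omega> \<Sigma>" using sub by (simp add: dsub_def)
  have card: "card ?V = DIM('a) + 1" using simplex_vertices(3)[OF f] by linarith
  then obtain v0 where v0: "v0 \<in> ?V" by (metis card.empty all_not_in_conv add_is_0 one_neq_zero)
  have "u p - u q = (\<Sum>w\<in>?V. (bary \<sigma> w p - bary \<sigma> w q) * u w)"
    using fe_space_bary[OF ufe s p] fe_space_bary[OF ufe s q] by (simp add: sum_subtractf left_diff_distrib)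
  \<comment> \<open>The coordinate differences sum to 0, so a reference value may be
    subtracted.\<close>
  also have "\<dots> = (\<Sum>w\<in>?V. (bary \<sigma> w p - bary \<sigma> w q) * (u w - u v0))"
    using bary_coords(1)[OF f] by (simp add: right_diff_distrib sum_subtractf flip: sum_distrib_right)
  finally have "\<bar>u p - u q\<bar> \<le> (\<Sum>w\<in>?V. \<bar>(bary \<sigma> w p - bary \<sigma> w q) * (u w - u v0)\<bar>)"
    by (simp add: sum_abs)
  also have "\<dots> \<le> (\<Sum>w\<in>?V. \<theta> * (R + \<rho>\<^sub>s) * norm (p - q))"
  proof (rule sum_mono)
    fix w assume w: "w \<in> ?V"
    have wv: "norm (w - v0) \<le> diameter \<sigma>" using dist_le_diameter[OF s] w v0 vertices_subset by blast
    have "\<bar>u w - u v0\<bar> \<le> (R + \<rho>\<^sub>s) * norm (w - v0)"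
      using solution_edge[OF s w v0] solution_edge[OF s v0 w] by (simp add: norm_minus_commute abs_le_iff)
    also have "\<dots> \<le> (R + \<rho>\<^sub>s) * (\<theta> * min_height \<sigma>)"
      using wv diameter_le[OF s] R_pos rho by (intro mult_left_mono) auto
    finally have e: "\<bar>u w - u v0\<bar> \<le> (R + \<rho>\<^sub>s) * (\<theta> * min_height \<sigma>)" .
    have "\<bar>(bary \<sigma> w p - bary \<sigma> w q) * (u w - u v0)\<bar> \<le>
        (norm (p - q) / min_height \<sigma>) * ((R + \<rho>\<^sub>s) * (\<theta> * min_height \<sigma>))"
      unfolding abs_mult using bary_lipschitz[OF f w min_height_pos[OF s]] e min_height_pos[OF s]
      by (intro mult_mono) auto
    also have "\<dots> = \<theta> * (R + \<rho>\<^sub>s) * norm (p - q)" using min_height_pos[OF s] by simp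
    finally show "\<bar>(bary \<sigma> w p - bary \<sigma> w q) * (u w - u v0)\<bar> \<le> \<theta> * (R + \<rho>\<^sub>s) * norm (p - q)" .
  qed
  also have "\<dots> = slope * norm (p - q)" by (simp add: slope_def card)
  finally show ?thesis .
qed

text \<open>Finitely many closed preimages of simplices cover the parameter interval of the segment,
  and a common Lipschitz constant on closed pieces of an interval glues.\<close>

lemma solution_segment_lipschitz: "segment_lipschitz slope (closure \<Omega>) u"
  unfolding segment_lipschitz_def
proof (intro conjI allI impI slope_nonneg)
  show "continuous_on (closure \<Omega>) u" using sub by (simp add: dsub_def fe_space_def)
  fix x y assume xy: "closed_segment x y \<subseteq> closure \<Omega>"
  define \<gamma> where "\<gamma> t = (1 - t) *\<^sub>R x + t *\<^sub>R y" for t :: real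
  have "(slope * norm (x - y))-lipschitz_on {0..1} (u \<circ> \<gamma>)"
  proof (rule lipschitz_on_closed_Union[where I = \<Sigma> and U = "\<lambda>\<sigma>. \<gamma> -` \<sigma>"])
    show "finite \<Sigma>" by (rule finite_mesh)
    show "0 \<le> slope * norm (x - y)" using slope_nonneg by simp
    show "closed (\<gamma> -` \<sigma>)" if "\<sigma> \<in> \<Sigma>" for \<sigma>
      unfolding \<gamma>_def using closed_simplex_mesh[OF that] by (intro closed_vimage continuous_intros)
    show "{0..1} \<subseteq> (\<Union>\<sigma>\<in>\<Sigma>. \<gamma> -` \<sigma>)"
    proof
      fix t :: real assume "t \<in> {0..1}"
      then have "\<gamma> t \<in> closed_segment x y" by (auto simp: \<gamma>_def in_segment)
      then show "t \<in> (\<Union>\<sigma>\<in>\<Sigma>. \<gamma> -` \<sigma>)" using xy obtain_simplex[of "\<gamma> t"] by blast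
    qed
    show "(slope * norm (x - y))-lipschitz_on (\<gamma> -` \<sigma>) (u \<circ> \<gamma>)" if "\<sigma> \<in> \<Sigma>" for \<sigma>
    proof (rule lipschitz_onI)
      show "0 \<le> slope * norm (x - y)" using slope_nonneg by simp
      fix s t assume "s \<in> \<gamma> -` \<sigma>" "t \<in> \<gamma> -` \<sigma>"
      then have "\<bar>u (\<gamma> s) - u (\<gamma> t)\<bar> \<le> slope * norm (\<gamma> s - \<gamma> t)"
        using solution_lipschitz_simplex[OF that] by simp
      moreover have "\<gamma> s - \<gamma> t = (t - s) *\<^sub>R (x - y)" by (simp add: \<gamma>_def algebra_simps)
      ultimately show "dist ((u \<circ> \<gamma>) s) ((u \<circ> \<gamma>) t) \<le> slope * norm (x - y) * dist s t"
        by (simp add: dist_norm abs_minus_commute mult_ac)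
    qed
  qed
  from lipschitz_onD[OF this, of 0 1] show "\<bar>u x - u y\<bar> \<le> slope * norm (x - y)"
    by (simp add: \<gamma>_def dist_norm)
qed

text \<open>The boundary condition is imposed only at nodes, but every boundary point has a boundary
  vertex in its simplex, at most a diameter away; both \<open>u\<close> and \<open>g\<close> change
  little between the two.\<close>

lemma solution_near_boundary:
  assumes z: "z \<in> frontier \<Omega>" and h: "\<And>\<sigma>. \<sigma> \<in> \<Sigma> \<Longrightarrow> diameter \<sigma> \<le> h"
  shows "\<bar>u z - g z\<bar> \<le> (slope + \<rho>\<^sub>s) * h"
proof -
  have zc: "z \<in> closure \<Omega>" using z by (simp add: frontier_def)
  then obtain \<sigma> where s: "\<sigma> \<in> \<Sigma>" "z \<in> \<sigma>" using obtain_simplex by blast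
  note f = full_simplex[OF s(1)]
  have "\<exists>v\<in>vertices \<sigma>. bary \<sigma> v z > 0"
  proof (rule ccontr)
    assume "\<not> ?thesis"
    then have "(\<Sum>v\<in>vertices \<sigma>. bary \<sigma> v z) \<le> 0" by (intro sum_nonpos) force
    then show False using bary_coords(1)[OF f] by simp
  qed
  then obtain v where v: "v \<in> vertices \<sigma>" "bary \<sigma> v z > 0" by blast
  have vb: "v \<in> nodes \<Sigma> \<inter> frontier \<Omega>" using boundary_vertex[OF z s v] vertex_nodes[OF s(1) v(1)] by simp
  have vz: "norm (v - z) \<le> h"
    using dist_le_diameter[OF s(1), of v z] h[OF s(1)] v(1) s(2) vertices_subset by fastforce
  have "\<bar>u v - u z\<bar> \<le> slope * norm (v - z)"
    using solution_lipschitz_simplex[OF s(1)] v(1) s(2) vertices_subset by blast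
  also have "\<dots> \<le> slope * h" using vz slope_nonneg by (rule mult_left_mono)
  finally have 1: "\<bar>u v - u z\<bar> \<le> slope * h" .
  have "\<bar>g v - g z\<bar> \<le> \<rho>\<^sub>s / \<theta> * norm (v - z)"
    using g[of v z] g[of z v] vb z by (simp add: norm_minus_commute abs_le_iff)
  also have "\<dots> \<le> \<rho>\<^sub>s * h"
  proof (rule mult_mono)
    show "\<rho>\<^sub>s / \<theta> \<le> \<rho>\<^sub>s" using theta rho mult_left_mono[of 1 \<theta> \<rho>\<^sub>s] by (simp add: pos_divide_le_eq)
  qed (use vz rho in auto)
  finally show ?thesis using 1 bd[OF vb] by (simp add: distrib_right)
qed

end

end

end

section \<open>Convergence\<close>

text \<open>The definite description in \<open>hopf_lax\<close> denotes, because nodal values can be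
  prescribed and determine the finite element function. This allows the fixed point equation to be
  read node by node.\<close>

lemma (in discrete_hamilton_jacobi) fe_solution_iff:
  assumes "r = support_fun H"
  shows "fe_solution \<Omega> H g \<Sigma> u \<longleftrightarrow> dsub u \<and> dsup u \<and> (\<forall>x\<in>nodes \<Sigma> \<inter> frontier \<Omega>. u x = g x)"
proof -
  define Q where "Q w \<longleftrightarrow> w \<in> fe_space \<Omega> \<Sigma> \<and>
     (\<forall>x\<in>nodes \<Sigma> \<inter> \<Omega>. w x = (INF y\<in>frontier (patch \<Sigma> x). u y + support_fun H x (x - y))) \<and>
     (\<forall>x\<in>nodes \<Sigma> \<inter> frontier \<Omega>. w x = u x)" for w
  have hl: "hopf_lax \<Omega> H \<Sigma> u = (THE w. Q w)" by (simp add: hopf_lax_def Q_def)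
  have disj: "x \<notin> \<Omega>" if "x \<in> frontier \<Omega>" for x
    using that open_domain by (simp add: frontier_def interior_open)
  define U where "U x = (if x \<in> \<Omega> then INF y\<in>frontier (patch \<Sigma> x). u y + support_fun H x (x - y) else u x)" for x
  obtain w where "w \<in> fe_space \<Omega> \<Sigma>" "\<And>x. x \<in> nodes \<Sigma> \<Longrightarrow> w x = U x"
    using interpolant_exists[of U] by blast
  then have "Q w" using disj by (auto simp: Q_def U_def)
  moreover have "w1 = w2" if "Q w1" "Q w2" for w1 w2
  proof (rule fe_space_eqI)
    show "w1 \<in> fe_space \<Omega> \<Sigma>" "w2 \<in> fe_space \<Omega> \<Sigma>" using that by (auto simp: Q_def)
    fix x assume "x \<in> nodes \<Sigma>"
    then show "w1 x = w2 x" by (cases rule: node_cases) (use that in \<open>auto simp: Q_def\<close>)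
  qed
  ultimately have ex1: "\<exists>!w. Q w" by blast
  have "u = hopf_lax \<Omega> H \<Sigma> u \<longleftrightarrow> Q u"
    unfolding hl using theI'[OF ex1] the1_equality[OF ex1] by metis
  show ?thesis
  proof (cases "u \<in> fe_space \<Omega> \<Sigma>")
    case True
    then have "Q u \<longleftrightarrow> dsub u \<and> dsup u"
      using fixed_point_iff[OF True] by (simp add: Q_def flip: assms)
    then show ?thesis using True \<open>u = hopf_lax \<Omega> H \<Sigma> u \<longleftrightarrow> Q u\<close> by (simp only: fe_solution_def) blast
  next
    case False
    then show ?thesis by (simp add: fe_solution_def dsub_def)
  qed
qed

text \<open>Interpolating the quadratic costs at most \<open>K * (D * (2 * e + h))\<close> with
  \<open>D\<close> the diameter, and \<open>D\<close> is at most
  \<open>\<theta> * norm (x - y)\<close> since \<open>y\<close> is on the facet opposite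
  \<open>x\<close>. The interpolation identity is assumed instead of membership in
  \<open>fe_space\<close>, so that the lemma also serves for \<open>- uh n\<close>.\<close>

lemma (in shape_regular_discretization) node_quadratic_estimate:
  assumes u: "\<And>\<sigma>. \<sigma> \<in> \<Sigma> \<Longrightarrow> y \<in> \<sigma> \<Longrightarrow> u y = (\<Sum>w\<in>vertices \<sigma>. bary \<sigma> w y * u w)"
    and x: "x \<in> nodes \<Sigma> \<inter> \<Omega>" and y: "y \<in> frontier (patch \<Sigma> x)"
    and max: "\<And>\<sigma> w. \<lbrakk>\<sigma> \<in> \<Sigma>; x \<in> vertices \<sigma>; w \<in> vertices \<sigma>\<rbrakk> \<Longrightarrow>
      u w \<le> u x + p \<bullet> (w - x) + K * ((norm (w - x0))\<^sup>2 - (norm (x - x0))\<^sup>2)"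
    and K: "K \<ge> 0" and h: "\<And>\<sigma>. \<sigma> \<in> \<Sigma> \<Longrightarrow> diameter \<sigma> \<le> h" and e: "norm (x - x0) \<le> e"
  shows "u y \<le> u x + p \<bullet> (y - x) + K * \<theta> * norm (x - y) * (2 * e + h)"
proof -
  obtain \<sigma> where s: "\<sigma> \<in> \<Sigma>" "x \<in> vertices \<sigma>" "y \<in> \<sigma>" "bary \<sigma> x y = 0"
    using frontier_patchE x y by blast
  note f = full_simplex[OF s(1)]
  let ?V = "vertices \<sigma>"
  define D where "D = diameter \<sigma>"
  have D0: "0 \<le> D"
    using diameter_ge_0 compact_imp_bounded[OF compact_simplex_mesh[OF s(1)]] by (simp add: D_def)
  have Dh: "D \<le> h" using h s(1) by (simp add: D_def)
  have "min_height \<sigma> \<le> norm (x - y)" by (rule min_height_le_dist[OF s(1,2,4)])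
  then have "\<theta> * min_height \<sigma> \<le> \<theta> * norm (x - y)" using theta by (intro mult_left_mono) auto
  then have Dt: "D \<le> \<theta> * norm (x - y)" using diameter_le[OF s(1)] by (simp add: D_def)
  have e0: "0 \<le> e" using e norm_ge_zero order_trans by blast
  have vertex: "u w \<le> (u x + K * (D * (2 * e + h))) + p \<bullet> (w - x)" if w: "w \<in> ?V" for w
  proof -
    have wx: "norm (w - x) \<le> D"
      using dist_le_diameter[OF s(1)] w s(2) vertices_subset by (auto simp: D_def)
    have tri: "norm (w - x0) \<le> norm (x - x0) + D"
      using norm_triangle_ineq[of "w - x" "x - x0"] wx by simp
    have "(norm (w - x0))\<^sup>2 \<le> (norm (x - x0) + D)\<^sup>2" by (rule power_mono[OF tri]) simp
    also have "\<dots> = (norm (x - x0))\<^sup>2 + D * (2 * norm (x - x0) + D)"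
      by (simp add: power2_eq_square algebra_simps)
    also have "D * (2 * norm (x - x0) + D) \<le> D * (2 * e + h)"
      using e Dh D0 by (intro mult_left_mono) auto
    finally have "K * ((norm (w - x0))\<^sup>2 - (norm (x - x0))\<^sup>2) \<le> K * (D * (2 * e + h))"
      using K by (intro mult_left_mono) auto
    then show ?thesis using max[OF s(1,2) w] by linarith
  qed
  have "u y \<le> (\<Sum>w\<in>?V. bary \<sigma> w y * ((u x + K * (D * (2 * e + h))) + p \<bullet> (w - x)))"
    unfolding u[OF s(1,3)] using vertex mem_simplex_iff_bary[OF f] s(3)
    by (intro sum_mono mult_left_mono) auto
  also have "\<dots> = (\<Sum>w\<in>?V. bary \<sigma> w y) * (u x + K * (D * (2 * e + h)) - p \<bullet> x) + p \<bullet> (\<Sum>w\<in>?V. bary \<sigma> w y *\<^sub>R w)"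
    by (simp add: inner_sum_right inner_diff_right sum_distrib_right distrib_left right_diff_distrib
        sum.distrib sum_subtractf)
  also have "\<dots> = u x + p \<bullet> (y - x) + K * (D * (2 * e + h))"
    using bary_coords[OF f, of y] by (simp add: inner_diff_right)
  also have "D * (2 * e + h) \<le> \<theta> * norm (x - y) * (2 * e + h)"
    using Dt e0 Dh D0 by (intro mult_right_mono) auto
  finally show ?thesis using K by (simp add: mult_left_mono mult.assoc)
qed

text \<open>Stability of strict maxima: the quadratic gap of \<open>f\<close> at \<open>x0\<close>
  outweighs the uniform error, so maximizers over increasingly dense finite sets approach
  \<open>x0\<close>.\<close>

lemma approximate_maximizers:
  fixes F :: "nat \<Rightarrow> 'a::euclidean_space \<Rightarrow> real"
  assumes lim: "uniform_limit S F f sequentially" and cont: "continuous_on S f"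
    and x0: "cball x0 d \<subseteq> S" "d > 0"
    and strict: "\<And>x. x \<in> cball x0 d \<Longrightarrow> f x \<le> f x0 - (norm (x - x0))\<^sup>2"
    and fin: "\<And>n. finite (N n)"
    and dense: "\<And>e. e > 0 \<Longrightarrow> \<forall>\<^sub>F n in sequentially. \<exists>x\<in>N n. dist x x0 < e" and e: "e > 0"
  shows "\<forall>\<^sub>F n in sequentially. \<exists>x\<in>N n. dist x x0 < e \<and> (\<forall>z\<in>N n \<inter> cball x0 d. F n z \<le> F n x)"
proof -
  define e' where "e' = min e d"
  \<comment> \<open>Three errors of size \<open>\<eta>\<close> occur: the approximation at
    \<open>x\<close>, the approximation at \<open>z0\<close>, and the oscillation of
    \<open>f\<close> near \<open>x0\<close>. Their sum must stay below
    \<open>e'\<^sup>2\<close>.\<close>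
  define \<eta> where "\<eta> = e'\<^sup>2 / 4"
  have e': "e' > 0" "e' \<le> e" "e' \<le> d" and eta: "\<eta> > 0" using e x0 by (auto simp: e'_def \<eta>_def)
  have "x0 \<in> S" using x0 by auto
  then obtain \<delta> where \<delta>: "\<delta> > 0" "\<And>x. x \<in> S \<Longrightarrow> dist x x0 < \<delta> \<Longrightarrow> dist (f x) (f x0) < \<eta>"
    using cont eta unfolding continuous_on_iff by meson
  have "\<forall>\<^sub>F n in sequentially. \<forall>x\<in>S. dist (F n x) (f x) < \<eta>" using lim eta by (rule uniform_limitD)
  moreover have "\<forall>\<^sub>F n in sequentially. \<exists>x\<in>N n. dist x x0 < min \<delta> d" using \<delta>(1) x0(2) by (intro dense) simp
  ultimately show ?thesis
  proof eventually_elim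
    case (elim n)
    obtain z0 where z0: "z0 \<in> N n" "dist z0 x0 < \<delta>" "dist z0 x0 < d" using elim(2) by auto
    have z0S: "z0 \<in> cball x0 d" "z0 \<in> S" using z0(3) x0 by (auto simp: dist_commute)
    have "finite (F n ` (N n \<inter> cball x0 d))" "F n ` (N n \<inter> cball x0 d) \<noteq> {}"
      using fin z0(1) z0S by auto
    then obtain x where x: "x \<in> N n \<inter> cball x0 d" "\<And>z. z \<in> N n \<inter> cball x0 d \<Longrightarrow> F n z \<le> F n x"
    proof -
      assume *: "finite (F n ` (N n \<inter> cball x0 d))" "F n ` (N n \<inter> cball x0 d) \<noteq> {}"
      obtain x where "x \<in> N n \<inter> cball x0 d" "F n x = Max (F n ` (N n \<inter> cball x0 d))"
        using Max_in[OF *] by (metis (no_types, lifting) imageE)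
      then show ?thesis using that[of x] Max_ge[OF *(1)] by simp
    qed
    have "x \<in> S" using x(1) x0 by blast
    have "\<bar>F n z0 - f z0\<bar> < \<eta>" "\<bar>F n x - f x\<bar> < \<eta>" "\<bar>f z0 - f x0\<bar> < \<eta>"
      using elim(1) \<delta>(2)[OF z0S(2) z0(2)] z0S(2) \<open>x \<in> S\<close> by (auto simp: dist_real_def)
    moreover have "F n z0 \<le> F n x" using x(2) z0(1) z0S(1) by blast
    moreover have "f x \<le> f x0 - (norm (x - x0))\<^sup>2" using strict x(1) by blast
    ultimately have "(norm (x - x0))\<^sup>2 < 3 * \<eta>" by linarith
    also have "3 * \<eta> \<le> e'\<^sup>2" by (simp add: \<eta>_def)
    finally have "norm (x - x0) < e'" using e'(1) by (simp add: power2_less_imp_less)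
    then show ?case using x e'(2) by (intro bexI[of _ x]) (auto simp: dist_norm)
  qed
qed

section \<open>The support function and its behaviour near an interior point\<close>

locale hamilton_jacobi =
  fixes \<Omega> :: "'a::euclidean_space set" and H :: "'a \<Rightarrow> 'a \<Rightarrow> real" and R :: real
  assumes open_domain: "open \<Omega>" and bounded_domain: "bounded \<Omega>" and domain_ne: "\<Omega> \<noteq> {}"
    and lipschitz_domain: "lipschitz_boundary \<Omega>"
    and H_continuous: "continuous_on (closure \<Omega> \<times> UNIV) (\<lambda>(x, p). H x p)"
    and H_convex: "\<And>x. x \<in> \<Omega> \<Longrightarrow> convex_on UNIV (H x)"
    and H_neg: "\<And>x. x \<in> \<Omega> \<Longrightarrow> H x 0 < 0"
    and H_coercive: "\<And>x p. x \<in> \<Omega> \<Longrightarrow> H x p \<le> 0 \<Longrightarrow> norm p \<le> R"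
begin

lemma support_fun_ge:
  assumes "x \<in> \<Omega>" "H x p \<le> 0"
  shows "p \<bullet> q \<le> support_fun H x q"
  unfolding support_fun_def
proof (rule cSUP_upper)
  show "bdd_above ((\<lambda>p. p \<bullet> q) ` {p. H x p \<le> 0})"
  proof (rule bdd_aboveI2)
    fix p' assume "p' \<in> {p. H x p \<le> 0}"
    then have "norm p' * norm q \<le> R * norm q" using H_coercive[OF assms(1)] by (intro mult_right_mono) auto
    then show "p' \<bullet> q \<le> R * norm q" using norm_cauchy_schwarz[of p' q] by linarith
  qed
qed (use assms in auto)

lemma support_fun_le:
  assumes "x \<in> \<Omega>" "\<And>p. H x p \<le> 0 \<Longrightarrow> p \<bullet> q \<le> b"
  shows "support_fun H x q \<le> b"
  unfolding support_fun_def using assms H_neg[OF assms(1)] by (intro cSUP_least) (auto intro: less_imp_le)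

lemma H_open:
  "open {(x, p). x \<in> \<Omega> \<and> H x p < 0}" "open {(x, p). x \<in> \<Omega> \<and> H x p > 0}"
proof -
  have c: "continuous_on (\<Omega> \<times> UNIV) (\<lambda>(x, p). H x p)"
    by (rule continuous_on_subset[OF H_continuous]) (use closure_subset in auto)
  have o: "open (\<Omega> \<times> (UNIV :: 'a set))" using open_domain by (simp add: open_Times)
  have "{(x, p). x \<in> \<Omega> \<and> H x p < 0} = (\<lambda>(x, p). H x p) -` {..<0} \<inter> \<Omega> \<times> UNIV"
    "{(x, p). x \<in> \<Omega> \<and> H x p > 0} = (\<lambda>(x, p). H x p) -` {0<..} \<inter> \<Omega> \<times> UNIV" by auto
  then show "open {(x, p). x \<in> \<Omega> \<and> H x p < 0}" "open {(x, p). x \<in> \<Omega> \<and> H x p > 0}"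
    using c unfolding continuous_on_open_vimage[OF o] by auto
qed

lemma H_neg_near:
  assumes "x0 \<in> \<Omega>" "H x0 p < 0"
  obtains d \<epsilon> where "d > 0" "\<epsilon> > 0"
    "\<And>x p'. \<lbrakk>x \<in> \<Omega>; dist x x0 < d; norm (p' - p) \<le> \<epsilon>\<rbrakk> \<Longrightarrow> H x p' \<le> 0"
proof -
  obtain A B where AB: "open A" "open B" "(x0, p) \<in> A \<times> B" "A \<times> B \<subseteq> {(x, p). x \<in> \<Omega> \<and> H x p < 0}"
    using open_prod_elim[OF H_open(1), of "(x0, p)"] assms by blast
  obtain d where d: "d > 0" "ball x0 d \<subseteq> A" using AB open_contains_ball by blast
  obtain \<epsilon> where \<epsilon>: "\<epsilon> > 0" "cball p \<epsilon> \<subseteq> B" using AB open_contains_cball by blast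
  have "H x p' \<le> 0" if "dist x x0 < d" "norm (p' - p) \<le> \<epsilon>" for x p'
  proof -
    have "x \<in> A" using d(2) that(1) by (auto simp: dist_commute)
    moreover have "p' \<in> B" using \<epsilon>(2) that(2) by (auto simp: dist_norm norm_minus_commute)
    ultimately show ?thesis using AB(4) by force
  qed
  then show ?thesis using that d(1) \<epsilon>(1) by blast
qed

text \<open>A whole ball around \<open>p\<close> lies in the sublevel sets at all nearby
  \<open>x\<close>; testing with the point of the ball that is farthest in the direction
  \<open>q\<close> gains \<open>\<epsilon> * norm q\<close>.\<close>

lemma support_fun_ge_near:
  assumes "x0 \<in> \<Omega>" "H x0 p < 0"
  obtains d \<epsilon> where "d > 0" "\<epsilon> > 0"
    "\<And>x q. \<lbrakk>x \<in> \<Omega>; dist x x0 < d\<rbrakk> \<Longrightarrow> p \<bullet> q + \<epsilon> * norm q \<le> support_fun H x q"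
proof -
  obtain d \<epsilon> where d: "d > 0" "\<epsilon> > 0"
    "\<And>x p'. \<lbrakk>x \<in> \<Omega>; dist x x0 < d; norm (p' - p) \<le> \<epsilon>\<rbrakk> \<Longrightarrow> H x p' \<le> 0"
    using H_neg_near[OF assms] by blast
  have "p \<bullet> q + \<epsilon> * norm q \<le> support_fun H x q" if "x \<in> \<Omega>" "dist x x0 < d" for x q
  proof -
    have "norm (\<epsilon> *\<^sub>R sgn q) \<le> \<epsilon>" using d(2) by (simp add: norm_sgn)
    then have "(p + \<epsilon> *\<^sub>R sgn q) \<bullet> q \<le> support_fun H x q"
      using d(3)[OF that, of "p + \<epsilon> *\<^sub>R sgn q"] support_fun_ge that(1) by simp
    moreover have "sgn q \<bullet> q = norm q"
      by (cases "q = 0") (simp_all add: sgn_div_norm dot_square_norm power2_eq_square)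
    ultimately show ?thesis by (simp add: inner_add_left)
  qed
  then show ?thesis using that d(1,2) by blast
qed

lemma support_fun_pos:
  assumes "x \<in> \<Omega>" "q \<noteq> 0"
  shows "0 < support_fun H x q"
proof -
  obtain d \<epsilon> where d: "d > 0" "\<epsilon> > 0" "\<And>x' q. \<lbrakk>x' \<in> \<Omega>; dist x' x < d\<rbrakk> \<Longrightarrow> 0 \<bullet> q + \<epsilon> * norm q \<le> support_fun H x' q"
    using support_fun_ge_near[OF assms(1) H_neg[OF assms(1)]] by blast
  have "0 < \<epsilon> * norm q" using assms(2) d(2) by simp
  also have "\<dots> \<le> support_fun H x q" using d(3)[OF assms(1), of q] d(1) by simp
  finally show ?thesis .
qed

lemma support_fun_upper:
  assumes "x \<in> \<Omega>"
  shows "support_fun H x q \<le> R * norm q"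
proof (rule support_fun_le[OF assms])
  fix p assume "H x p \<le> 0"
  then have "norm p * norm q \<le> R * norm q" using H_coercive[OF assms] by (intro mult_right_mono) auto
  then show "p \<bullet> q \<le> R * norm q" using norm_cauchy_schwarz[of p q] by linarith
qed

lemma support_fun_continuous:
  assumes x: "x \<in> \<Omega>"
  shows "continuous_on UNIV (support_fun H x)"
proof -
  have *: "support_fun H x q \<le> support_fun H x q' + R * norm (q - q')" for q q'
  proof (rule support_fun_le[OF x])
    fix p assume p: "H x p \<le> 0"
    have "norm p * norm (q - q') \<le> R * norm (q - q')" using H_coercive[OF x p] by (intro mult_right_mono) auto
    then have "p \<bullet> (q - q') \<le> R * norm (q - q')" using norm_cauchy_schwarz[of p "q - q'"] by linarith
    then show "p \<bullet> q \<le> support_fun H x q' + R * norm (q - q')"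
      using support_fun_ge[OF x p, of q'] by (simp add: inner_diff_right)
  qed
  have "R \<ge> 0" using H_coercive[OF x less_imp_le[OF H_neg[OF x]]] by simp
  have "R-lipschitz_on UNIV (support_fun H x)"
  proof (rule lipschitz_onI[OF _ \<open>R \<ge> 0\<close>])
    fix q q' :: 'a
    show "dist (support_fun H x q) (support_fun H x q') \<le> R * dist q q'"
      using *[of q q'] *[of q' q] by (simp add: dist_norm norm_minus_commute[of q'] abs_le_iff)
  qed
  then show ?thesis by (rule lipschitz_on_continuous_on)
qed

text \<open>A hyperplane separates \<open>p\<close> from the convex sublevel set at
  \<open>x0\<close>. Coercivity makes the relevant part of the far half-space compact, so the
  separation persists for nearby \<open>x\<close>.\<close>

lemma support_fun_separation:
  assumes x0: "x0 \<in> \<Omega>" and pos: "H x0 p > 0"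
  obtains q d \<epsilon> where "norm q = 1" "d > 0" "\<epsilon> > 0"
    "\<And>x t. \<lbrakk>x \<in> \<Omega>; dist x x0 < d; t \<ge> 0\<rbrakk> \<Longrightarrow> support_fun H x (t *\<^sub>R q) \<le> t * (p \<bullet> q - \<epsilon>)"
proof -
  define S where "S = {p. H x0 p \<le> 0}"
  have cont: "continuous_on UNIV (H x0)"
  proof -
    have "continuous_on UNIV (\<lambda>p. (\<lambda>(x, p). H x p) (x0, p))"
      using closure_subset x0 by (intro continuous_on_compose2[OF H_continuous] continuous_intros) auto
    then show ?thesis by simp
  qed
  have "closed S" unfolding S_def using closed_Collect_le[OF cont continuous_on_const] by simp
  moreover have "convex S"
    unfolding convex_alt
  proof (intro ballI allI impI)
    fix v w and t :: real
    assume vw: "v \<in> S" "w \<in> S" and t: "0 \<le> t \<and> t \<le> 1"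
    have "H x0 ((1 - t) *\<^sub>R v + t *\<^sub>R w) \<le> (1 - t) * H x0 v + t * H x0 w"
      using convex_onD[OF H_convex[OF x0], of t v w] t by simp
    moreover have "(1 - t) * H x0 v \<le> 0" "t * H x0 w \<le> 0"
      using vw t by (auto simp: S_def intro: mult_nonneg_nonpos)
    ultimately show "(1 - t) *\<^sub>R v + t *\<^sub>R w \<in> S" by (simp add: S_def)
  qed
  moreover have "p \<notin> S" using pos by (simp add: S_def)
  ultimately obtain a b where ab: "a \<bullet> p < b" "\<And>p'. p' \<in> S \<Longrightarrow> b < a \<bullet> p'"
    using separating_hyperplane_closed_point[of S p] by blast
  have "0 \<in> S" using H_neg[OF x0] by (simp add: S_def)
  then have a0: "a \<noteq> 0" using ab by fastforce
  \<comment> \<open>The separation theorem puts \<open>p\<close> on the lower side of the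
    hyperplane; the sign is reversed so that \<open>p \<bullet> q\<close> exceeds the bound
    \<open>\<beta>\<close> of the sublevel set.\<close>
  define q where "q = - (1 / norm a) *\<^sub>R a"
  define \<beta> where "\<beta> = - b / norm a"
  have nq: "norm q = 1" using a0 by (simp add: q_def)
  have iq: "p' \<bullet> q = - (a \<bullet> p') / norm a" for p' by (simp add: q_def inner_commute)
  have pq: "p \<bullet> q > \<beta>" using ab(1) a0 by (simp add: iq \<beta>_def divide_strict_right_mono)
  have Sq: "p' \<bullet> q < \<beta>" if "p' \<in> S" for p'
    using ab(2)[OF that] a0 by (simp add: iq \<beta>_def divide_strict_right_mono)
  \<comment> \<open>All sublevel sets lie in the ball of radius \<open>R\<close>, so it suffices to
    keep \<open>H\<close> positive on this compact piece. The tube lemma does so for all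
    \<open>x\<close> in a neighbourhood of \<open>x0\<close>.\<close>
  define C where "C = cball 0 R \<inter> {p'. \<beta> \<le> p' \<bullet> q}"
  have "compact C"
    unfolding C_def by (intro compact_Int_closed compact_cball closed_Collect_le continuous_intros)
  moreover have "{x0} \<times> C \<subseteq> {(x, p). x \<in> \<Omega> \<and> H x p > 0}"
  proof -
    have "0 < H x0 p'" if "p' \<in> C" for p'
    proof -
      have "\<not> p' \<bullet> q < \<beta>" using that by (simp add: C_def)
      then have "p' \<notin> S" using Sq by blast
      then show ?thesis by (simp add: S_def)
    qed
    then show ?thesis using x0 by auto
  qed
  ultimately have "\<exists>X. x0 \<in> X \<and> open X \<and> X \<times> C \<subseteq> {(x, p). x \<in> \<Omega> \<and> H x p > 0}"
    by (intro Elementary_Topology.tube_lemma H_open(2))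
  then obtain X where X: "x0 \<in> X" "open X" "X \<times> C \<subseteq> {(x, p). x \<in> \<Omega> \<and> H x p > 0}"
    by (elim exE conjE)
  obtain d where d: "d > 0" "ball x0 d \<subseteq> X" using X open_contains_ball by blast
  have "support_fun H x (t *\<^sub>R q) \<le> t * (p \<bullet> q - (p \<bullet> q - \<beta>))"
    if x: "x \<in> \<Omega>" "dist x x0 < d" "t \<ge> 0" for x t
  proof (rule support_fun_le[OF x(1)])
    fix p' assume p': "H x p' \<le> 0"
    have "x \<in> X" using d(2) x(2) by (auto simp: dist_commute)
    then have "p' \<notin> C" using X(3) p' by force
    then have "p' \<bullet> q \<le> \<beta>" using H_coercive[OF x(1) p'] by (auto simp: C_def)
    then show "p' \<bullet> (t *\<^sub>R q) \<le> t * (p \<bullet> q - (p \<bullet> q - \<beta>))" using x(3) by (simp add: mult_left_mono)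
  qed
  then show ?thesis using that[OF nq d(1), of "p \<bullet> q - \<beta>"] pq by simp
qed

end

section \<open>Passage to the limit along the sequence of meshes\<close>

locale hamilton_jacobi_discretizations = hamilton_jacobi \<Omega> H R
  for \<Omega> :: "'a::euclidean_space set" and H R +
  fixes \<Sigma> :: "nat \<Rightarrow> 'a set set" and \<theta> \<rho>\<^sub>s :: real and g :: "'a \<Rightarrow> real"
  assumes theta: "\<theta> \<ge> 1" and triangulations: "\<And>n. triangulation_of \<Omega> (\<Sigma> n)"
    and regular: "\<And>n. shape_regular \<theta> (\<Sigma> n)"
    and mesh_size_tendsto: "(\<lambda>n. mesh_size (\<Sigma> n)) \<longlonglongrightarrow> 0"
    and rho: "\<rho>\<^sub>s \<ge> 0" and support_ge: "\<And>x q. x \<in> \<Omega> \<Longrightarrow> \<rho>\<^sub>s * norm q \<le> support_fun H x q"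
    and boundary_data: "\<And>x y. x \<in> frontier \<Omega> \<Longrightarrow> y \<in> frontier \<Omega> \<Longrightarrow> g x - g y \<le> \<rho>\<^sub>s / \<theta> * norm (x - y)"
begin

sublocale D: shape_regular_discretization \<Omega> "\<Sigma> n" "support_fun H" R \<theta> \<rho>\<^sub>s g for n
proof
  show "interior (closure \<Omega>) = \<Omega>"
    by (rule interior_closure_lipschitz_domain[OF open_domain lipschitz_domain])
qed (fact open_domain bounded_domain domain_ne triangulations support_fun_pos support_fun_continuous
    support_fun_upper theta regular rho support_ge boundary_data)+

lemma fe_solution_iff: "fe_solution \<Omega> H g (\<Sigma> n) u \<longleftrightarrow>
  D.dsub n u \<and> D.dsup n u \<and> (\<forall>x\<in>nodes (\<Sigma> n) \<inter> frontier \<Omega>. u x = g x)"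
  by (rule D.fe_solution_iff) simp

lemma fe_solution_ex1: "\<exists>!u. fe_solution \<Omega> H g (\<Sigma> n) u"
  using D.discrete_solution_exists[of n g] D.discrete_solution_unique[of n]
  unfolding fe_solution_iff by (metis (no_types, lifting))

lemma diameter_le_mesh_size: "\<sigma> \<in> \<Sigma> n \<Longrightarrow> diameter \<sigma> \<le> mesh_size (\<Sigma> n)"
  using D.finite_mesh unfolding mesh_size_def by (intro Max_ge) auto

lemma nodes_dense:
  assumes "x0 \<in> closure \<Omega>" "e > 0"
  shows "\<forall>\<^sub>F n in sequentially. \<exists>x\<in>nodes (\<Sigma> n). dist x x0 < e"
  using order_tendstoD(2)[OF mesh_size_tendsto assms(2)]
proof eventually_elim
  case (elim n)
  obtain \<sigma> where s: "\<sigma> \<in> \<Sigma> n" "x0 \<in> \<sigma>" using D.obtain_simplex[OF assms(1)] by blast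
  have "card (vertices \<sigma>) \<noteq> 0" using simplex_vertices(3)[OF D.full_simplex[OF s(1)]] by linarith
  then obtain v where v: "v \<in> vertices \<sigma>" by fastforce
  have "norm (v - x0) \<le> diameter \<sigma>"
    using D.dist_le_diameter[OF s(1)] v s(2) vertices_subset by blast
  then show ?case using diameter_le_mesh_size[OF s(1)] elim v D.vertex_nodes[OF s(1)]
    by (intro bexI[of _ v]) (auto simp: dist_norm)
qed

text \<open>Enlarging \<open>K\<close> to \<open>\<bar>K\<bar> + 1\<close> makes the maximum strict
  with a quadratic gap and the coefficient positive, as the two preceding estimates require.\<close>

lemma strict_quadratic_max:
  assumes x0: "x0 \<in> \<Omega>"
    and ev: "\<forall>\<^sub>F x in nhds x0. f x \<le> f x0 + p \<bullet> (x - x0) + K * (norm (x - x0))\<^sup>2"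
  obtains d where "d > 0" "cball x0 d \<subseteq> \<Omega>"
    "\<And>x. x \<in> cball x0 d \<Longrightarrow> f x - (p \<bullet> (x - x0) + (\<bar>K\<bar> + 1) * (norm (x - x0))\<^sup>2) \<le> f x0 - (norm (x - x0))\<^sup>2"
proof -
  have "\<forall>\<^sub>F x in nhds x0. x \<in> \<Omega> \<and> f x \<le> f x0 + p \<bullet> (x - x0) + K * (norm (x - x0))\<^sup>2"
    using eventually_nhds_in_open[OF open_domain x0] ev by (rule eventually_conj)
  then obtain d where d: "d > 0" "\<And>x. dist x x0 < d \<Longrightarrow> x \<in> \<Omega> \<and> f x \<le> f x0 + p \<bullet> (x - x0) + K * (norm (x - x0))\<^sup>2"
    by (auto simp: eventually_nhds_metric)
  have d2: "dist x x0 < d" if "x \<in> cball x0 (d / 2)" for x using that d(1) by (simp add: dist_commute)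
  show ?thesis
  proof (rule that[of "d / 2"])
    show "cball x0 (d / 2) \<subseteq> \<Omega>" using d2 d(2) by blast
    fix x assume x: "x \<in> cball x0 (d / 2)"
    have "K * (norm (x - x0))\<^sup>2 \<le> \<bar>K\<bar> * (norm (x - x0))\<^sup>2" by (intro mult_right_mono) auto
    then show "f x - (p \<bullet> (x - x0) + (\<bar>K\<bar> + 1) * (norm (x - x0))\<^sup>2) \<le> f x0 - (norm (x - x0))\<^sup>2"
      using d(2)[OF d2[OF x]] by (simp add: distrib_right)
  qed (use d(1) in simp)
qed

text \<open>At a node where the discrete function is extremal relative to a quadratic, it lies on one
  side of its linear part up to an error that is small compared with the distance to the boundary
  of the patch.\<close>

lemma near_extremal_node:
  fixes U :: "nat \<Rightarrow> 'a \<Rightarrow> real"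
  assumes lim: "uniform_limit (closure \<Omega>) U f sequentially" and cont: "continuous_on (closure \<Omega>) f"
    and bary: "\<And>n \<sigma> y. \<sigma> \<in> \<Sigma> n \<Longrightarrow> y \<in> \<sigma> \<Longrightarrow> U n y = (\<Sum>w\<in>vertices \<sigma>. bary \<sigma> w y * U n w)"
    and x0: "x0 \<in> \<Omega>" and ev: "\<forall>\<^sub>F x in nhds x0. f x \<le> f x0 + p \<bullet> (x - x0) + K * (norm (x - x0))\<^sup>2"
    and eps: "\<epsilon> > 0" and e: "e > 0"
  obtains n x where "x \<in> nodes (\<Sigma> n) \<inter> \<Omega>" "dist x x0 < e"
    "\<And>y. y \<in> frontier (patch (\<Sigma> n) x) \<Longrightarrow> U n y \<le> U n x + p \<bullet> (y - x) + \<epsilon> * norm (x - y)"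
proof -
  obtain d where d: "d > 0" "cball x0 d \<subseteq> \<Omega>"
    "\<And>x. x \<in> cball x0 d \<Longrightarrow> f x - (p \<bullet> (x - x0) + (\<bar>K\<bar> + 1) * (norm (x - x0))\<^sup>2) \<le> f x0 - (norm (x - x0))\<^sup>2"
    using strict_quadratic_max[OF x0 ev] by blast
  define K1 where "K1 = \<bar>K\<bar> + 1"
  define \<psi> where "\<psi> x = p \<bullet> (x - x0) + K1 * (norm (x - x0))\<^sup>2" for x
  have K1: "K1 > 0" by (simp add: K1_def)
  \<comment> \<open>The bound \<open>d / 2\<close> keeps the neighbours of \<open>x\<close> inside
    \<open>cball x0 d\<close> once the mesh size is below \<open>e'\<close>; the last bound makes
    the interpolation error \<open>3 * (K1 * \<theta>) * e'\<close> at most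
    \<open>\<epsilon>\<close>.\<close>
  define e' where "e' = min e (min (d / 2) (\<epsilon> / (4 * (K1 * \<theta>))))"
  have K1t: "K1 * \<theta> > 0" using K1 theta by simp
  have e': "e' > 0" "e' \<le> e" "e' \<le> d / 2" "e' \<le> \<epsilon> / (4 * (K1 * \<theta>))"
    using e d(1) eps K1t by (auto simp: e'_def)
  have "\<forall>\<^sub>F n in sequentially. \<exists>x\<in>nodes (\<Sigma> n). dist x x0 < e' \<and>
      (\<forall>z\<in>nodes (\<Sigma> n) \<inter> cball x0 d. U n z - \<psi> z \<le> U n x - \<psi> x)"
  proof (rule approximate_maximizers)
    show "uniform_limit (closure \<Omega>) (\<lambda>n z. U n z - \<psi> z) (\<lambda>z. f z - \<psi> z) sequentially"
      by (intro uniform_limit_minus lim uniform_limit_const)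
    show "continuous_on (closure \<Omega>) (\<lambda>z. f z - \<psi> z)"
      unfolding \<psi>_def by (intro continuous_intros cont)
    show "cball x0 d \<subseteq> closure \<Omega>" using d(2) closure_subset by blast
    show "f x - \<psi> x \<le> f x0 - \<psi> x0 - (norm (x - x0))\<^sup>2" if "x \<in> cball x0 d" for x
      using d(3)[OF that] by (simp add: \<psi>_def K1_def)
    show "finite (nodes (\<Sigma> n))" for n by (rule D.finite_nodes)
    show "\<forall>\<^sub>F n in sequentially. \<exists>x\<in>nodes (\<Sigma> n). dist x x0 < e" if "e > 0" for e
      using nodes_dense[OF _ that] x0 closure_subset by blast
  qed (use d(1) e'(1) in auto)
  moreover have "\<forall>\<^sub>F n in sequentially. mesh_size (\<Sigma> n) < e'"
    by (rule order_tendstoD(2)[OF mesh_size_tendsto e'(1)])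
  ultimately have "\<forall>\<^sub>F n in sequentially. mesh_size (\<Sigma> n) < e' \<and> (\<exists>x\<in>nodes (\<Sigma> n). dist x x0 < e' \<and>
      (\<forall>z\<in>nodes (\<Sigma> n) \<inter> cball x0 d. U n z - \<psi> z \<le> U n x - \<psi> x))"
    by eventually_elim blast
  then obtain n x where h: "mesh_size (\<Sigma> n) < e'" and x: "x \<in> nodes (\<Sigma> n)" "dist x x0 < e'"
    and max: "\<And>z. z \<in> nodes (\<Sigma> n) \<inter> cball x0 d \<Longrightarrow> U n z - \<psi> z \<le> U n x - \<psi> x"
    using eventually_happens'[OF sequentially_bot] by blast
  have "x \<in> cball x0 d" using x(2) e'(1,3) by (simp add: dist_commute)
  then have xO: "x \<in> nodes (\<Sigma> n) \<inter> \<Omega>" using x(1) d(2) by blast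
  show ?thesis
  proof (rule that[of x n, OF xO])
    show "dist x x0 < e" using x(2) e'(2) by simp
    fix y assume y: "y \<in> frontier (patch (\<Sigma> n) x)"
    have "U n y \<le> U n x + p \<bullet> (y - x) + K1 * \<theta> * norm (x - y) * (2 * e' + e')"
    proof (rule D.node_quadratic_estimate[OF bary xO y _ less_imp_le[OF K1], where ?x0.0 = x0])
      fix \<sigma> w assume s: "\<sigma> \<in> \<Sigma> n" "x \<in> vertices \<sigma>" "w \<in> vertices \<sigma>"
      have "norm (w - x) \<le> diameter \<sigma>"
        using D.dist_le_diameter[OF s(1)] s vertices_subset by blast
      then have "norm (w - x) < e'" using diameter_le_mesh_size[OF s(1)] h by linarith
      then have "norm (w - x0) \<le> d"
        using norm_triangle_ineq[of "w - x" "x - x0"] x(2) e'(3) by (simp add: dist_norm)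
      then have "w \<in> nodes (\<Sigma> n) \<inter> cball x0 d"
        using D.vertex_nodes[OF s(1,3)] by (simp add: dist_norm norm_minus_commute)
      from max[OF this]
      show "U n w \<le> U n x + p \<bullet> (w - x) + K1 * ((norm (w - x0))\<^sup>2 - (norm (x - x0))\<^sup>2)"
        by (simp add: \<psi>_def inner_diff_right algebra_simps)
    next
      fix \<sigma> assume "\<sigma> \<in> \<Sigma> n"
      then show "diameter \<sigma> \<le> e'" using diameter_le_mesh_size h by fastforce
    next
      show "norm (x - x0) \<le> e'" using x(2) by (simp add: dist_norm)
    qed
    also have "K1 * \<theta> * norm (x - y) * (2 * e' + e') = (3 * (K1 * \<theta>) * e') * norm (x - y)" by simp
    also have "(3 * (K1 * \<theta>) * e') * norm (x - y) \<le> \<epsilon> * norm (x - y)"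
    proof (rule mult_right_mono)
      have "4 * (K1 * \<theta>) * e' \<le> \<epsilon>" using e'(4) K1t by (simp add: field_simps)
      moreover have "0 \<le> (K1 * \<theta>) * e'" using K1t e'(1) by simp
      ultimately show "3 * (K1 * \<theta>) * e' \<le> \<epsilon>" by linarith
    qed simp
    finally show "U n y \<le> U n x + p \<bullet> (y - x) + \<epsilon> * norm (x - y)" by simp
  qed
qed

context
  fixes uh :: "nat \<Rightarrow> 'a \<Rightarrow> real"
  assumes sol: "\<And>n. fe_solution \<Omega> H g (\<Sigma> n) (uh n)"
begin

lemma sub: "D.dsub n (uh n)" and sup: "D.dsup n (uh n)"
  and bd: "x \<in> nodes (\<Sigma> n) \<inter> frontier \<Omega> \<Longrightarrow> uh n x = g x"
  using sol unfolding fe_solution_iff by blast+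

lemma uh_bary: "\<sigma> \<in> \<Sigma> n \<Longrightarrow> y \<in> \<sigma> \<Longrightarrow> uh n y = (\<Sum>w\<in>vertices \<sigma>. bary \<sigma> w y * uh n w)"
  using sub D.fe_space_bary unfolding D.dsub_def by blast

text \<open>The discrete subsolution inequality holds for every competitor, so one is chosen along
  \<open>- q\<close>, where \<open>q\<close> is a direction in which the cost is smaller than
  \<open>p \<bullet> q\<close> by \<open>\<epsilon>\<close> per unit length. The nodal estimate
  loses only half of that margin.\<close>

lemma limit_subsolution:
  assumes lim: "uniform_limit (closure \<Omega>) uh w sequentially" and cont: "continuous_on (closure \<Omega>) w"
    and x0: "x0 \<in> \<Omega>" and ev: "\<forall>\<^sub>F x in nhds x0. w x \<le> w x0 + p \<bullet> (x - x0) + K * (norm (x - x0))\<^sup>2"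
  shows "H x0 p \<le> 0"
proof (rule ccontr)
  assume "\<not> H x0 p \<le> 0"
  then obtain q d \<epsilon> where q: "norm q = 1" "d > 0" "\<epsilon> > 0"
    "\<And>x t. \<lbrakk>x \<in> \<Omega>; dist x x0 < d; t \<ge> 0\<rbrakk> \<Longrightarrow> support_fun H x (t *\<^sub>R q) \<le> t * (p \<bullet> q - \<epsilon>)"
    using support_fun_separation[OF x0, of p] by (metis not_le)
  obtain n x where x: "x \<in> nodes (\<Sigma> n) \<inter> \<Omega>" "dist x x0 < d"
    and est: "\<And>y. y \<in> frontier (patch (\<Sigma> n) x) \<Longrightarrow> uh n y \<le> uh n x + p \<bullet> (y - x) + (\<epsilon> / 2) * norm (x - y)"
    using near_extremal_node[OF lim cont uh_bary x0 ev half_gt_zero[OF q(3)] q(2)] by blast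
  have "x \<in> interior (patch (\<Sigma> n) x)" using D.node_in_patch[OF x(1)] D.open_patch by (simp add: interior_open)
  moreover have "- q \<noteq> 0" using q(1) by auto
  ultimately obtain t where t: "0 < t" "x + t *\<^sub>R (- q) \<in> frontier (patch (\<Sigma> n) x)"
    using ray_to_frontier[OF D.bounded_patch] by blast
  define y where "y = x + t *\<^sub>R (- q)"
  have xy: "x - y = t *\<^sub>R q" by (simp add: y_def)
  have "uh n x \<le> uh n y + support_fun H x (x - y)"
    using sub[of n] x(1) t(2) unfolding D.dsub_def y_def by blast
  also have "support_fun H x (x - y) \<le> t * (p \<bullet> q - \<epsilon>)"
    unfolding xy using q(4) x t(1) by auto
  also have "uh n y \<le> uh n x + p \<bullet> (y - x) + (\<epsilon> / 2) * norm (x - y)" using est t(2) y_def by blast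
  also have "p \<bullet> (y - x) = - t * (p \<bullet> q)" by (simp add: y_def)
  also have "norm (x - y) = t" using t(1) q(1) by (simp add: xy)
  finally have "0 \<le> - (\<epsilon> * t) / 2" by (simp add: algebra_simps)
  then show False using mult_pos_pos[OF q(3) t(1)] by linarith
qed

text \<open>Here the competitor \<open>y\<close> is given and cannot be chosen, so the margin is
  needed in every direction; \<open>support_fun_ge_near\<close> supplies it. The nodal estimate is
  applied to \<open>- uh n\<close>.\<close>

lemma limit_supersolution:
  assumes lim: "uniform_limit (closure \<Omega>) uh w sequentially" and cont: "continuous_on (closure \<Omega>) w"
    and x0: "x0 \<in> \<Omega>" and ev: "\<forall>\<^sub>F x in nhds x0. w x0 + p \<bullet> (x - x0) - K * (norm (x - x0))\<^sup>2 \<le> w x"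
  shows "H x0 p \<ge> 0"
proof (rule ccontr)
  assume "\<not> H x0 p \<ge> 0"
  then obtain d \<epsilon> where d: "d > 0" "\<epsilon> > 0"
    "\<And>x q. \<lbrakk>x \<in> \<Omega>; dist x x0 < d\<rbrakk> \<Longrightarrow> p \<bullet> q + \<epsilon> * norm q \<le> support_fun H x q"
    using support_fun_ge_near[OF x0, of p] by (metis not_le)
  have ev': "\<forall>\<^sub>F x in nhds x0. - w x \<le> - w x0 + (- p) \<bullet> (x - x0) + K * (norm (x - x0))\<^sup>2"
    using ev by eventually_elim simp
  have bary': "- uh n y = (\<Sum>w\<in>vertices \<sigma>. bary \<sigma> w y * - uh n w)" if "\<sigma> \<in> \<Sigma> n" "y \<in> \<sigma>" for n \<sigma> y
    using uh_bary[OF that] by (simp add: sum_negf)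
  obtain n x where x: "x \<in> nodes (\<Sigma> n) \<inter> \<Omega>" "dist x x0 < d"
    and est: "\<And>y. y \<in> frontier (patch (\<Sigma> n) x) \<Longrightarrow> - uh n y \<le> - uh n x + (- p) \<bullet> (y - x) + (\<epsilon> / 2) * norm (x - y)"
    using near_extremal_node[OF uniform_limit_uminus[OF lim] continuous_on_minus[OF cont] bary' x0 ev' half_gt_zero[OF d(2)] d(1)]
    by blast
  obtain y where y: "y \<in> frontier (patch (\<Sigma> n) x)" "uh n y + support_fun H x (x - y) \<le> uh n x"
    using sup[of n] x(1) unfolding D.dsup_def by blast
  have "p \<bullet> (x - y) + \<epsilon> * norm (x - y) \<le> support_fun H x (x - y)" using d(3) x by blast
  then have "\<epsilon> * norm (x - y) \<le> \<epsilon> / 2 * norm (x - y)"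
    using est[OF y(1)] y(2) by (simp add: inner_diff_right)
  moreover have "norm (x - y) > 0" using D.not_in_frontier_patch[OF x(1)] y(1) by auto
  ultimately show False using d(2) by simp
qed

text \<open>The same constant and affine barriers serve every mesh, and the slope depends only on
  the dimension, \<open>\<theta>\<close>, \<open>R\<close> and
  \<open>\<rho>\<^sub>s\<close>.\<close>

lemma uniform_bounds:
  obtains M B where "M \<ge> 0" "\<And>n. segment_lipschitz M (closure \<Omega>) (uh n)"
    "\<And>n x. x \<in> closure \<Omega> \<Longrightarrow> \<bar>uh n x\<bar> \<le> B"
    "\<And>n z. z \<in> frontier \<Omega> \<Longrightarrow> \<bar>uh n z - g z\<bar> \<le> M * mesh_size (\<Sigma> n)"
proof -
  obtain a :: 'a where "a \<in> Basis" using nonempty_Basis by blast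
  then have a: "norm a = 1" by simp
  have "compact (closure \<Omega>)" using bounded_domain by (simp add: compact_closure)
  then obtain E where E: "E > 0" "\<And>x. x \<in> closure \<Omega> \<Longrightarrow> norm x \<le> E"
    using compact_imp_bounded bounded_pos by metis
  have fr: "frontier \<Omega> \<subseteq> closure \<Omega>" by (auto simp: frontier_def)
  have "frontier \<Omega> \<noteq> {}"
    using domain_ne bounded_domain not_bounded_UNIV frontier_eq_empty by metis
  then obtain z where z: "z \<in> frontier \<Omega>" by blast
  define G where "G = \<bar>g z\<bar> + \<rho>\<^sub>s / \<theta> * (2 * E)"
  have c0: "0 \<le> \<rho>\<^sub>s / \<theta>" using theta rho by simp
  have gG: "\<bar>g x\<bar> \<le> G" if "x \<in> frontier \<Omega>" for x
  proof -
    have "norm (x - z) \<le> 2 * E"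
      using norm_triangle_ineq4[of x z] E(2)[of x] E(2)[of z] that z fr by fastforce
    then have "\<rho>\<^sub>s / \<theta> * norm (x - z) \<le> \<rho>\<^sub>s / \<theta> * (2 * E)" using c0 by (rule mult_left_mono)
    then show ?thesis using boundary_data[OF that z] boundary_data[OF z that]
      unfolding G_def norm_minus_commute[of z x] by linarith
  qed
  \<comment> \<open>Lifts the affine barrier above \<open>g\<close>: on the closure its linear part
    is at least \<open>- (R * E)\<close>, and \<open>g\<close> is at most \<open>G\<close>.\<close>
  define C where "C = G + R * E"
  have Rp: "R > 0" by (rule D.R_pos)
  have ax: "\<bar>R * (a \<bullet> x)\<bar> \<le> R * E" if "x \<in> closure \<Omega>" for x
  proof -
    have "\<bar>a \<bullet> x\<bar> \<le> E" using Cauchy_Schwarz_ineq2[of a x] a E(2)[OF that] by simp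
    then show ?thesis using Rp by (simp add: abs_mult)
  qed
  have upper: "uh n x \<le> G + 2 * (R * E)" if x: "x \<in> closure \<Omega>" for n x
  proof -
    have "g b \<le> R * (a \<bullet> b) + C" if "b \<in> frontier \<Omega>" for b
      using gG[OF that] ax[of b] that fr unfolding C_def by (smt (verit, ccfv_threshold) subsetD)
    then have "uh n x \<le> R * (a \<bullet> x) + C"
      using D.solution_le_affine[OF sub sup bd a _ x] by blast
    then show ?thesis using ax[OF x] by (simp add: C_def)
  qed
  have lower: "- G \<le> uh n x" if x: "x \<in> closure \<Omega>" for n x
  proof (rule D.solution_ge_const[OF sub sup bd _ x])
    show "- G \<le> g b" if "b \<in> frontier \<Omega>" for b using gG[OF that] by linarith
  qed
  define S where "S = real (DIM('a) + 1) * (\<theta> * (R + \<rho>\<^sub>s))"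
  have S0: "S \<ge> 0" using theta rho Rp by (simp add: S_def)
  show ?thesis
  proof (rule that[of "S + \<rho>\<^sub>s" "G + 2 * (R * E)"])
    show M0: "S + \<rho>\<^sub>s \<ge> 0" using S0 rho by simp
    show "segment_lipschitz (S + \<rho>\<^sub>s) (closure \<Omega>) (uh n)" for n
    proof -
      have "segment_lipschitz S (closure \<Omega>) (uh n)"
        using D.solution_segment_lipschitz[OF sub sup bd S_def] .
      moreover have "S * norm (x - y) \<le> (S + \<rho>\<^sub>s) * norm (x - y)" for x y :: 'a
        using rho by (intro mult_right_mono) auto
      ultimately show ?thesis using M0 unfolding segment_lipschitz_def by (meson order_trans)
    qed
    show "\<bar>uh n x\<bar> \<le> G + 2 * (R * E)" if "x \<in> closure \<Omega>" for n x
    proof -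
      have "0 \<le> R * E" using Rp E(1) by simp
      then show ?thesis using upper[OF that, of n] lower[OF that, of n] by linarith
    qed
    show "\<bar>uh n z - g z\<bar> \<le> (S + \<rho>\<^sub>s) * mesh_size (\<Sigma> n)" if "z \<in> frontier \<Omega>" for n z
      by (rule D.solution_near_boundary[OF sub sup bd S_def that diameter_le_mesh_size])
  qed
qed

lemma convergent_subsequence:
  obtains k w where "strict_mono (k :: nat \<Rightarrow> nat)" "w \<in> extensional (closure \<Omega>)"
    "uniform_limit (closure \<Omega>) (uh \<circ> k) w sequentially" "\<exists>L. L-lipschitz_on (closure \<Omega>) w"
    "\<And>z. z \<in> frontier \<Omega> \<Longrightarrow> w z = g z"
proof -
  obtain M B where M: "M \<ge> 0" "\<And>n. segment_lipschitz M (closure \<Omega>) (uh n)"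
    "\<And>n x. x \<in> closure \<Omega> \<Longrightarrow> \<bar>uh n x\<bar> \<le> B"
    "\<And>n z. z \<in> frontier \<Omega> \<Longrightarrow> \<bar>uh n z - g z\<bar> \<le> M * mesh_size (\<Sigma> n)"
    using uniform_bounds by blast
  obtain L where "\<And>f. \<lbrakk>segment_lipschitz M (closure \<Omega>) f; \<And>x. x \<in> closure \<Omega> \<Longrightarrow> \<bar>f x\<bar> \<le> B\<rbrakk>
    \<Longrightarrow> L-lipschitz_on (closure \<Omega>) f"
    using lipschitz_domain_uniform_lipschitz[OF open_domain bounded_domain lipschitz_domain M(1), of B] by blast
  then have L: "L-lipschitz_on (closure \<Omega>) (uh n)" for n using M(2,3) by blast
  have L0: "L \<ge> 0" using L lipschitz_on_nonneg by blast
  have comp: "compact (closure \<Omega>)" using bounded_domain by (simp add: compact_closure)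
  have equi: "\<exists>d>0. \<forall>n y. y \<in> closure \<Omega> \<and> norm (x - y) < d \<longrightarrow> norm (uh n x - uh n y) < e"
    if x: "x \<in> closure \<Omega>" and e: "0 < e" for x e
  proof (intro exI[of _ "e / (L + 1)"] conjI allI impI)
    show "e / (L + 1) > 0" using e L0 by simp
    fix n y assume y: "y \<in> closure \<Omega> \<and> norm (x - y) < e / (L + 1)"
    have "norm (uh n x - uh n y) \<le> L * norm (x - y)"
      using lipschitz_onD[OF L x, of y n] y by (simp add: dist_norm)
    also have "\<dots> \<le> (L + 1) * norm (x - y)" by (simp add: distrib_right)
    also have "\<dots> < e" using y L0 by (simp add: pos_less_divide_eq mult.commute)
    finally show "norm (uh n x - uh n y) < e" .
  qed
  have bdd: "norm (uh n x) \<le> B" if "x \<in> closure \<Omega>" for n x using M(3)[OF that] by simp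
  obtain w0 k where k: "strict_mono (k :: nat \<Rightarrow> nat)"
    and conv: "\<And>e. 0 < e \<Longrightarrow> \<exists>N. \<forall>n x. n \<ge> N \<and> x \<in> closure \<Omega> \<longrightarrow> norm (uh (k n) x - w0 x) < e"
    using Arzela_Ascoli[OF comp bdd equi] by metis
  define w where "w = restrict w0 (closure \<Omega>)"
  have lim: "uniform_limit (closure \<Omega>) (uh \<circ> k) w sequentially"
  proof (rule uniform_limitI)
    fix e :: real assume "0 < e"
    then obtain N where "\<forall>n x. n \<ge> N \<and> x \<in> closure \<Omega> \<longrightarrow> norm (uh (k n) x - w0 x) < e" using conv by blast
    then show "\<forall>\<^sub>F n in sequentially. \<forall>x\<in>closure \<Omega>. dist ((uh \<circ> k) n x) (w x) < e"
      unfolding eventually_sequentially by (intro exI[of _ N]) (auto simp: w_def dist_norm)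
  qed
  have pt: "(\<lambda>n. uh (k n) x) \<longlonglongrightarrow> w x" if "x \<in> closure \<Omega>" for x
    using tendsto_uniform_limitI[OF lim that] by (simp add: o_def)
  have "L-lipschitz_on (closure \<Omega>) w"
  proof (rule lipschitz_onI[OF _ L0])
    fix x y assume xy: "x \<in> closure \<Omega>" "y \<in> closure \<Omega>"
    have "(\<lambda>n. dist (uh (k n) x) (uh (k n) y)) \<longlonglongrightarrow> dist (w x) (w y)"
      by (intro tendsto_dist pt xy)
    then show "dist (w x) (w y) \<le> L * dist x y"
      by (rule LIMSEQ_le_const2) (use lipschitz_onD[OF L xy] in auto)
  qed
  moreover have "w z = g z" if z: "z \<in> frontier \<Omega>" for z
  proof (rule LIMSEQ_unique[OF pt])
    show "z \<in> closure \<Omega>" using z by (simp add: frontier_def)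
    have "(\<lambda>n. M * mesh_size (\<Sigma> (k n))) \<longlonglongrightarrow> M * 0"
      using LIMSEQ_subseq_LIMSEQ[OF mesh_size_tendsto k] by (intro tendsto_mult_left) (simp add: o_def)
    then have null: "(\<lambda>n. M * mesh_size (\<Sigma> (k n))) \<longlonglongrightarrow> 0" by simp
    have "(\<lambda>n. uh (k n) z - g z) \<longlonglongrightarrow> 0"
      by (rule Lim_null_comparison[OF _ null]) (use M(4)[OF z] in auto)
    then show "(\<lambda>n. uh (k n) z) \<longlonglongrightarrow> g z" by (rule LIM_zero_cancel)
  qed
  moreover have "w \<in> extensional (closure \<Omega>)" by (simp add: w_def)
  ultimately show ?thesis using that k lim by blast
qed

end

text \<open>Lets the limit lemmas, stated for a whole sequence of meshes, be applied along
  subsequences.\<close>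

lemma subsequence:
  assumes "strict_mono (k :: nat \<Rightarrow> nat)"
  shows "hamilton_jacobi_discretizations \<Omega> H R (\<Sigma> \<circ> k) \<theta> \<rho>\<^sub>s g"
proof
  show "(\<lambda>n. mesh_size ((\<Sigma> \<circ> k) n)) \<longlonglongrightarrow> 0"
    using LIMSEQ_subseq_LIMSEQ[OF mesh_size_tendsto assms] by (simp add: o_def)
qed (use theta triangulations regular rho support_ge boundary_data in auto)

lemma subsequence_tendsto_viscosity_solution:
  assumes "\<And>n. fe_solution \<Omega> H g (\<Sigma> n) (uh n)"
  obtains k w where "strict_mono (k :: nat \<Rightarrow> nat)" "dirichlet_viscosity_solution \<Omega> H g w"
    "uniform_limit (closure \<Omega>) (uh \<circ> k) w sequentially"
proof -
  obtain k w where k: "strict_mono (k :: nat \<Rightarrow> nat)" and w: "w \<in> extensional (closure \<Omega>)"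
    "uniform_limit (closure \<Omega>) (uh \<circ> k) w sequentially" "\<exists>L. L-lipschitz_on (closure \<Omega>) w"
    "\<And>z. z \<in> frontier \<Omega> \<Longrightarrow> w z = g z"
    using convergent_subsequence[OF assms] by blast
  have cont: "continuous_on (closure \<Omega>) w" using w(3) lipschitz_on_continuous_on by blast
  interpret K: hamilton_jacobi_discretizations \<Omega> H R "\<Sigma> \<circ> k" \<theta> \<rho>\<^sub>s g by (rule subsequence[OF k])
  have sol: "fe_solution \<Omega> H g ((\<Sigma> \<circ> k) n) ((uh \<circ> k) n)" for n using assms by simp
  have "viscosity_subsolution \<Omega> H w"
    unfolding viscosity_subsolution_iff_jet[OF open_domain]
    using w(3) K.limit_subsolution[OF sol w(2) cont] by blast
  moreover have "viscosity_supersolution \<Omega> H w"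
    unfolding viscosity_supersolution_iff_jet[OF open_domain]
    using w(3) K.limit_supersolution[OF sol w(2) cont] by blast
  ultimately have "dirichlet_viscosity_solution \<Omega> H g w"
    using w(1,4) by (simp add: dirichlet_viscosity_solution_def)
  then show ?thesis using that[OF k] w(2) by blast
qed

end

section \<open>Uniqueness and convergence of the whole sequence\<close>

lemma (in hamilton_jacobi) dirichlet_viscosity_solution_unique:
  assumes u: "dirichlet_viscosity_solution \<Omega> H g u" and v: "dirichlet_viscosity_solution \<Omega> H g v"
  shows "u = v"
proof -
  have le: "u z \<le> v z" if u: "dirichlet_viscosity_solution \<Omega> H g u" and v: "dirichlet_viscosity_solution \<Omega> H g v"
    and z: "z \<in> closure \<Omega>" for u v z
  proof -
    obtain Lu where Lu: "Lu-lipschitz_on (closure \<Omega>) u"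
      using u by (auto simp: dirichlet_viscosity_solution_def viscosity_subsolution_def)
    obtain Lv where Lv: "Lv-lipschitz_on (closure \<Omega>) v"
      using v by (auto simp: dirichlet_viscosity_solution_def viscosity_subsolution_def)
    have su: "viscosity_subsolution \<Omega> H u" and sv: "viscosity_supersolution \<Omega> H v"
      using u v by (auto simp: dirichlet_viscosity_solution_def)
    show ?thesis
    proof (rule viscosity_comparison_jets[OF open_domain bounded_domain H_continuous H_convex H_neg Lu Lv _ _ _ z])
      fix x0 p K assume "x0 \<in> \<Omega>" "\<forall>\<^sub>F x in nhds x0. u x \<le> u x0 + p \<bullet> (x - x0) + K * (norm (x - x0))\<^sup>2"
      then show "H x0 p \<le> 0" using su unfolding viscosity_subsolution_iff_jet[OF open_domain] by blast
    next
      fix x0 p K assume "x0 \<in> \<Omega>" "\<forall>\<^sub>F x in nhds x0. v x0 + p \<bullet> (x - x0) - K * (norm (x - x0))\<^sup>2 \<le> v x"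
      then show "H x0 p \<ge> 0" using sv unfolding viscosity_supersolution_iff_jet[OF open_domain] by blast
    next
      fix x assume "x \<in> frontier \<Omega>"
      then show "u x \<le> v x" using u v by (simp add: dirichlet_viscosity_solution_def)
    qed
  qed
  show ?thesis
  proof (rule extensionalityI)
    show "u \<in> extensional (closure \<Omega>)" "v \<in> extensional (closure \<Omega>)"
      using u v by (auto simp: dirichlet_viscosity_solution_def)
    show "u x = v x" if "x \<in> closure \<Omega>" for x using le[OF u v that] le[OF v u that] by simp
  qed
qed

text \<open>Subsequence principle: indices at which the distance to \<open>u\<close> is not small
  would form a sequence of meshes of their own, with a further subsequence converging to a viscosity
  solution, which is \<open>u\<close> by uniqueness.\<close>

lemma (in hamilton_jacobi_discretizations) fe_solutions_converge:
  assumes uh: "\<And>n. fe_solution \<Omega> H g (\<Sigma> n) (uh n)" and u: "dirichlet_viscosity_solution \<Omega> H g u"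
  shows "uniform_limit (closure \<Omega>) uh u sequentially"
proof (rule ccontr)
  assume "\<not> ?thesis"
  then obtain e where e: "e > 0" "\<not> (\<forall>\<^sub>F n in sequentially. \<forall>x\<in>closure \<Omega>. dist (uh n x) (u x) < e)"
    unfolding uniform_limit_iff by blast
  define A where "A = {n. \<not> (\<forall>x\<in>closure \<Omega>. dist (uh n x) (u x) < e)}"
  have "infinite A"
    using e(2) unfolding A_def by (simp add: not_eventually frequently_cofinite flip: cofinite_eq_sequentially)
  then obtain k :: "nat \<Rightarrow> nat" where k: "strict_mono k" "\<And>n. k n \<in> A"
    using infinite_enumerate by blast
  interpret K: hamilton_jacobi_discretizations \<Omega> H R "\<Sigma> \<circ> k" \<theta> \<rho>\<^sub>s g by (rule subsequence[OF k(1)])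
  have "fe_solution \<Omega> H g ((\<Sigma> \<circ> k) n) ((uh \<circ> k) n)" for n using uh by simp
  then obtain l w where l: "strict_mono (l :: nat \<Rightarrow> nat)" "dirichlet_viscosity_solution \<Omega> H g w"
    "uniform_limit (closure \<Omega>) ((uh \<circ> k) \<circ> l) w sequentially"
    using K.subsequence_tendsto_viscosity_solution by blast
  have "w = u" using dirichlet_viscosity_solution_unique l(2) u by blast
  then have "\<forall>\<^sub>F n in sequentially. \<forall>x\<in>closure \<Omega>. dist (uh (k (l n)) x) (u x) < e"
    using uniform_limitD[OF l(3) e(1)] by (simp add: o_def)
  then obtain n where "\<forall>x\<in>closure \<Omega>. dist (uh (k (l n)) x) (u x) < e"
    using eventually_happens'[OF sequentially_bot] by blast
  then show False using k(2)[of "l n"] by (simp add: A_def)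
qed

theorem theorem11:
  fixes \<Omega> :: "'a::euclidean_space set"
    and H :: "'a \<Rightarrow> 'a \<Rightarrow> real"
    and g :: "'a \<Rightarrow> real"
    and \<Sigma> :: "nat \<Rightarrow> 'a set set"
    and \<theta> \<rho>\<^sub>s :: real
  assumes "bounded \<Omega>" and "polytopal_lipschitz_domain \<Omega>"
    and "continuous_on (closure \<Omega> \<times> UNIV) (\<lambda>(x, p). H x p)"
    and "\<And>x. x \<in> closure \<Omega> \<Longrightarrow> convex_on UNIV (H x)"
    and "\<And>M. \<forall>\<^sub>F p in at_infinity. \<forall>x\<in>closure \<Omega>. M \<le> H x p"
    and "\<And>x. x \<in> \<Omega> \<Longrightarrow> H x 0 < 0"
    and "\<theta> \<ge> 1"
    and "\<And>n. triangulation_of \<Omega> (\<Sigma> n)"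
    and "\<And>n. shape_regular \<theta> (\<Sigma> n)"
    and "(\<lambda>n. mesh_size (\<Sigma> n)) \<longlonglongrightarrow> 0"
    and "\<rho>\<^sub>s \<ge> 0"
    and "\<And>x q. x \<in> \<Omega> \<Longrightarrow> \<rho>\<^sub>s * norm q \<le> support_fun H x q"
    and "\<And>x y. x \<in> frontier \<Omega> \<Longrightarrow> y \<in> frontier \<Omega> \<Longrightarrow> g x - g y \<le> \<rho>\<^sub>s / \<theta> * norm (x - y)"
  shows "(\<forall>n. \<exists>!u. fe_solution \<Omega> H g (\<Sigma> n) u) \<and>
         (\<exists>!u. dirichlet_viscosity_solution \<Omega> H g u) \<and>
         (\<forall>uh u. (\<forall>n. fe_solution \<Omega> H g (\<Sigma> n) (uh n)) \<longrightarrow>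
                 dirichlet_viscosity_solution \<Omega> H g u \<longrightarrow>
                 uniform_limit (closure \<Omega>) uh u sequentially)"
proof -
  have \<Omega>: "open \<Omega>" "\<Omega> \<noteq> {}" "lipschitz_boundary \<Omega>"
    using assms(2) by (auto simp: polytopal_lipschitz_domain_def)
  \<comment> \<open>Taking the level 1 in the coercivity puts all sets where
    \<open>H x p \<le> 0\<close> into one ball, uniformly in \<open>x\<close>.\<close>
  obtain R where R: "\<And>p x. R \<le> norm p \<Longrightarrow> x \<in> closure \<Omega> \<Longrightarrow> 1 \<le> H x p"
    using assms(5)[of 1] by (auto simp: eventually_at_infinity)
  have coercive: "norm p \<le> R" if "x \<in> \<Omega>" "H x p \<le> 0" for x p
  proof (rule ccontr)
    assume "\<not> norm p \<le> R"
    then have "1 \<le> H x p" using R[of p x] that(1) closure_subset by auto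
    then show False using that(2) by simp
  qed
  have convex: "convex_on UNIV (H x)" if "x \<in> \<Omega>" for x
    using assms(4) closure_subset that by blast
  interpret hamilton_jacobi_discretizations \<Omega> H R \<Sigma> \<theta> \<rho>\<^sub>s g
    by (rule hamilton_jacobi_discretizations.intro[OF
          hamilton_jacobi.intro[OF \<Omega>(1) assms(1) \<Omega>(2,3) assms(3) convex assms(6) coercive]
          hamilton_jacobi_discretizations_axioms.intro[OF assms(7-13)]])
  obtain uh where uh: "\<And>n. fe_solution \<Omega> H g (\<Sigma> n) (uh n)"
    using fe_solution_ex1 by metis
  \<comment> \<open>Existence for the Dirichlet problem: the limit of a subsequence of discrete
    solutions.\<close>
  obtain w where "dirichlet_viscosity_solution \<Omega> H g w"
    using subsequence_tendsto_viscosity_solution[OF uh] by blast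
  then show ?thesis
    using fe_solution_ex1 dirichlet_viscosity_solution_unique fe_solutions_converge by blast
qed

end
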